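(* Let $I$ be a finite totally ordered set, $s:I\to\mathcal T(W)$ a sequence of reflections, $R$ a nested structure on $I$, $v:R\to W$ a map, and $F=\{f^1<f^2<\cdots<f^{\mathfrak n}\}\subset R$ a nonempty subset such that the intervals $[f]$, $f\in F$, are pairwise disjoint. Then the projection along $F$, $$p^F:\mathrm{BS}_c(s,v)\to\mathrm{BS}_c(s^F,v^F),$$ is a fibre bundle with fibre $$\mathrm{BS}_c(s|_{[f^1]},v|_{R_{f^1}})\times\cdots\times\mathrm{BS}_c(s|_{[f^{\mathfrak n}]},v|_{R_{f^{\mathfrak n}}}).$$
   Context: Groups. $G$ is a semisimple complex (Chevalley) group with root system $\Phi$, generated by root elements $x_\alpha(t)$ ($\alpha\in\Phi$, $t\in\mathbb C$). Put $w_\alpha(t)=x_\alpha(t)x_{-\alpha}(-t^{-1})x_\alpha(t)$, $\omega_\alpha=w_\alpha(1)$, $h_\alpha(t)=w_\alpha(t)\omega_\alpha^{-1}$; $T$ is the maximal torus generated by all $h_\alpha(t)$. Let $\sigma$ be the analytic automorphism of $G$ with $\sigma(x_\alpha(t))=x_{-\alpha}(-\bar t)$, $C=G^\sigma$ (maximal compact subgroup), $K=T^\sigma$ (compact torus). $W$ is the Weyl group, $s_\alpha$ the reflection of $\alpha$, $\mathcal T(W)=\{s_\alpha\mid\alpha\in\Phi\}$. Let $\varphi_\alpha:\mathrm{SL}_2(\mathbb C)\to G$ be the homomorphism sending upper/lower unitriangular matrices with entry $t$ to $x_\alpha(t)$/$x_{-\alpha}(t)$; $C_{s_\alpha}=\varphi_\alpha(\mathrm{SU}_2)K$,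 a compact subgroup depending only on $s_\alpha$. Let $\mathcal N\subset C$ be generated by all $\omega_\alpha$ and $K$; there is an isomorphism $W\cong\mathcal N/K$, $s_\alpha\mapsto\omega_\alpha K$. Fix a representative $\dot w\in\mathcal N$ of every $w\in W$ and write $wK=\dot wK$. Spaces. For a finite totally ordered set $I$ ($-\infty$ and $+\infty$ are added as elements below and above all elements of $I$; $i\pm1$ denotes the next/previous element) and $s:I\to\mathcal T(W)$, put $C(s)=\prod_{i\in I}C_{s_i}$ and let $K(I)=\prod_{i\in I}K$ act on the right by $(ck)_i=k_{i-1}^{-1}c_ik_i$ with $k_{-\infty}=1$. $\mathrm{BS}_c(s)=C(s)/K(I)$ (quotient topology), and $[c]$ is the class of $c$. Nested structures. For $r=(r_1,r_2)\in I^2$ put $[r]=\{k\in I\mid r_1\le k\le r_2\}$. A subset $R\subset I^2$ is a nested structure on $I$ if $r_1\le r_2$ for all $r\in R$; $\{r_1,r_2\}\cap\{r_1',r_2'\}=\emptyset$ for distinct $r,r'\in R$; and for any $r,r'\in R$ the intervals $[r],[r']$ are either disjoint or one contains the other. Write $r\subset r'$ if $[r]\subset[r']$ and $r<r'$ if $r_2<r_1'$. For $v:R\to W$ let $C(s,v)=\{c\in C(s)\mid c_{r_1}c_{r_1+1}\cdots c_{r_2}\in v_rK\ \forall r\in R\}$ and $\mathrm{BS}_c(s,v)=\{[c]\mid c\in C(s,v)\}\subset\mathrm{BS}_c(s)$ with the subspace topology. Projection. For $F$ as in the claim: $I^F=I\setminus\bigcup_{f\in F}[f]$, $R^F=R\setminus\{r\in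 R\mid\exists f\in F: r\subset f\}$ (a nested structure on $I^F$). For $i\in I^F$ choose $m\in\{0,\dots,\mathfrak n\}$ with $f^m_2<i<f^{m+1}_1$ (with $f^0_2=-\infty$, $f^{\mathfrak n+1}_1=+\infty$), and put $v^i=v_{f^1}\cdots v_{f^m}$, $\dot v^i=\dot v_{f^1}\cdots\dot v_{f^m}$. Define $s^F:I^F\to\mathcal T(W)$ and $v^F:R^F\to W$ by $s^F_i=v^is_i(v^i)^{-1}$, $v^F_r=v^{r_1}v_r(v^{r_2})^{-1}$. A sequence $c\in C(s,v)$ is $F$-balanced if $c_{f_1}c_{f_1+1}\cdots c_{f_2}=\dot v_f$ for all $f\in F$; every element of $\mathrm{BS}_c(s,v)$ is $[c]$ for some $F$-balanced $c$. For $F$-balanced $c$ put $c^F_i=\dot v^ic_i(\dot v^i)^{-1}$ ($i\in I^F$) and $p^F([c])=[c^F]$; this is a well-defined map $\mathrm{BS}_c(s,v)\to\mathrm{BS}_c(s^F,v^F)$. For $f\in F$, $R_f=\{r\in R\mid r\subset f\}$, a nested structure on $[f]$. *)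

theory Defs
  imports "HOL-Analysis.Analysis" "HOL-Algebra.Generated_Groups"
begin

section \<open>Root systems and Weyl groups\<close>

definition reflection :: "'e::euclidean_space \<Rightarrow> 'e \<Rightarrow> 'e" where
  "reflection \<alpha> x = x - (2 * (x \<bullet> \<alpha>) / (\<alpha> \<bullet> \<alpha>)) *\<^sub>R \<alpha>"

text \<open>Reduced crystallographic root systems.\<close>

definition root_system :: "'e::euclidean_space set \<Rightarrow> bool" where
  "root_system \<Phi> \<longleftrightarrow> finite \<Phi> \<and> span \<Phi> = UNIV \<and> 0 \<notin> \<Phi> \<and>
     (\<forall>\<alpha>\<in>\<Phi>. reflection \<alpha> ` \<Phi> = \<Phi>) \<and>
     (\<forall>\<alpha>\<in>\<Phi>. \<forall>\<beta>\<in>\<Phi>. 2 * (\<beta> \<bullet> \<alpha>) / (\<alpha> \<bullet> \<alpha>) \<in> \<int>) \<and>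
     (\<forall>\<alpha>\<in>\<Phi>. \<forall>c. c *\<^sub>R \<alpha> \<in> \<Phi> \<longrightarrow> c = 1 \<or> c = - 1)"

definition reflections :: "'e::euclidean_space set \<Rightarrow> ('e \<Rightarrow> 'e) set" where
  "reflections \<Phi> = reflection ` \<Phi>"

definition perm_group :: "('a \<Rightarrow> 'a) monoid" where
  "perm_group = \<lparr>carrier = {w. bij w}, mult = (\<circ>), one = id\<rparr>"

definition weyl_group :: "'e::euclidean_space set \<Rightarrow> ('e \<Rightarrow> 'e) monoid" where
  "weyl_group \<Phi> = perm_group\<lparr>carrier := generate perm_group (reflections \<Phi>)\<rparr>"


section \<open>Matrix groups\<close>

definition GL :: "(complex^'n^'n) monoid" where
  "GL = \<lparr>carrier = {A. invertible A}, mult = (**), one = mat 1\<rparr>"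

definition SL2 :: "(complex^2^2) monoid" where
  "SL2 = \<lparr>carrier = {A. det A = 1}, mult = (**), one = mat 1\<rparr>"

definition SU2 :: "(complex^2^2) set" where
  "SU2 = {A. det A = 1 \<and> A ** map_matrix cnj (transpose A) = mat 1}"

definition upper_unitri :: "complex \<Rightarrow> complex^2^2" where
  "upper_unitri t = vector [vector [1, t], vector [0, 1]]"

definition lower_unitri :: "complex \<Rightarrow> complex^2^2" where
  "lower_unitri t = vector [vector [1, 0], vector [t, 1]]"

definition commutator :: "complex^'n^'n \<Rightarrow> complex^'n^'n \<Rightarrow> complex^'n^'n" where
  "commutator A B = A ** B - B ** A"

definition matrix_exp :: "complex \<Rightarrow> complex^'n^'n \<Rightarrow> complex^'n^'n" where
  \<comment> \<open>the exponential of \<open>t A\<close>\<close>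
  "matrix_exp t A = (\<Sum>k. map_matrix ((*) (t ^ k / fact k)) ((((**) A) ^^ k) (mat 1)))"

definition mprod :: "(complex^'n^'n) list \<Rightarrow> complex^'n^'n" where
  "mprod As = foldr (**) As (mat 1)"


section \<open>Chevalley groups over the complex numbers\<close>

text \<open>
  A Chevalley basis of a semisimple complex Lie algebra with root system \<open>\<Phi>\<close>, in a faithful
  representation on \<open>\<complex>\<^sup>n\<close>. The map \<open>H\<close> sends the coroot \<open>2\<alpha>/(\<alpha>,\<alpha>)\<close> to \<open>[X\<^sub>\<alpha>, X\<^sub>-\<^sub>\<alpha>]\<close>; its linearity
  expresses that the latter are integral combinations, with the same coefficients as in the
  coroot system, of those belonging to simple roots. The number \<open>r\<close> is the largest one such that
  \<open>\<beta> - r\<alpha>\<close> is a root. Given the relations, \<open>X\<^sub>\<alpha> \<noteq> 0\<close> for all \<open>\<alpha>\<close> says that the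
  representation is faithful.
\<close>

definition chevalley_system :: "'e::euclidean_space set \<Rightarrow> ('e \<Rightarrow> complex^'n^'n) \<Rightarrow> bool" where
  "chevalley_system \<Phi> X \<longleftrightarrow>
     (\<forall>\<alpha>\<in>\<Phi>. X \<alpha> \<noteq> 0) \<and>
     (\<exists>H. linear H \<and>
        (\<forall>x y. commutator (H x) (H y) = 0) \<and>
        (\<forall>x. \<forall>\<alpha>\<in>\<Phi>. commutator (H x) (X \<alpha>) = (x \<bullet> \<alpha>) *\<^sub>R X \<alpha>) \<and>
        (\<forall>\<alpha>\<in>\<Phi>. commutator (X \<alpha>) (X (- \<alpha>)) = H ((2 / (\<alpha> \<bullet> \<alpha>)) *\<^sub>R \<alpha>))) \<and>
     (\<forall>\<alpha>\<in>\<Phi>. \<forall>\<beta>\<in>\<Phi>. \<alpha> + \<beta> \<noteq> 0 \<longrightarrow>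
        (if \<alpha> + \<beta> \<in> \<Phi>
         then let r = Max {k::nat. \<beta> - real k *\<^sub>R \<alpha> \<in> \<Phi>} in
                commutator (X \<alpha>) (X \<beta>) = real (r + 1) *\<^sub>R X (\<alpha> + \<beta>) \<or>
                commutator (X \<alpha>) (X \<beta>) = - (real (r + 1) *\<^sub>R X (\<alpha> + \<beta>))
         else commutator (X \<alpha>) (X \<beta>) = 0))"

locale chevalley_group =
  fixes \<Phi> :: "'e::euclidean_space set"
    and X :: "'e \<Rightarrow> complex^'n^'n"
  assumes root_system: "root_system \<Phi>"
    and chevalley_system: "chevalley_system \<Phi> X"
begin

definition x_root :: "'e \<Rightarrow> complex \<Rightarrow> complex^'n^'n" where
  "x_root \<alpha> t = matrix_exp t (X \<alpha>)"

definition G :: "(complex^'n^'n) monoid" where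
  "G = GL\<lparr>carrier := generate GL {x_root \<alpha> t | \<alpha> t. \<alpha> \<in> \<Phi>}\<rparr>"

definition w_root :: "'e \<Rightarrow> complex \<Rightarrow> complex^'n^'n" where
  "w_root \<alpha> t = x_root \<alpha> t ** x_root (- \<alpha>) (- inverse t) ** x_root \<alpha> t"

definition \<omega> :: "'e \<Rightarrow> complex^'n^'n" where
  "\<omega> \<alpha> = w_root \<alpha> 1"

definition h_root :: "'e \<Rightarrow> complex \<Rightarrow> complex^'n^'n" where
  "h_root \<alpha> t = w_root \<alpha> t ** matrix_inv (\<omega> \<alpha>)"

definition T :: "(complex^'n^'n) set" where
  "T = generate GL {h_root \<alpha> t | \<alpha> t. \<alpha> \<in> \<Phi> \<and> t \<noteq> 0}"

end

text \<open>
  \<open>G\<close> carries the subspace topology of the matrix space. A continuous automorphism of a Lie group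
  is real-analytic, so continuity is the form in which analyticity of \<open>\<sigma>\<close> enters.
\<close>

locale compact_chevalley_group = chevalley_group \<Phi> X
  for \<Phi> :: "'e::euclidean_space set" and X :: "'e \<Rightarrow> complex^'n^'n" +
  fixes \<sigma> :: "complex^'n^'n \<Rightarrow> complex^'n^'n"
  assumes \<sigma>_iso: "\<sigma> \<in> iso G G"
    and \<sigma>_continuous: "continuous_on (carrier G) \<sigma>"
    and \<sigma>_x: "\<alpha> \<in> \<Phi> \<Longrightarrow> \<sigma> (x_root \<alpha> t) = x_root (- \<alpha>) (- cnj t)"
begin

definition C :: "(complex^'n^'n) set" where
  "C = {g \<in> carrier G. \<sigma> g = g}"

definition K :: "(complex^'n^'n) set" where
  "K = {g \<in> T. \<sigma> g = g}"

definition N :: "(complex^'n^'n) monoid" where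
  "N = GL\<lparr>carrier := generate GL (\<omega> ` \<Phi> \<union> K)\<rparr>"

end

text \<open>
  \<open>\<phi>\<close> is the family of homomorphisms from \<open>SL\<^sub>2\<close>, and \<open>rep w\<close> is the chosen representative of \<open>w\<close>.
  The map \<open>w \<mapsto> rep w K\<close> is the isomorphism from the Weyl group to \<open>N/K\<close>; it is determined by its
  values on the reflections.
\<close>

locale bott_samelson_setting = compact_chevalley_group \<Phi> X \<sigma>
  for \<Phi> :: "'e::euclidean_space set" and X :: "'e \<Rightarrow> complex^'n^'n" and \<sigma> +
  fixes \<phi> :: "'e \<Rightarrow> complex^2^2 \<Rightarrow> complex^'n^'n"
    and rep :: "('e \<Rightarrow> 'e) \<Rightarrow> complex^'n^'n"
  assumes \<phi>_hom: "\<alpha> \<in> \<Phi> \<Longrightarrow> \<phi> \<alpha> \<in> hom SL2 G"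
    and \<phi>_upper: "\<alpha> \<in> \<Phi> \<Longrightarrow> \<phi> \<alpha> (upper_unitri t) = x_root \<alpha> t"
    and \<phi>_lower: "\<alpha> \<in> \<Phi> \<Longrightarrow> \<phi> \<alpha> (lower_unitri t) = x_root (- \<alpha>) t"
    and rep_in_N: "u \<in> carrier (weyl_group \<Phi>) \<Longrightarrow> rep u \<in> carrier N"
    and rep_iso: "(\<lambda>u. rep u <#\<^bsub>N\<^esub> K) \<in> iso (weyl_group \<Phi>) (N Mod K)"
    and rep_reflection: "\<alpha> \<in> \<Phi> \<Longrightarrow> rep (reflection \<alpha>) <#\<^bsub>N\<^esub> K = \<omega> \<alpha> <#\<^bsub>N\<^esub> K"


section \<open>Nested structures\<close>

definition ivl :: "'i::linorder set \<Rightarrow> 'i \<times> 'i \<Rightarrow> 'i set" where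
  "ivl I r = {k \<in> I. fst r \<le> k \<and> k \<le> snd r}"

definition nested_structure :: "'i::linorder set \<Rightarrow> ('i \<times> 'i) set \<Rightarrow> bool" where
  "nested_structure I R \<longleftrightarrow> R \<subseteq> I \<times> I \<and>
     (\<forall>r\<in>R. fst r \<le> snd r) \<and>
     (\<forall>r\<in>R. \<forall>r'\<in>R. r \<noteq> r' \<longrightarrow> {fst r, snd r} \<inter> {fst r', snd r'} = {}) \<and>
     (\<forall>r\<in>R. \<forall>r'\<in>R. ivl I r \<inter> ivl I r' = {} \<or> ivl I r \<subseteq> ivl I r' \<or> ivl I r' \<subseteq> ivl I r)"

definition subs :: "'i::linorder set \<Rightarrow> ('i \<times> 'i) set \<Rightarrow> 'i \<times> 'i \<Rightarrow> ('i \<times> 'i) set" where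
  "subs I R f = {r \<in> R. ivl I r \<subseteq> ivl I f}"

text \<open>
  The set \<open>F\<close> enters the following definitions through its enumeration \<open>fs = [f\<^sup>1, \<dots>, f\<^sup>n]\<close>,
  \<open>f\<^sup>1 < \<dots> < f\<^sup>n\<close>.
\<close>

definition index_proj :: "'i::linorder set \<Rightarrow> ('i \<times> 'i) list \<Rightarrow> 'i set" where
  "index_proj I fs = I - (\<Union>f\<in>set fs. ivl I f)"

definition nested_proj ::
    "'i::linorder set \<Rightarrow> ('i \<times> 'i) set \<Rightarrow> ('i \<times> 'i) list \<Rightarrow> ('i \<times> 'i) set" where
  "nested_proj I R fs = R - {r \<in> R. \<exists>f\<in>set fs. ivl I r \<subseteq> ivl I f}"

text \<open>The list \<open>[f\<^sup>1, \<dots>, f\<^sup>m]\<close> of those \<open>f\<close> that lie to the left of \<open>i\<close>.\<close>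

definition before :: "('i::linorder \<times> 'i) list \<Rightarrow> 'i \<Rightarrow> ('i \<times> 'i) list" where
  "before fs i = takeWhile (\<lambda>f. snd f < i) fs"

definition v_upto :: "('i::linorder \<times> 'i) list \<Rightarrow> ('i \<times> 'i \<Rightarrow> 'e \<Rightarrow> 'e) \<Rightarrow> 'i \<Rightarrow> 'e \<Rightarrow> 'e" where
  "v_upto fs v i = foldr (\<circ>) (map v (before fs i)) id"

definition s_proj ::
    "('i::linorder \<times> 'i) list \<Rightarrow> ('i \<times> 'i \<Rightarrow> 'e \<Rightarrow> 'e) \<Rightarrow> ('i \<Rightarrow> 'e \<Rightarrow> 'e) \<Rightarrow> 'i \<Rightarrow> 'e \<Rightarrow> 'e" where
  "s_proj fs v s i = v_upto fs v i \<circ> s i \<circ> inv_into UNIV (v_upto fs v i)"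

definition v_proj ::
    "('i::linorder \<times> 'i) list \<Rightarrow> ('i \<times> 'i \<Rightarrow> 'e \<Rightarrow> 'e) \<Rightarrow> 'i \<times> 'i \<Rightarrow> 'e \<Rightarrow> 'e" where
  "v_proj fs v r = v_upto fs v (fst r) \<circ> v r \<circ> inv_into UNIV (v_upto fs v (snd r))"


section \<open>Quotient topologies and fibre bundles\<close>

definition quotient_topology :: "'a topology \<Rightarrow> ('a \<Rightarrow> 'b) \<Rightarrow> 'b topology" where
  "quotient_topology X q =
     topology (\<lambda>U. U \<subseteq> q ` topspace X \<and> openin X {x \<in> topspace X. q x \<in> U})"

lemma openin_quotient_topology:
  "openin (quotient_topology X q) U \<longleftrightarrow>
     U \<subseteq> q ` topspace X \<and> openin X {x \<in> topspace X. q x \<in> U}"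
proof -
  have "istopology (\<lambda>U. U \<subseteq> q ` topspace X \<and> openin X {x \<in> topspace X. q x \<in> U})"
    unfolding istopology_def
  proof (intro conjI allI impI; (elim conjE)?)
    fix S T
    assume "openin X {x \<in> topspace X. q x \<in> S}" "openin X {x \<in> topspace X. q x \<in> T}"
    then have "openin X ({x \<in> topspace X. q x \<in> S} \<inter> {x \<in> topspace X. q x \<in> T})"
      by (rule openin_Int)
    also have "{x \<in> topspace X. q x \<in> S} \<inter> {x \<in> topspace X. q x \<in> T} =
        {x \<in> topspace X. q x \<in> S \<inter> T}"
      by auto
    finally show "openin X {x \<in> topspace X. q x \<in> S \<inter> T}" .
  next
    fix \<K>
    assume *: "\<forall>S\<in>\<K>. S \<subseteq> q ` topspace X \<and> openin X {x \<in> topspace X. q x \<in> S}"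
    then have "openin X (\<Union>S\<in>\<K>. {x \<in> topspace X. q x \<in> S})"
      by blast
    also have "(\<Union>S\<in>\<K>. {x \<in> topspace X. q x \<in> S}) = {x \<in> topspace X. q x \<in> \<Union>\<K>}"
      by auto
    finally show "openin X {x \<in> topspace X. q x \<in> \<Union>\<K>}" .
    from * show "\<Union>\<K> \<subseteq> q ` topspace X"
      by blast
  qed auto
  then show ?thesis
    by (simp add: quotient_topology_def topology_inverse')
qed

lemma quotient_map_quotient_topology: "quotient_map X (quotient_topology X q) q"
proof -
  have "{x \<in> topspace X. q x \<in> q ` topspace X} = topspace X"
    by auto
  then have "openin (quotient_topology X q) (q ` topspace X)"
    by (simp add: openin_quotient_topology)
  then have "topspace (quotient_topology X q) = q ` topspace X"
    by (meson openin_quotient_topology openin_subset openin_topspace subset_antisym)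
  then show ?thesis
    by (auto simp: quotient_map_def openin_quotient_topology)
qed

text \<open>
  Local triviality does not force the projection to be surjective: the fibre may be empty.
\<close>

definition fibre_bundle ::
    "'a topology \<Rightarrow> 'b topology \<Rightarrow> 'c topology \<Rightarrow> ('a \<Rightarrow> 'b) \<Rightarrow> bool" where
  "fibre_bundle E B Y p \<longleftrightarrow> continuous_map E B p \<and>
     (\<forall>b\<in>topspace B. \<exists>U \<theta>. openin B U \<and> b \<in> U \<and>
        homeomorphic_map (subtopology E {e \<in> topspace E. p e \<in> U})
          (prod_topology (subtopology B U) Y) \<theta> \<and>
        (\<forall>e\<in>topspace E. p e \<in> U \<longrightarrow> fst (\<theta> e) = p e))"


section \<open>Bott--Samelson varieties\<close>

definition seq_prod :: "'i::linorder set \<Rightarrow> ('i \<Rightarrow> complex^'n^'n) \<Rightarrow> 'i \<times> 'i \<Rightarrow> complex^'n^'n" where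
  "seq_prod I c r = mprod (map c (sorted_list_of_set (ivl I r)))"

text \<open>The entry \<open>k\<^bsub>i-1\<^esub>\<close>, where \<open>k\<^bsub>-\<infinity>\<^esub> = 1\<close>.\<close>

definition prev_entry :: "'i::linorder set \<Rightarrow> ('i \<Rightarrow> complex^'n^'n) \<Rightarrow> 'i \<Rightarrow> complex^'n^'n" where
  "prev_entry I k i = (if {j \<in> I. j < i} = {} then mat 1 else k (Max {j \<in> I. j < i}))"

definition act ::
    "'i::linorder set \<Rightarrow> ('i \<Rightarrow> complex^'n^'n) \<Rightarrow> ('i \<Rightarrow> complex^'n^'n) \<Rightarrow> 'i \<Rightarrow> complex^'n^'n" where
  "act I c k = (\<lambda>i\<in>I. matrix_inv (prev_entry I k i) ** c i ** k i)"

context bott_samelson_setting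
begin

text \<open>
  The union over the two roots with the given reflection; both contribute the same subgroup.
\<close>

definition C_refl :: "('e \<Rightarrow> 'e) \<Rightarrow> (complex^'n^'n) set" where
  "C_refl t = (\<Union>\<alpha>\<in>{\<alpha> \<in> \<Phi>. reflection \<alpha> = t}. \<phi> \<alpha> ` SU2 <#>\<^bsub>G\<^esub> K)"

definition C_seq_topology ::
    "'i::linorder set \<Rightarrow> ('i \<Rightarrow> 'e \<Rightarrow> 'e) \<Rightarrow> ('i \<Rightarrow> complex^'n^'n) topology" where
  "C_seq_topology I s = product_topology (\<lambda>i. top_of_set (C_refl (s i))) I"

definition cls :: "'i::linorder set \<Rightarrow> ('i \<Rightarrow> complex^'n^'n) \<Rightarrow> ('i \<Rightarrow> complex^'n^'n) set" where
  "cls I c = act I c ` (PiE I (\<lambda>_. K))"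

definition BS :: "'i::linorder set \<Rightarrow> ('i \<Rightarrow> 'e \<Rightarrow> 'e) \<Rightarrow> ('i \<Rightarrow> complex^'n^'n) set topology" where
  "BS I s = quotient_topology (C_seq_topology I s) (cls I)"

definition C_nested ::
    "'i::linorder set \<Rightarrow> ('i \<Rightarrow> 'e \<Rightarrow> 'e) \<Rightarrow> ('i \<times> 'i) set \<Rightarrow> ('i \<times> 'i \<Rightarrow> 'e \<Rightarrow> 'e) \<Rightarrow>
     ('i \<Rightarrow> complex^'n^'n) set" where
  "C_nested I s R v =
     {c \<in> PiE I (\<lambda>i. C_refl (s i)). \<forall>r\<in>R. seq_prod I c r \<in> rep (v r) <#\<^bsub>N\<^esub> K}"

definition BS_nested ::
    "'i::linorder set \<Rightarrow> ('i \<Rightarrow> 'e \<Rightarrow> 'e) \<Rightarrow> ('i \<times> 'i) set \<Rightarrow> ('i \<times> 'i \<Rightarrow> 'e \<Rightarrow> 'e) \<Rightarrow>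
     ('i \<Rightarrow> complex^'n^'n) set topology" where
  "BS_nested I s R v = subtopology (BS I s) (cls I ` C_nested I s R v)"

definition balanced ::
    "'i::linorder set \<Rightarrow> ('i \<Rightarrow> 'e \<Rightarrow> 'e) \<Rightarrow> ('i \<times> 'i) set \<Rightarrow> ('i \<times> 'i \<Rightarrow> 'e \<Rightarrow> 'e) \<Rightarrow>
     ('i \<times> 'i) list \<Rightarrow> ('i \<Rightarrow> complex^'n^'n) set" where
  "balanced I s R v fs = {c \<in> C_nested I s R v. \<forall>f\<in>set fs. seq_prod I c f = rep (v f)}"

definition rep_upto ::
    "('i::linorder \<times> 'i) list \<Rightarrow> ('i \<times> 'i \<Rightarrow> 'e \<Rightarrow> 'e) \<Rightarrow> 'i \<Rightarrow> complex^'n^'n" where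
  "rep_upto fs v i = mprod (map (\<lambda>f. rep (v f)) (before fs i))"

definition seq_proj ::
    "'i::linorder set \<Rightarrow> ('i \<times> 'i \<Rightarrow> 'e \<Rightarrow> 'e) \<Rightarrow> ('i \<times> 'i) list \<Rightarrow>
     ('i \<Rightarrow> complex^'n^'n) \<Rightarrow> 'i \<Rightarrow> complex^'n^'n" where
  "seq_proj I v fs c =
     (\<lambda>i\<in>index_proj I fs. rep_upto fs v i ** c i ** matrix_inv (rep_upto fs v i))"

text \<open>
  The class \<open>[c\<^sup>F]\<close> does not depend on the balanced representative \<open>c\<close> of the argument, so it is the
  unique \<open>b\<close> below.
\<close>

definition proj ::
    "'i::linorder set \<Rightarrow> ('i \<Rightarrow> 'e \<Rightarrow> 'e) \<Rightarrow> ('i \<times> 'i) set \<Rightarrow> ('i \<times> 'i \<Rightarrow> 'e \<Rightarrow> 'e) \<Rightarrow>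
     ('i \<times> 'i) list \<Rightarrow> ('i \<Rightarrow> complex^'n^'n) set \<Rightarrow> ('i \<Rightarrow> complex^'n^'n) set" where
  "proj I s R v fs a = (THE b. \<exists>c\<in>balanced I s R v fs.
     a = cls I c \<and> b = cls (index_proj I fs) (seq_proj I v fs c))"

end

end

theory Submission
  imports Defs
begin

text \<open>
  Each \<open>C\<^sub>s \<rightarrow> C\<^sub>s / K\<close> has local slices: for \<open>c = \<phi>\<^sub>\<alpha>(A) k\<close> with \<open>A \<in> SU\<^sub>2\<close>, the conjugate of the coroot
  element \<open>h\<^sub>\<alpha>\<close> by \<open>c\<close> depends only on \<open>A\<close> modulo the diagonal torus and determines it continuously.
  Applying slices from left to right gives a local gauge, that is, a normal form \<open>N\<close> on a saturated
  open set of \<open>C(s\<^sup>F)\<close> for the free action of \<open>K(I\<^sup>F)\<close>. Every point of the preimage of this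
  open set under the projection has a balanced representative whose projected sequence is in normal
  form. It is unique up to the entries of \<open>K(I)\<close> inside the blocks \<open>[f]\<close>, \<open>f \<in> F\<close>, other than the
  last ones, so its restrictions to the blocks define a point of the fibre. Conversely, a sequence in
  normal form and balanced sequences on the blocks can be glued.

  That the projected sequence lies in \<open>C(s\<^sup>F)\<close> requires \<open>n C\<^sub>s n\<inverse> = C\<^bsub>wsw\<inverse>\<^esub>\<close> for \<open>n \<in> wK\<close>. This
  reduces to \<open>\<omega>\<^sub>\<beta>\<close>, whose adjoint action maps the root vector of \<open>\<alpha>\<close> to a multiple of the one of
  \<open>s\<^sub>\<beta>\<alpha>\<close>: it preserves the span of the \<open>\<beta>\<close>-string through \<open>\<alpha>\<close>, and in this span the eigenvalues of
  \<open>ad H(\<beta>)\<close> are distinct.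
\<close>

section \<open>Complex matrices\<close>

text \<open>The spaces are subspaces of quotients, so the trivialisation is built on sequences and
  then passed to classes in both directions. What allows this is that \<open>cls\<close> is open: an
  open quotient map restricts to a quotient map on saturated subsets, and a product of open
  surjections is again one, whereas restrictions and products of arbitrary quotient maps need not be
  quotient maps. The normal form has to fix the projected sequence itself, not only its class. Once
  that is fixed, freeness of the action of \<open>K(I\<^sup>F)\<close> forces every gauge element
  relating two balanced sequences to be 1 just before each block. This matches the convention by
  which a block, as an index set of its own, has the entry 1 before its first index; only then do
  restriction to the blocks and gluing respect classes. The maps \<open>\<phi> \<alpha>\<close> are
  given as abstract homomorphisms. Continuity of the slices therefore comes from writing them in
  root elements, which are exponentials, and the adjoint action of root elements is obtained from
  Taylor's formula along real one-parameter groups.\<close>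

definition cscale :: "complex \<Rightarrow> complex^'n^'m \<Rightarrow> complex^'n^'m" where
  "cscale c A = map_matrix ((*) c) A"

lemma cscale_nth [simp]: "cscale c A $ i $ j = c * A $ i $ j"
  by (simp add: cscale_def map_matrix_def)

lemma cscale_add_left: "cscale (a + b) A = cscale a A + cscale b A"
  by (simp add: vec_eq_iff algebra_simps)

lemma cscale_add: "cscale c (A + B) = cscale c A + cscale c B"
  by (simp add: vec_eq_iff algebra_simps)

lemma cscale_diff: "cscale c (A - B) = cscale c A - cscale c B"
  by (simp add: vec_eq_iff algebra_simps)

lemma cscale_cscale [simp]: "cscale a (cscale b A) = cscale (a * b) A"
  by (simp add: vec_eq_iff algebra_simps)

lemma cscale_one [simp]: "cscale 1 A = A"
  by (simp add: vec_eq_iff)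

lemma cscale_zero_left [simp]: "cscale 0 A = 0"
  by (simp add: vec_eq_iff)

lemma cscale_zero [simp]: "cscale c 0 = 0"
  by (simp add: vec_eq_iff)

lemma cscale_minus_left: "cscale (- c) A = - cscale c A"
  by (simp add: vec_eq_iff)

lemma cscale_minus: "cscale c (- A) = - cscale c A"
  by (simp add: vec_eq_iff)

lemma cscale_scaleR: "cscale c (r *\<^sub>R A) = cscale (c * of_real r) A"
  by (simp add: vec_eq_iff scaleR_conv_of_real [where 'a = complex])

lemma scaleR_cscale: "r *\<^sub>R A = cscale (of_real r) A"
  by (simp add: vec_eq_iff scaleR_conv_of_real [where 'a = complex])

lemma cscale_eq_0_iff: "cscale c A = 0 \<longleftrightarrow> c = 0 \<or> A = 0"
  by (auto simp: vec_eq_iff)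

lemma cscale_cancel: "cscale a A = cscale b A \<Longrightarrow> A \<noteq> 0 \<Longrightarrow> a = b"
  by (auto simp: vec_eq_iff)

lemma cscale_mult_left: "cscale c A ** B = cscale c (A ** B)"
  by (simp add: vec_eq_iff matrix_matrix_mult_def sum_distrib_left algebra_simps)

lemma cscale_mult_right: "A ** cscale c B = cscale c (A ** B)"
  by (simp add: vec_eq_iff matrix_matrix_mult_def sum_distrib_left algebra_simps)

lemma cscale_sum: "cscale c (sum f S) = (\<Sum>x\<in>S. cscale c (f x))"
  by (induction S rule: infinite_finite_induct) (simp_all add: cscale_add)

lemma mult_diff_left: "(A - B) ** (D::complex^'n^'m) = A ** D - B ** D"
  by (simp add: vec_eq_iff matrix_matrix_mult_def sum_subtractf algebra_simps)

lemma mult_diff_right: "D ** (A - B) = D ** A - D ** (B::complex^'n^'m)"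
  by (simp add: vec_eq_iff matrix_matrix_mult_def sum_subtractf algebra_simps)

lemma mult_add_left: "(A + B) ** (D::complex^'n^'m) = A ** D + B ** D"
  by (simp add: vec_eq_iff matrix_matrix_mult_def sum.distrib algebra_simps)

lemma mult_add_right: "D ** (A + B) = D ** A + D ** (B::complex^'n^'m)"
  by (simp add: vec_eq_iff matrix_matrix_mult_def sum.distrib algebra_simps)

lemma mult_minus_left: "(- A) ** (D::complex^'n^'m) = - (A ** D)"
  by (simp add: vec_eq_iff matrix_matrix_mult_def sum_negf)

lemma mult_minus_right: "D ** (- A) = - (D ** (A::complex^'n^'m))"
  by (simp add: vec_eq_iff matrix_matrix_mult_def sum_negf)

lemma bilinear_matrix_mult: "bilinear ((**) :: complex^'n^'n \<Rightarrow> complex^'n^'n \<Rightarrow> complex^'n^'n)"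
  by (auto simp: bilinear_def linear_iff mult_add_left mult_add_right scaleR_cscale
      cscale_mult_left cscale_mult_right)

lemma bounded_bilinear_matrix_mult:
  "bounded_bilinear ((**) :: complex^'n^'n \<Rightarrow> complex^'n^'n \<Rightarrow> complex^'n^'n)"
  using bilinear_conv_bounded_bilinear bilinear_matrix_mult by blast

lemma linear_matrix_mult_left:
  fixes P :: "complex^'n^'n"
  shows "linear (\<lambda>M :: complex^'n^'n. P ** M)"
  using bilinear_matrix_mult unfolding bilinear_def by auto

lemma linear_matrix_mult_right:
  fixes P :: "complex^'n^'n"
  shows "linear (\<lambda>M :: complex^'n^'n. M ** P)"
  using bilinear_matrix_mult unfolding bilinear_def by auto

lemma bounded_linear_matrix_mult_left:
  fixes P :: "complex^'n^'n"
  shows "bounded_linear (\<lambda>M :: complex^'n^'n. P ** M)"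
  by (rule linear_matrix_mult_left [THEN linear_conv_bounded_linear [THEN iffD1]])

lemma bounded_linear_matrix_mult_right:
  fixes P :: "complex^'n^'n"
  shows "bounded_linear (\<lambda>M :: complex^'n^'n. M ** P)"
  by (rule linear_matrix_mult_right [THEN linear_conv_bounded_linear [THEN iffD1]])

section \<open>Inverses of complex matrices and their continuity\<close>

lemma matrix_inv_unique:
  fixes A B :: "complex^'n^'n"
  assumes "A ** B = mat 1" "B ** A = mat 1"
  shows "matrix_inv A = B"
  unfolding matrix_inv_def
proof (rule some_equality)
  fix B' assume B': "A ** B' = mat 1 \<and> B' ** A = mat 1"
  have "B' = B' ** (A ** B)"
    by (simp add: assms)
  also have "\<dots> = B"
    using B' by (simp add: matrix_mul_assoc)
  finally show "B' = B" .
qed (use assms in blast)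

lemma matrix_inv_right: "invertible A \<Longrightarrow> A ** matrix_inv A = mat 1"
  and matrix_inv_left: "invertible A \<Longrightarrow> matrix_inv A ** A = mat 1"
  for A :: "complex^'n^'n"
  unfolding invertible_def matrix_inv_def by (metis (mono_tags, lifting) someI_ex)+

lemma matrix_inv_mult:
  fixes A B :: "complex^'n^'n"
  assumes "invertible A" "invertible B"
  shows "matrix_inv (A ** B) = matrix_inv B ** matrix_inv A"
proof (rule matrix_inv_unique)
  have "A ** B ** (matrix_inv B ** matrix_inv A) = A ** (B ** matrix_inv B) ** matrix_inv A"
    by (simp add: matrix_mul_assoc)
  then show "A ** B ** (matrix_inv B ** matrix_inv A) = mat 1"
    using assms by (simp add: matrix_inv_right)
  have "matrix_inv B ** matrix_inv A ** (A ** B) = matrix_inv B ** (matrix_inv A ** A) ** B"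
    by (simp add: matrix_mul_assoc)
  then show "matrix_inv B ** matrix_inv A ** (A ** B) = mat 1"
    using assms by (simp add: matrix_inv_left)
qed

lemma invertible_matrix_inv [simp]:
  fixes A :: "complex^'n^'n"
  shows "invertible A \<Longrightarrow> invertible (matrix_inv A)"
  unfolding invertible_def [of "matrix_inv A"] using matrix_inv_left matrix_inv_right by blast

lemma matrix_inv_matrix_inv:
  fixes A :: "complex^'n^'n"
  shows "invertible A \<Longrightarrow> matrix_inv (matrix_inv A) = A"
  by (intro matrix_inv_unique) (simp_all add: matrix_inv_left matrix_inv_right)

lemma matrix_inv_one [simp]: "matrix_inv (mat 1 :: complex^'n^'n) = mat 1"
  by (intro matrix_inv_unique) simp_all

lemma invertible_one [simp]: "invertible (mat 1 :: complex^'n^'n)"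
  unfolding invertible_def by (metis matrix_mul_lid)

lemma matrix_inv_cancel_left:
  fixes A B :: "complex^'n^'n"
  shows "invertible A \<Longrightarrow> A ** (matrix_inv A ** B) = B"
    "invertible A \<Longrightarrow> matrix_inv A ** (A ** B) = B"
  by (simp_all add: matrix_mul_assoc matrix_inv_left matrix_inv_right)

lemma matrix_right_inv_cancel:
  fixes A B :: "complex^'n^'n"
  shows "invertible A \<Longrightarrow> B ** A ** matrix_inv A = B" "invertible A \<Longrightarrow> B ** matrix_inv A ** A = B"
  by (simp_all add: matrix_inv_left matrix_inv_right flip: matrix_mul_assoc)

lemmas matrix_group_simps =
  matrix_mul_assoc [symmetric] matrix_inv_mult matrix_inv_matrix_inv matrix_inv_cancel_left
  matrix_inv_left matrix_inv_right invertible_mult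

lemma matrix_left_cancel:
  fixes A B :: "complex^'n^'n"
  shows "invertible A \<Longrightarrow> A ** B = A ** D \<longleftrightarrow> B = D"
  by (metis matrix_inv_cancel_left(2))

lemma matrix_right_cancel:
  fixes A B :: "complex^'n^'n"
  shows "invertible A \<Longrightarrow> B ** A = D ** A \<longleftrightarrow> B = D"
  by (metis matrix_mul_assoc matrix_inv_right matrix_mul_rid)

lemma continuous_map_matrix_mult:
  fixes f g :: "'a \<Rightarrow> complex^'n^'n"
  assumes "continuous_map T euclidean f" "continuous_map T euclidean g"
  shows "continuous_map T euclidean (\<lambda>x. f x ** g x)"
  using assms unfolding continuous_map_atin limitin_canonical_iff
  by (auto intro: bounded_bilinear.tendsto [OF bounded_bilinear_matrix_mult])

text \<open>Cramer's rule for column \<open>j\<close> of the inverse. Every entry becomes a quotient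
  of determinants, hence continuous where \<open>det A\<close> is nonzero.\<close>

lemma matrix_inv_entry:
  fixes A :: "complex^'n^'n"
  assumes "invertible A"
  shows "matrix_inv A $ i $ j = det (\<chi> k l. if l = i then (if k = j then 1 else 0) else A $ k $ l) / det A"
proof -
  have "det A \<noteq> 0"
    using assms invertible_det_nz by blast
  moreover have "A *v (\<chi> i. matrix_inv A $ i $ j) = (\<chi> k. if k = j then 1 else 0)"
  proof -
    have "(A ** matrix_inv A) $ k $ j = (if k = j then 1 else 0)" for k
      using assms by (simp add: matrix_inv_right mat_def)
    then show ?thesis
      by (simp add: vec_eq_iff matrix_matrix_mult_def matrix_vector_mult_def)
  qed
  ultimately have "(\<chi> i. matrix_inv A $ i $ j) =
     (\<chi> i. det (\<chi> k l. if l = i then (\<chi> k. if k = j then 1 else 0) $ k else A $ k $ l) / det A)"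
    using cramer by blast
  then have "(\<chi> i. matrix_inv A $ i $ j) $ i =
     (\<chi> i. det (\<chi> k l. if l = i then (\<chi> k. if k = j then 1 else 0) $ k else A $ k $ l) / det A) $ i"
    by (rule arg_cong)
  then show ?thesis
    by (simp cong: if_cong)
qed

lemma continuous_on_matrix_inv:
  "continuous_on {A :: complex^'n^'n. invertible A} matrix_inv"
proof -
  have entry: "continuous_on S (\<lambda>A :: complex^'n^'n. A $ i $ j)" for S i j
    by (intro continuous_intros)
  have "continuous_on {A :: complex^'n^'n. invertible A}
      (\<lambda>A. \<chi> i j. det (\<chi> k l. if l = i then (if k = j then 1 else 0) else A $ k $ l) / det A)"
    unfolding det_def
    apply (intro continuous_on_vec_lambda continuous_on_divide continuous_on_sum
        continuous_on_mult continuous_on_const continuous_on_prod)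
    \<comment> \<open>In the replaced column the factor is constant; elsewhere it is a coordinate of
      \<open>A\<close>.\<close>
    subgoal for i j p k
      by (cases "p k = i") (auto intro!: entry)
    subgoal for i j p k
      by (rule entry)
    subgoal for i j
      unfolding det_def [symmetric] by (auto simp: invertible_det_nz)
    done
  then show ?thesis
    by (rule continuous_on_eq) (simp add: vec_eq_iff matrix_inv_entry)
qed

lemma continuous_map_matrix_inv:
  fixes f :: "'a \<Rightarrow> complex^'n^'n"
  assumes "continuous_map T euclidean f" "\<And>x. x \<in> topspace T \<Longrightarrow> invertible (f x)"
  shows "continuous_map T euclidean (\<lambda>x. matrix_inv (f x))"
proof -
  have "continuous_map T (top_of_set {A :: complex^'n^'n. invertible A}) f"
    using assms by (auto simp: continuous_map_in_subtopology)
  then have "continuous_map T euclidean (matrix_inv \<circ> f)"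
    by (rule continuous_map_compose) (simp add: continuous_on_matrix_inv)
  then show ?thesis
    by (simp add: o_def)
qed

section \<open>The matrix exponential\<close>

abbreviation mpow :: "complex^'n^'n \<Rightarrow> nat \<Rightarrow> complex^'n^'n" where
  "mpow A k \<equiv> (((**) A) ^^ k) (mat 1)"

text \<open>\<open>M\<close> is the sum of the norms of all entries times the matrix size, which
  pays for the sum in one matrix product. Geometric growth makes the exponential series comparable
  with that of \<open>M * norm t\<close>.\<close>

lemma mpow_entry_bound:
  fixes A :: "complex^'n^'n"
  shows "\<exists>M. 0 \<le> M \<and> (\<forall>k i j. norm (mpow A k $ i $ j) \<le> M ^ k)"
proof -
  define m where "m = (\<Sum>i\<in>UNIV. \<Sum>j\<in>UNIV. norm (A $ i $ j))"
  have m: "norm (A $ i $ j) \<le> m" for i j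
  proof -
    have "norm (A $ i $ j) \<le> (\<Sum>j\<in>UNIV. norm (A $ i $ j))"
      by (intro member_le_sum) auto
    also have "\<dots> \<le> m"
      unfolding m_def by (rule member_le_sum) (auto intro: sum_nonneg)
    finally show ?thesis .
  qed
  have m0: "0 \<le> m"
    using m norm_ge_zero order_trans by blast
  define M where "M = real CARD('n) * m"
  have "norm (mpow A k $ i $ j) \<le> M ^ k" for k i j
  proof (induction k arbitrary: i j)
    case 0
    then show ?case by (simp add: mat_def)
  next
    case (Suc k)
    have "norm (mpow A (Suc k) $ i $ j) \<le> (\<Sum>l\<in>UNIV. norm (A $ i $ l * mpow A k $ l $ j))"
      by (simp add: matrix_matrix_mult_def norm_sum)
    also have "\<dots> \<le> (\<Sum>l\<in>(UNIV::'n set). m * M ^ k)"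
      using m Suc.IH m0 by (intro sum_mono) (simp add: norm_mult mult_mono)
    also have "\<dots> = M ^ Suc k"
      by (simp add: M_def)
    finally show ?case .
  qed
  moreover have "0 \<le> M"
    using m0 by (simp add: M_def)
  ultimately show ?thesis by blast
qed

lemma summable_exp_entry:
  fixes A :: "complex^'n^'n"
  shows "summable (\<lambda>k. mpow A k $ i $ j / fact k * t ^ k)"
proof -
  obtain M where M: "0 \<le> M" "\<And>k i j. norm (mpow A k $ i $ j) \<le> M ^ k"
    using mpow_entry_bound by blast
  have "summable (\<lambda>k. inverse (fact k) * (M * norm t) ^ k)"
    by (rule summable_exp)
  then show ?thesis
  proof (rule summable_comparison_test')
    fix k :: nat
    have "norm (mpow A k $ i $ j) * norm t ^ k \<le> M ^ k * norm t ^ k"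
      using M by (intro mult_right_mono) auto
    then show "norm (mpow A k $ i $ j / fact k * t ^ k) \<le> inverse (fact k) * (M * norm t) ^ k"
      by (simp add: norm_mult norm_divide norm_power power_mult_distrib field_simps)
  qed
qed

text \<open>Convergence is established entry by entry, where the series is a power series in
  \<open>t\<close> and can be differentiated term by term.\<close>

lemma matrix_exp_sums:
  fixes A :: "complex^'n^'n"
  shows "(\<lambda>k. cscale (t ^ k / fact k) (mpow A k)) sums matrix_exp t A"
    and matrix_exp_entry: "matrix_exp t A $ i $ j = (\<Sum>k. mpow A k $ i $ j / fact k * t ^ k)"
proof -
  define E :: "complex^'n^'n" where "E = (\<chi> i j. \<Sum>k. mpow A k $ i $ j / fact k * t ^ k)"
  have "(\<lambda>n. (\<Sum>k<n. cscale (t ^ k / fact k) (mpow A k)) $ i $ j) \<longlonglongrightarrow> E $ i $ j" for i j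
    using summable_sums [OF summable_exp_entry [of A i j t]]
    by (simp add: E_def sums_def mult.commute)
  then have *: "(\<lambda>k. cscale (t ^ k / fact k) (mpow A k)) sums E"
    unfolding sums_def by (intro vec_tendstoI) 
  have "matrix_exp t A = (\<Sum>k. cscale (t ^ k / fact k) (mpow A k))"
    unfolding matrix_exp_def cscale_def by (rule refl)
  also have "\<dots> = E"
    using * by (rule sums_unique [symmetric])
  finally have "matrix_exp t A = E" .
  then show "(\<lambda>k. cscale (t ^ k / fact k) (mpow A k)) sums matrix_exp t A"
    "matrix_exp t A $ i $ j = (\<Sum>k. mpow A k $ i $ j / fact k * t ^ k)"
    using * by (auto simp: E_def)
qed

lemma matrix_exp_zero [simp]: "matrix_exp 0 (A :: complex^'n^'n) = mat 1"
proof -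
  have "(\<lambda>k. cscale (0 ^ k / fact k) (mpow A k)) sums (\<Sum>k\<in>{0}. cscale (0 ^ k / fact k) (mpow A k))"
    by (rule sums_finite) (auto simp: zero_power)
  then show ?thesis
    using matrix_exp_sums [of 0 A] sums_unique2 by fastforce
qed

text \<open>Termwise on the series, in a form free of the inverse of \<open>P\<close>. With
  \<open>B\<close> a scalar multiple of another root vector it turns conjugation of root vectors
  into conjugation of root elements.\<close>

lemma matrix_exp_intertwine:
  fixes P :: "complex^'n^'n"
  assumes "P ** A = B ** P"
  shows "P ** matrix_exp t A = matrix_exp t B ** P"
proof -
  have pow: "P ** mpow A k = mpow B k ** P" for k
  proof (induction k)
    case (Suc k)
    have "P ** mpow A (Suc k) = B ** (P ** mpow A k)"
      by (simp add: assms matrix_mul_assoc)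
    also have "\<dots> = mpow B (Suc k) ** P"
      by (simp add: Suc.IH matrix_mul_assoc)
    finally show ?case .
  qed simp
  have "(\<lambda>k. P ** cscale (t ^ k / fact k) (mpow A k)) sums (P ** matrix_exp t A)"
    using bounded_linear_matrix_mult_left matrix_exp_sums(1) by (rule bounded_linear.sums)
  moreover have "(\<lambda>k. cscale (t ^ k / fact k) (mpow B k) ** P) sums (matrix_exp t B ** P)"
    using bounded_linear_matrix_mult_right matrix_exp_sums(1) by (rule bounded_linear.sums)
  ultimately show ?thesis
    by (simp add: cscale_mult_left cscale_mult_right pow sums_unique2)
qed

lemma matrix_exp_cscale:
  "matrix_exp t (cscale c A) = matrix_exp (t * c) (A :: complex^'n^'n)"
proof -
  have "mpow (cscale c A) k = cscale (c ^ k) (mpow A k)" for k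
    by (induction k) (simp_all add: cscale_mult_left cscale_mult_right mult.commute)
  moreover have "matrix_exp t A = (\<Sum>k. cscale (t ^ k / fact k) (mpow A k))" for t and A :: "complex^'n^'n"
    unfolding matrix_exp_def cscale_def by (rule refl)
  ultimately show ?thesis
    by (simp only: cscale_cscale) (simp add: power_mult_distrib)
qed

text \<open>Away from 0 differentiability serves for continuity; the value of the derivative is read
  off at 0 and carried elsewhere by the group law.\<close>

lemma matrix_exp_entry_deriv:
  fixes A :: "complex^'n^'n"
  shows "\<exists>D. ((\<lambda>t. matrix_exp t A $ i $ j) has_field_derivative D) (at t)"
    and "((\<lambda>t. matrix_exp t A $ i $ j) has_field_derivative A $ i $ j) (at 0)"
proof -
  let ?c = "\<lambda>k. mpow A k $ i $ j / fact k"
  have D: "((\<lambda>t. matrix_exp t A $ i $ j) has_field_derivative (\<Sum>n. diffs ?c n * t ^ n)) (at t)" for t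
    unfolding matrix_exp_entry
    by (rule termdiffs_strong_converges_everywhere) (rule summable_exp_entry)
  then show "\<exists>D. ((\<lambda>t. matrix_exp t A $ i $ j) has_field_derivative D) (at t)"
    by blast
  have "(\<Sum>n. diffs ?c n * 0 ^ n) = diffs ?c 0"
    by (rule powser_zero)
  also have "\<dots> = A $ i $ j"
    by (simp add: diffs_def)
  finally show "((\<lambda>t. matrix_exp t A $ i $ j) has_field_derivative A $ i $ j) (at 0)"
    using D [of 0] by simp
qed

lemma continuous_on_matrix_exp: "continuous_on UNIV (\<lambda>t. matrix_exp t (A :: complex^'n^'n))"
proof -
  have "continuous_on UNIV (\<lambda>t. matrix_exp t A $ i $ j)" for i j
  proof (intro continuous_at_imp_continuous_on ballI)
    fix t
    obtain D where "((\<lambda>t. matrix_exp t A $ i $ j) has_field_derivative D) (at t)"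
      using matrix_exp_entry_deriv(1) by blast
    then show "isCont (\<lambda>t. matrix_exp t A $ i $ j) t"
      by (rule DERIV_isCont)
  qed
  then have "continuous_on UNIV (\<lambda>t. \<chi> i j. matrix_exp t A $ i $ j)"
    by (intro continuous_on_vec_lambda)
  then show ?thesis
    by simp
qed

section \<open>Commutators and conjugation by one-parameter groups\<close>

lemma commutator_add_right: "commutator A (B + D) = commutator A B + commutator A D"
  by (simp add: commutator_def mult_add_left mult_add_right)

lemma commutator_cscale_left: "commutator (cscale c A) B = cscale c (commutator A B)"
  by (simp add: commutator_def cscale_mult_left cscale_mult_right cscale_diff)

lemma commutator_cscale_right: "commutator A (cscale c B) = cscale c (commutator A B)"
  by (simp add: commutator_def cscale_mult_left cscale_mult_right cscale_diff)

lemma commutator_scaleR_right: "commutator A (r *\<^sub>R B) = r *\<^sub>R commutator A B"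
  by (simp add: scaleR_cscale commutator_cscale_right)

lemma commutator_anticomm: "commutator A B = - commutator B A"
  by (simp add: commutator_def)

lemma commutator_self [simp]: "commutator A A = 0"
  by (simp add: commutator_def)

lemma commutator_zero_right [simp]: "commutator A 0 = 0"
  by (simp add: commutator_def)

lemma linear_commutator: "linear (commutator A)"
  by (auto simp: linear_iff commutator_add_right commutator_scaleR_right)

lemma commutator_sum_right: "commutator A (sum f S) = (\<Sum>x\<in>S. commutator A (f x))"
  using linear_sum [OF linear_commutator] .

text \<open>Stands for \<open>g \<tau> = exp (\<tau> A)\<close>. For root elements the group law
  comes from the homomorphisms \<open>\<phi> \<alpha>\<close>, so that the exponential series has to
  supply only the derivative at 0.\<close>

locale matrix_one_parameter_group =
  fixes g :: "real \<Rightarrow> complex^'n^'n" and A :: "complex^'n^'n"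
  assumes g_add: "g (a + b) = g a ** g b"
    and g_zero: "g 0 = mat 1"
    and g_deriv: "(g has_vector_derivative A) (at 0)"
begin

definition conj_by :: "real \<Rightarrow> complex^'n^'n \<Rightarrow> complex^'n^'n" where
  "conj_by \<tau> Y = g \<tau> ** Y ** g (- \<tau>)"

lemma linear_conj_by: "linear (conj_by \<tau>)"
  using linear_compose [OF linear_matrix_mult_left linear_matrix_mult_right]
  by (simp add: conj_by_def [abs_def] o_def)

text \<open>At 0, where \<open>g\<close> is the identity, this is the product rule. Sums of
  parameters become compositions of the linear maps \<open>conj_by\<close>, which moves the
  derivative from 0 to \<open>\<tau>\<close>.\<close>

lemma conj_by_deriv:
  "((\<lambda>\<tau>. conj_by \<tau> Y) has_vector_derivative conj_by \<tau> (commutator A Y)) (at \<tau>)"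
proof -
  have neg: "((\<lambda>h. g (- h)) has_vector_derivative (- A)) (at 0)"
  proof -
    have "((\<lambda>h. - h) has_real_derivative - 1) (at 0)"
      by (auto intro!: derivative_eq_intros)
    then show ?thesis
      using vector_diff_chain_at [of uminus "- 1" 0 g A] g_deriv
      by (simp add: has_real_derivative_iff_has_vector_derivative o_def)
  qed
  have "((\<lambda>h. g h ** (Y ** g (- h))) has_vector_derivative
      g 0 ** (Y ** (- A)) + A ** (Y ** g (- 0))) (at 0)"
    by (intro bounded_bilinear.has_vector_derivative [OF bounded_bilinear_matrix_mult] g_deriv
        bounded_linear.has_vector_derivative [OF bounded_linear_matrix_mult_left neg])
  then have "((\<lambda>h. conj_by h Y) has_vector_derivative commutator A Y) (at 0)"
    by (simp add: g_zero conj_by_def commutator_def mult_minus_right matrix_mul_assoc)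
  then have "((\<lambda>h. conj_by \<tau> (conj_by h Y)) has_vector_derivative conj_by \<tau> (commutator A Y)) (at 0)"
    by (rule bounded_linear.has_vector_derivative
        [OF linear_conj_by [THEN linear_conv_bounded_linear [THEN iffD1]]])
  moreover have "conj_by \<tau> (conj_by h Y) = conj_by (\<tau> + h) Y" for h
  proof -
    have "g (- (\<tau> + h)) = g (- h) ** g (- \<tau>)"
      by (simp add: algebra_simps flip: g_add)
    then show ?thesis
      by (simp add: conj_by_def g_add matrix_mul_assoc)
  qed
  ultimately have "((\<lambda>h. conj_by (\<tau> + h) Y) has_vector_derivative conj_by \<tau> (commutator A Y)) (at 0)"
    by simp
  then show ?thesis
    using vector_diff_chain_at [of "\<lambda>x. x - \<tau>" 1 \<tau> "\<lambda>h. conj_by (\<tau> + h) Y"]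
    by (simp add: o_def has_vector_derivative_diff_const)
qed

text \<open>Taylor's formula with Lagrange remainder is about real functions, so the curve is paired
  with a test matrix \<open>Z\<close>, on which \<open>\<xi>\<close> depends. Each differentiation
  inserts one more commutator with \<open>A\<close>.\<close>

lemma conj_by_Maclaurin:
  "\<exists>\<xi>. \<bar>\<xi>\<bar> \<le> 1 \<and> inner Z (conj_by 1 Y) =
     (\<Sum>m<n. inner Z ((commutator A ^^ m) Y) / fact m) + inner Z (conj_by \<xi> ((commutator A ^^ n) Y)) / fact n"
proof -
  define u where "u m \<tau> = inner Z (conj_by \<tau> ((commutator A ^^ m) Y))" for m \<tau>
  have "(u m has_real_derivative u (Suc m) \<tau>) (at \<tau>)" for m \<tau>
    using bounded_linear.has_vector_derivative [OF bounded_linear_inner_right conj_by_deriv]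
    by (simp add: u_def [abs_def] has_real_derivative_iff_has_vector_derivative)
  then have "\<exists>\<xi>. \<bar>\<xi>\<bar> \<le> \<bar>1\<bar> \<and>
      u 0 1 = (\<Sum>m<n. u m 0 / fact m * 1 ^ m) + u n \<xi> / fact n * 1 ^ n"
    by (intro Maclaurin_all_le) auto
  then show ?thesis
    by (simp add: u_def conj_by_def [of 0] g_zero)
qed

text \<open>The remainder of order 3 vanishes against every \<open>Z\<close>. This is the case of a
  root vector acting on the span of \<open>X \<alpha>\<close>, \<open>X (- \<alpha>)\<close> and
  \<open>h \<alpha>\<close>.\<close>

lemma conj_by_quadratic:
  assumes "commutator A (commutator A (commutator A Y)) = 0"
  shows "g 1 ** Y ** g (- 1) = Y + commutator A Y + (1/2) *\<^sub>R commutator A (commutator A Y)"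
proof (rule vector_eq_ldot [THEN iffD1], rule allI)
  fix Z
  show "Z \<bullet> (g 1 ** Y ** g (- 1)) =
      Z \<bullet> (Y + commutator A Y + (1/2) *\<^sub>R commutator A (commutator A Y))"
    using conj_by_Maclaurin [of Z Y 3] assms
    by (simp add: eval_nat_numeral inner_add_right) (simp add: conj_by_def)
qed

text \<open>Against \<open>Z\<close> orthogonal to \<open>S\<close> all Taylor terms vanish, and the
  remainder is at most a constant times \<open>M ^ n / fact n\<close>, which tends to 0. So the
  conjugate lies in the double orthogonal complement of \<open>S\<close>, which is
  \<open>S\<close>.\<close>

lemma conj_by_invariant_subspace:
  assumes S: "subspace S" and inv: "\<And>Y. Y \<in> S \<Longrightarrow> commutator A Y \<in> S" and Y: "Y \<in> S"
  shows "g 1 ** Y ** g (- 1) \<in> S"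
proof -
  have pow: "(commutator A ^^ m) Y \<in> S" for m
    by (induction m) (use inv Y in auto)
  obtain M where M: "M > 0" "\<And>W. norm (commutator A W) \<le> M * norm W"
    using linear_bounded_pos [OF linear_commutator, of A] by metis
  have normpow: "norm ((commutator A ^^ m) Y) \<le> M ^ m * norm Y" for m
  proof (induction m)
    case (Suc m)
    have "norm ((commutator A ^^ Suc m) Y) \<le> M * norm ((commutator A ^^ m) Y)"
      using M(2) by simp
    also have "\<dots> \<le> M * (M ^ m * norm Y)"
      using Suc M(1) by simp
    finally show ?case by (simp add: mult.assoc)
  qed simp
  \<comment> \<open>Needed for a bound of \<open>g\<close> on the interval from -1 to 1, over which
    the point \<open>\<xi>\<close> of the remainder ranges.\<close>
  have deriv: "(g has_vector_derivative g \<tau> ** A) (at \<tau>)" for \<tau>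
  proof -
    have "((\<lambda>h. g \<tau> ** g h) has_vector_derivative g \<tau> ** A) (at 0)"
      by (rule bounded_linear.has_vector_derivative [OF bounded_linear_matrix_mult_left g_deriv])
    then show ?thesis
      using vector_diff_chain_at [of "\<lambda>x. x - \<tau>" 1 \<tau> "\<lambda>h. g \<tau> ** g h"]
      by (simp add: o_def has_vector_derivative_diff_const flip: g_add)
  qed
  then have "continuous_on {-1..1} g"
    by (meson continuous_at_imp_continuous_on has_vector_derivative_continuous)
  then have "bounded (g ` {-1..1})"
    using compact_continuous_image compact_imp_bounded by blast
  then obtain G where G: "\<And>\<tau>. \<bar>\<tau>\<bar> \<le> 1 \<Longrightarrow> norm (g \<tau>) \<le> G"
    unfolding bounded_iff by (metis abs_le_iff atLeastAtMost_iff imageI minus_le_iff)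
  then have G0: "0 \<le> G"
    by (smt (verit, best) norm_ge_zero)
  have "\<exists>b>0. \<forall>(P :: complex^'n^'n) (Q :: complex^'n^'n). norm (P ** Q) \<le> norm P * norm Q * b"
    by (rule bounded_bilinear.pos_bounded [OF bounded_bilinear_matrix_mult])
  then obtain b where b: "b > 0" "\<And>(P :: complex^'n^'n) (Q :: complex^'n^'n). norm (P ** Q) \<le> norm P * norm Q * b"
    by auto
  have conj_bound: "norm (conj_by \<tau> W) \<le> G * norm W * b * G * b" if "\<bar>\<tau>\<bar> \<le> 1" for \<tau> W
  proof -
    have "norm (conj_by \<tau> W) \<le> norm (g \<tau> ** W) * norm (g (- \<tau>)) * b"
      unfolding conj_by_def by (rule b)
    also have "\<dots> \<le> (G * norm W * b) * G * b"
    proof -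
      have "norm (g \<tau> ** W) \<le> G * norm W * b"
        using b(2) [of "g \<tau>" W] G [OF that] b(1)
        by (meson dual_order.trans less_imp_le mult_right_mono norm_ge_zero)
      moreover have "norm (g (- \<tau>)) \<le> G"
        using G that by simp
      ultimately show ?thesis
        using b(1) by (intro mult_right_mono mult_mono) (auto intro: order_trans [OF norm_ge_zero])
    qed
    finally show ?thesis .
  qed
  have "inner Z (g 1 ** Y ** g (- 1)) = 0" if Z: "\<And>W. W \<in> S \<Longrightarrow> inner Z W = 0" for Z
  proof -
    let ?B = "norm Z * (G * norm Y * b * G * b)"
    have bound: "\<bar>inner Z (conj_by 1 Y)\<bar> \<le> ?B * (inverse (fact n) * M ^ n)" for n
    proof -
      obtain \<xi> where \<xi>: "\<bar>\<xi>\<bar> \<le> 1"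
        "inner Z (conj_by 1 Y) = inner Z (conj_by \<xi> ((commutator A ^^ n) Y)) / fact n"
        using conj_by_Maclaurin [of Z Y n] Z pow by auto
      have "\<bar>inner Z (conj_by \<xi> ((commutator A ^^ n) Y))\<bar> \<le>
          norm Z * norm (conj_by \<xi> ((commutator A ^^ n) Y))"
        by (rule Cauchy_Schwarz_ineq2)
      also have "\<dots> \<le> norm Z * (G * norm ((commutator A ^^ n) Y) * b * G * b)"
        using conj_bound \<xi>(1) by (intro mult_left_mono) auto
      also have "\<dots> \<le> norm Z * (G * (M ^ n * norm Y) * b * G * b)"
        using normpow b(1) G0 by (intro mult_left_mono mult_right_mono) auto
      also have "\<dots> = ?B * M ^ n"
        by simp
      finally show ?thesis
        unfolding \<xi>(2) by (simp add: abs_mult field_simps)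
    qed
    have "(\<lambda>n. ?B * (inverse (fact n) * M ^ n)) \<longlonglongrightarrow> ?B * 0"
      by (intro tendsto_mult_left summable_LIMSEQ_zero summable_exp)
    then have "\<bar>inner Z (conj_by 1 Y)\<bar> \<le> ?B * 0"
      using bound by (intro LIMSEQ_le_const) auto
    then show ?thesis
      by (simp add: conj_by_def)
  qed
  then have "g 1 ** Y ** g (- 1) \<in> orthogonal_comp (orthogonal_comp S)"
    by (auto simp: orthogonal_comp_def orthogonal_def inner_commute)
  then show ?thesis
    using S by (simp add: orthogonal_comp_self)
qed

end

text \<open>Applying \<open>L - l m\<close> removes the summand of \<open>m\<close> and multiplies
  the others by nonzero factors, so that the induction hypothesis applies to them.\<close>

lemma eigenvectors_sum_zero:
  fixes L :: "'a::real_vector \<Rightarrow> 'a"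
  assumes "finite S" "linear L" "\<And>x. x \<in> S \<Longrightarrow> L (y x) = l x *\<^sub>R y x" "inj_on l S"
    "(\<Sum>x\<in>S. y x) = 0"
  shows "\<forall>x\<in>S. y x = 0"
  using assms
proof (induction S arbitrary: y rule: finite_induct)
  case (insert m S)
  have "0 = L (\<Sum>x\<in>insert m S. y x) - l m *\<^sub>R (\<Sum>x\<in>insert m S. y x)"
    using insert.prems by (simp add: linear_0)
  also have "\<dots> = (\<Sum>x\<in>insert m S. l x *\<^sub>R y x) - (\<Sum>x\<in>insert m S. l m *\<^sub>R y x)"
    using insert.prems(2) by (simp add: linear_sum [OF insert.prems(1)] scaleR_sum_right)
  also have "\<dots> = (\<Sum>x\<in>S. (l x - l m) *\<^sub>R y x)"
    using insert.hyps by (simp add: sum_subtractf scaleR_diff_left)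
  finally have "(\<Sum>x\<in>S. (l x - l m) *\<^sub>R y x) = 0"
    by simp
  then have *: "\<forall>x\<in>S. (l x - l m) *\<^sub>R y x = 0"
    using insert.prems by (intro insert.IH) (auto simp: linear_cmul)
  then have "\<forall>x\<in>S. y x = 0"
  proof (intro ballI)
    fix x assume "x \<in> S"
    moreover from this have "l x \<noteq> l m"
      using insert.prems(3) insert.hyps by (auto simp: inj_on_def)
    ultimately show "y x = 0"
      using * by auto
  qed
  then show ?case
    using insert.prems(4) insert.hyps by simp
qed simp

section \<open>Two by two matrices\<close>

definition m2 :: "complex \<Rightarrow> complex \<Rightarrow> complex \<Rightarrow> complex \<Rightarrow> complex^2^2" where
  "m2 a b c d = vector [vector [a, b], vector [c, d]]"

lemma m2_nth [simp]: "m2 a b c d $ 1 $ 1 = a" "m2 a b c d $ 1 $ 2 = b"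
  "m2 a b c d $ 2 $ 1 = c" "m2 a b c d $ 2 $ 2 = d"
  by (simp_all add: m2_def)

lemma m2_eq_iff: "A = B \<longleftrightarrow> A $ 1 $ 1 = B $ 1 $ 1 \<and> A $ 1 $ 2 = B $ 1 $ 2 \<and>
    A $ 2 $ 1 = B $ 2 $ 1 \<and> A $ 2 $ 2 = B $ 2 $ 2" for A B :: "complex^2^2"
  by (auto simp: vec_eq_iff forall_2)

lemma m2_mult [simp]: "m2 a b c d ** m2 a' b' c' d' =
    m2 (a * a' + b * c') (a * b' + b * d') (c * a' + d * c') (c * b' + d * d')"
  by (simp add: m2_eq_iff matrix_matrix_mult_def sum_2)

lemma m2_det [simp]: "det (m2 a b c d) = a * d - b * c"
  by (simp add: det_2)

lemma m2_cases:
  fixes A :: "complex^2^2"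
  obtains a b c d where "A = m2 a b c d"
proof
  show "A = m2 (A $ 1 $ 1) (A $ 1 $ 2) (A $ 2 $ 1) (A $ 2 $ 2)"
    by (simp add: m2_eq_iff)
qed

lemma m2_one: "mat 1 = m2 1 0 0 1"
  by (simp add: m2_eq_iff mat_def)

lemma upper_m2: "upper_unitri t = m2 1 t 0 1"
  by (simp add: upper_unitri_def m2_def)

lemma lower_m2: "lower_unitri t = m2 1 0 t 1"
  by (simp add: lower_unitri_def m2_def)

lemma m2_inv: "a * d - b * c = 1 \<Longrightarrow> matrix_inv (m2 a b c d) = m2 d (- b) (- c) a"
  by (intro matrix_inv_unique) (simp_all add: m2_one algebra_simps)

lemma SL2_invertible: "det A = 1 \<Longrightarrow> invertible A" for A :: "complex^2^2"
  by (simp add: invertible_det_nz)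

lemma SL2_det_inv: "det A = 1 \<Longrightarrow> det (matrix_inv A) = 1" for A :: "complex^2^2"
  by (cases A rule: m2_cases) (simp add: m2_inv algebra_simps)

lemma m2_trace: "trace (m2 a b c d) = a + d"
  by (simp add: trace_def sum_2)

text \<open>The unitriangular matrices generate SL_2. If the lower left entry \<open>c\<close> is
  nonzero, elimination gives upper times lower times upper. If \<open>c = 0\<close>, adding the
  second column to the first makes that entry \<open>d\<close>, which is nonzero.\<close>

lemma SL2_induct [consumes 1, case_names upper lower mult]:
  fixes A :: "complex^2^2"
  assumes "det A = 1"
    and upper: "\<And>t. P (upper_unitri t)"
    and lower: "\<And>t. P (lower_unitri t)"
    and mult: "\<And>A B. det A = 1 \<Longrightarrow> det B = 1 \<Longrightarrow> P A \<Longrightarrow> P B \<Longrightarrow> P (A ** B)"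
  shows "P A"
proof -
  have *: "P (m2 a b c d)" if "c \<noteq> 0" "a * d - b * c = 1" for a b c d
  proof -
    have "m2 a b c d = upper_unitri ((a - 1) / c) ** (lower_unitri c ** upper_unitri ((d - 1) / c))"
      using that by (simp add: upper_m2 lower_m2 m2_eq_iff divide_simps) (simp add: algebra_simps)
    then show ?thesis
      by (simp only:) (intro mult upper lower, simp_all add: upper_m2 lower_m2)
  qed
  obtain a b c d where A: "A = m2 a b c d"
    by (rule m2_cases)
  show ?thesis
  proof (cases "c = 0")
    case True
    with assms(1) A have ad: "a * d = 1"
      by simp
    then have "P (m2 (a + b) b d d)"
      by (intro *) (auto simp: algebra_simps)
    moreover have "A = m2 (a + b) b d d ** lower_unitri (- 1)"
      using A True by (simp add: lower_m2)
    ultimately show ?thesis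
      using mult [OF _ _ _ lower [of "- 1"], of "m2 (a + b) b d d"] ad
      by (simp add: lower_m2 algebra_simps)
  next
    case False
    then show ?thesis
      using * assms(1) A by simp
  qed
qed

lemma m2_adjoint: "map_matrix cnj (transpose (m2 a b c d)) = m2 (cnj a) (cnj c) (cnj b) (cnj d)"
  by (simp add: m2_eq_iff map_matrix_def transpose_def)

text \<open>For determinant 1 the inverse is the adjugate; equating it with the conjugate transpose
  leaves \<open>a\<close> and \<open>c\<close> as free entries.\<close>

lemma SU2_cases:
  assumes "A \<in> SU2"
  obtains a c where "A = m2 a (- cnj c) c (cnj a)" "a * cnj a + c * cnj c = 1"
proof -
  obtain a b c d where A: "A = m2 a b c d"
    by (rule m2_cases)
  have det: "a * d - b * c = 1"
    using assms by (simp add: SU2_def A)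
  have "m2 a b c d ** m2 (cnj a) (cnj c) (cnj b) (cnj d) = m2 1 0 0 1"
    using assms unfolding SU2_def A mem_Collect_eq m2_adjoint m2_one by blast
  then have eqs: "a * cnj a + b * cnj b = 1" "a * cnj c + b * cnj d = 0"
    "c * cnj a + d * cnj b = 0" "c * cnj c + d * cnj d = 1"
    by (auto simp: m2_eq_iff)
  have d: "d = cnj a"
    using det eqs(1,3) by algebra
  have "c = - cnj b"
    using det eqs(1,3) by algebra
  then have "b = - cnj c"
    by simp
  with A d det show thesis
    by (intro that [of a c]) (auto simp: mult.commute)
qed

lemma SU2_m2:
  assumes "a * cnj a + c * cnj c = 1"
  shows "m2 a (- cnj c) c (cnj a) \<in> SU2"
  using assms unfolding SU2_def m2_adjoint mem_Collect_eq by (simp add: m2_one algebra_simps)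

lemma SU2_det: "A \<in> SU2 \<Longrightarrow> det A = 1"
  by (simp add: SU2_def)

lemma SU2_mult: "A \<in> SU2 \<Longrightarrow> B \<in> SU2 \<Longrightarrow> A ** B \<in> SU2"
proof -
  assume A: "A \<in> SU2" and B: "B \<in> SU2"
  obtain a c where a: "A = m2 a (- cnj c) c (cnj a)" "a * cnj a + c * cnj c = 1"
    using A by (rule SU2_cases)
  obtain a' c' where b: "B = m2 a' (- cnj c') c' (cnj a')" "a' * cnj a' + c' * cnj c' = 1"
    using B by (rule SU2_cases)
  let ?p = "a * a' - cnj c * c'" and ?q = "c * a' + cnj a * c'"
  \<comment> \<open>Multiplicativity of the quaternion norm.\<close>
  have "?p * cnj ?p + ?q * cnj ?q = (a * cnj a + c * cnj c) * (a' * cnj a' + c' * cnj c')"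
    by (simp add: algebra_simps)
  then have "m2 ?p (- cnj ?q) ?q (cnj ?p) \<in> SU2"
    using a b by (intro SU2_m2) simp
  then show ?thesis
    by (simp add: a b algebra_simps)
qed

lemma SU2_inv: "A \<in> SU2 \<Longrightarrow> matrix_inv A \<in> SU2"
proof -
  assume "A \<in> SU2"
  then obtain a c where a: "A = m2 a (- cnj c) c (cnj a)" "a * cnj a + c * cnj c = 1"
    by (rule SU2_cases)
  then have "matrix_inv A = m2 (cnj a) (cnj c) (- c) a"
    by (simp add: m2_inv algebra_simps)
  then show ?thesis
    using SU2_m2 [of "cnj a" "- c"] a by (simp add: algebra_simps)
qed

lemma SU2_diag: "norm u = 1 \<Longrightarrow> m2 u 0 0 (cnj u) \<in> SU2"
  using SU2_m2 [of u 0] by (simp add: complex_norm_square [symmetric])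

section \<open>Root subgroups\<close>

lemma group_GL: "group (GL :: (complex^'n^'n) monoid)"
proof (rule groupI)
  fix x :: "complex^'n^'n" assume "x \<in> carrier GL"
  then show "\<exists>y\<in>carrier GL. y \<otimes>\<^bsub>GL\<^esub> x = \<one>\<^bsub>GL\<^esub>"
    by (intro bexI [of _ "matrix_inv x"]) (auto simp: GL_def matrix_inv_left)
qed (auto simp: GL_def invertible_mult matrix_mul_assoc)

lemma GL_simps: "mult GL = (**)" "one GL = mat 1" "carrier GL = {A. invertible A}"
  by (simp_all add: GL_def)

lemma GL_inv: "invertible A \<Longrightarrow> inv\<^bsub>GL\<^esub> A = matrix_inv A" for A :: "complex^'n^'n"
  by (rule group.inv_equality [OF group_GL]) (auto simp: GL_def matrix_inv_left)

lemma reflection_orthogonal: "orthogonal_transformation (reflection \<alpha>)"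
proof (cases "\<alpha> = 0")
  case False
  show ?thesis
    unfolding orthogonal_transformation_def
  proof (intro conjI allI)
    show "linear (reflection \<alpha>)"
      by (auto simp: linear_iff reflection_def inner_add_left algebra_simps add_divide_distrib)
    fix x y
    show "reflection \<alpha> x \<bullet> reflection \<alpha> y = x \<bullet> y"
      using False by (simp add: reflection_def inner_diff_left inner_diff_right field_simps inner_commute)
  qed
qed (simp add: reflection_def [abs_def] orthogonal_transformation_id)

lemma reflection_reflection [simp]: "reflection \<alpha> (reflection \<alpha> x) = x"
  by (cases "\<alpha> = 0") (simp_all add: reflection_def inner_diff_left)

lemma reflection_self: "\<alpha> \<noteq> 0 \<Longrightarrow> reflection \<alpha> \<alpha> = - \<alpha>"
  by (simp add: reflection_def algebra_simps scaleR_2)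

lemma reflection_uminus: "reflection (- \<alpha>) = reflection \<alpha>"
  by (simp add: reflection_def fun_eq_iff)

lemma reflection_conj:
  assumes "orthogonal_transformation w"
  shows "reflection (w \<alpha>) (w x) = w (reflection \<alpha> x)"
  using assms unfolding orthogonal_transformation_def reflection_def
  by (simp add: linear_diff linear_cmul)

section \<open>Root system, root vectors and coroot elements\<close>

context chevalley_group
begin

lemma finite_roots: "finite \<Phi>" and root_nonzero: "\<alpha> \<in> \<Phi> \<Longrightarrow> \<alpha> \<noteq> 0"
  and reflection_root: "\<alpha> \<in> \<Phi> \<Longrightarrow> \<beta> \<in> \<Phi> \<Longrightarrow> reflection \<alpha> \<beta> \<in> \<Phi>"
  and root_integral: "\<alpha> \<in> \<Phi> \<Longrightarrow> \<beta> \<in> \<Phi> \<Longrightarrow> 2 * (\<beta> \<bullet> \<alpha>) / (\<alpha> \<bullet> \<alpha>) \<in> \<int>"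
  and root_reduced: "\<alpha> \<in> \<Phi> \<Longrightarrow> c *\<^sub>R \<alpha> \<in> \<Phi> \<Longrightarrow> c = 1 \<or> c = - 1"
  using root_system unfolding root_system_def by auto

lemma root_uminus: "\<alpha> \<in> \<Phi> \<Longrightarrow> - \<alpha> \<in> \<Phi>"
  using reflection_root [of \<alpha> \<alpha>] reflection_self root_nonzero by metis

definition H :: "'e \<Rightarrow> complex^'n^'n" where
  "H = (SOME H. linear H \<and>
        (\<forall>x y. commutator (H x) (H y) = 0) \<and>
        (\<forall>x. \<forall>\<alpha>\<in>\<Phi>. commutator (H x) (X \<alpha>) = (x \<bullet> \<alpha>) *\<^sub>R X \<alpha>) \<and>
        (\<forall>\<alpha>\<in>\<Phi>. commutator (X \<alpha>) (X (- \<alpha>)) = H ((2 / (\<alpha> \<bullet> \<alpha>)) *\<^sub>R \<alpha>)))"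

lemma H_linear: "linear H"
  and H_X: "\<alpha> \<in> \<Phi> \<Longrightarrow> commutator (H x) (X \<alpha>) = (x \<bullet> \<alpha>) *\<^sub>R X \<alpha>"
  and X_X_uminus: "\<alpha> \<in> \<Phi> \<Longrightarrow> commutator (X \<alpha>) (X (- \<alpha>)) = H ((2 / (\<alpha> \<bullet> \<alpha>)) *\<^sub>R \<alpha>)"
proof -
  have "\<exists>H. linear H \<and>
        (\<forall>x y. commutator (H x) (H y) = 0) \<and>
        (\<forall>x. \<forall>\<alpha>\<in>\<Phi>. commutator (H x) (X \<alpha>) = (x \<bullet> \<alpha>) *\<^sub>R X \<alpha>) \<and>
        (\<forall>\<alpha>\<in>\<Phi>. commutator (X \<alpha>) (X (- \<alpha>)) = H ((2 / (\<alpha> \<bullet> \<alpha>)) *\<^sub>R \<alpha>))"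
    using chevalley_system unfolding chevalley_system_def by blast
  from someI_ex [OF this, folded H_def] show "linear H"
    "\<alpha> \<in> \<Phi> \<Longrightarrow> commutator (H x) (X \<alpha>) = (x \<bullet> \<alpha>) *\<^sub>R X \<alpha>"
    "\<alpha> \<in> \<Phi> \<Longrightarrow> commutator (X \<alpha>) (X (- \<alpha>)) = H ((2 / (\<alpha> \<bullet> \<alpha>)) *\<^sub>R \<alpha>)"
    by blast+
qed

lemma X_nonzero: "\<alpha> \<in> \<Phi> \<Longrightarrow> X \<alpha> \<noteq> 0"
  using chevalley_system unfolding chevalley_system_def by blast

lemma X_X_string:
  assumes "\<alpha> \<in> \<Phi>" "\<beta> \<in> \<Phi>" "\<alpha> + \<beta> \<noteq> 0"
  shows "\<alpha> + \<beta> \<in> \<Phi> \<Longrightarrow> \<exists>a. commutator (X \<alpha>) (X \<beta>) = cscale a (X (\<alpha> + \<beta>))"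
    and "\<alpha> + \<beta> \<notin> \<Phi> \<Longrightarrow> commutator (X \<alpha>) (X \<beta>) = 0"
proof -
  have *: "if \<alpha> + \<beta> \<in> \<Phi>
         then let r = Max {k::nat. \<beta> - real k *\<^sub>R \<alpha> \<in> \<Phi>} in
                commutator (X \<alpha>) (X \<beta>) = real (r + 1) *\<^sub>R X (\<alpha> + \<beta>) \<or>
                commutator (X \<alpha>) (X \<beta>) = - (real (r + 1) *\<^sub>R X (\<alpha> + \<beta>))
         else commutator (X \<alpha>) (X \<beta>) = 0"
    using chevalley_system assms unfolding chevalley_system_def by blast
  then show "\<alpha> + \<beta> \<notin> \<Phi> \<Longrightarrow> commutator (X \<alpha>) (X \<beta>) = 0"
    by simp
  assume "\<alpha> + \<beta> \<in> \<Phi>"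
  with * show "\<exists>a. commutator (X \<alpha>) (X \<beta>) = cscale a (X (\<alpha> + \<beta>))"
    unfolding Let_def scaleR_cscale cscale_minus_left [symmetric] by auto
qed

definition h :: "'e \<Rightarrow> complex^'n^'n" where
  "h \<alpha> = commutator (X \<alpha>) (X (- \<alpha>))"

lemma h_H: "\<alpha> \<in> \<Phi> \<Longrightarrow> h \<alpha> = H ((2 / (\<alpha> \<bullet> \<alpha>)) *\<^sub>R \<alpha>)"
  by (simp add: h_def X_X_uminus)

lemma h_X: "\<alpha> \<in> \<Phi> \<Longrightarrow> commutator (h \<alpha>) (X \<alpha>) = cscale 2 (X \<alpha>)"
  and h_X_uminus: "\<alpha> \<in> \<Phi> \<Longrightarrow> commutator (h \<alpha>) (X (- \<alpha>)) = cscale (- 2) (X (- \<alpha>))"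
  by (simp_all add: h_H H_X root_uminus root_nonzero scaleR_cscale)

lemma X_h: "\<alpha> \<in> \<Phi> \<Longrightarrow> commutator (X \<alpha>) (h \<alpha>) = cscale (- 2) (X \<alpha>)"
  by (subst commutator_anticomm) (simp add: h_X cscale_minus_left)

lemma h_uminus: "h (- \<alpha>) = - h \<alpha>"
  unfolding h_def by (subst commutator_anticomm) simp

lemma h_nonzero: "\<alpha> \<in> \<Phi> \<Longrightarrow> h \<alpha> \<noteq> 0"
  using h_X [of \<alpha>] X_nonzero [of \<alpha>]
  by (auto simp: commutator_def cscale_eq_0_iff)

text \<open>On matrices of trace 0, this is the differential of \<open>\<phi> \<alpha>\<close>.\<close>

definition \<iota> :: "'e \<Rightarrow> complex^2^2 \<Rightarrow> complex^'n^'n" where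
  "\<iota> \<alpha> M = cscale (M $ 1 $ 2) (X \<alpha>) + cscale (M $ 2 $ 1) (X (- \<alpha>)) + cscale (M $ 1 $ 1) (h \<alpha>)"

text \<open>The three matrices are eigenvectors of \<open>commutator (h \<alpha>)\<close> for 2, -2
  and 0. Applied to the relation this operator yields \<open>u = v\<close>, and applied to
  \<open>u = v\<close> it yields \<open>u = 0\<close>.\<close>

lemma \<iota>_zero_iff:
  assumes "\<alpha> \<in> \<Phi>"
  shows "cscale p (X \<alpha>) + cscale q (X (- \<alpha>)) + cscale r (h \<alpha>) = 0 \<longleftrightarrow> p = 0 \<and> q = 0 \<and> r = 0"
proof
  define u v w where uvw: "u = cscale p (X \<alpha>)" "v = cscale q (X (- \<alpha>))" "w = cscale r (h \<alpha>)"
  let ?L = "commutator (h \<alpha>)"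
  assume "cscale p (X \<alpha>) + cscale q (X (- \<alpha>)) + cscale r (h \<alpha>) = 0"
  then have 0: "u + v + w = 0"
    by (simp add: uvw)
  have L: "?L u = cscale 2 u" "?L v = cscale (- 2) v" "?L w = 0"
    by (simp_all add: uvw commutator_cscale_right h_X h_X_uminus assms mult.commute)
  have "?L (u + v + w) = 0"
    by (simp add: 0)
  then have "cscale 2 u + cscale (- 2) v = 0"
    by (simp add: L commutator_add_right)
  then have uv: "u = v"
    by (auto simp: vec_eq_iff add_eq_0_iff)
  then have "cscale 2 u = cscale (- 2) u"
    using L by simp
  then have "u = 0"
    by (auto simp: vec_eq_iff)
  with uv 0 show "p = 0 \<and> q = 0 \<and> r = 0"
    using X_nonzero [of \<alpha>] X_nonzero [of "- \<alpha>"] h_nonzero [of \<alpha>] assms root_uminus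
    by (auto simp: uvw cscale_eq_0_iff)
qed simp

end

lemma has_vector_derivative_vec:
  fixes f :: "real \<Rightarrow> 'a::real_normed_vector^'n"
  assumes "\<And>i. ((\<lambda>x. f x $ i) has_vector_derivative D $ i) (at x)"
  shows "(f has_vector_derivative D) (at x)"
  unfolding has_vector_derivative_def has_derivative_def
proof (intro conjI vec_tendstoI)
  show "bounded_linear (\<lambda>x. x *\<^sub>R D)"
    by (rule bounded_linear_scaleR_left)
  fix i
  show "((\<lambda>y. ((f y - f (Lim (at x) (\<lambda>x. x)) - (y - Lim (at x) (\<lambda>x. x)) *\<^sub>R D) /\<^sub>R
      norm (y - Lim (at x) (\<lambda>x. x))) $ i) \<longlongrightarrow> 0 $ i) (at x)"
    using assms [of i] unfolding has_vector_derivative_def has_derivative_def by simp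
qed

lemma subgroup_GL:
  assumes "subgroup S (GL :: (complex^'n^'n) monoid)"
  shows "g \<in> S \<Longrightarrow> invertible g" "g \<in> S \<Longrightarrow> h \<in> S \<Longrightarrow> g ** h \<in> S" "mat 1 \<in> S"
    "g \<in> S \<Longrightarrow> matrix_inv g \<in> S"
proof -
  show inv: "g \<in> S \<Longrightarrow> invertible g" for g
    using subgroup.mem_carrier [OF assms] by (simp add: GL_def)
  show "g \<in> S \<Longrightarrow> h \<in> S \<Longrightarrow> g ** h \<in> S"
    using subgroup.m_closed [OF assms, of g h] by (simp add: GL_def)
  show "mat 1 \<in> S"
    using subgroup.one_closed [OF assms] by (simp add: GL_def)
  show "g \<in> S \<Longrightarrow> matrix_inv g \<in> S"
    using subgroup.m_inv_closed [OF assms, of g] inv [of g] by (simp add: GL_inv)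
qed

lemma subgroup_GLI:
  assumes "\<And>g. g \<in> S \<Longrightarrow> invertible g" "\<And>g h. g \<in> S \<Longrightarrow> h \<in> S \<Longrightarrow> g ** h \<in> S" "mat 1 \<in> S"
    "\<And>g. g \<in> S \<Longrightarrow> matrix_inv g \<in> S"
  shows "subgroup S (GL :: (complex^'n^'n) monoid)"
  using assms by (intro group.subgroupI [OF group_GL]) (auto simp: GL_simps GL_inv)

section \<open>Root elements and the homomorphisms from SL_2\<close>

context bott_samelson_setting
begin

lemma x_root_zero [simp]: "x_root \<alpha> 0 = mat 1"
  by (simp add: x_root_def)

lemma \<phi>_mult: "\<alpha> \<in> \<Phi> \<Longrightarrow> det A = 1 \<Longrightarrow> det B = 1 \<Longrightarrow> \<phi> \<alpha> (A ** B) = \<phi> \<alpha> A ** \<phi> \<alpha> B"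
  using hom_mult [OF \<phi>_hom, of \<alpha> A B] by (simp add: SL2_def G_def GL_def)

lemma \<phi>_G: "\<alpha> \<in> \<Phi> \<Longrightarrow> det A = 1 \<Longrightarrow> \<phi> \<alpha> A \<in> carrier G"
  using \<phi>_hom [of \<alpha>] by (auto simp: SL2_def hom_def)

lemma \<phi>_one: "\<alpha> \<in> \<Phi> \<Longrightarrow> \<phi> \<alpha> (mat 1) = mat 1"
  using \<phi>_upper [of \<alpha> 0] by (simp add: upper_m2 m2_one)

lemma \<phi>_inv:
  assumes "\<alpha> \<in> \<Phi>" "det A = 1"
  shows "invertible (\<phi> \<alpha> A)" "matrix_inv (\<phi> \<alpha> A) = \<phi> \<alpha> (matrix_inv A)"
proof -
  have "\<phi> \<alpha> A ** \<phi> \<alpha> (matrix_inv A) = mat 1" "\<phi> \<alpha> (matrix_inv A) ** \<phi> \<alpha> A = mat 1"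
    using assms by (simp_all add: SL2_det_inv SL2_invertible matrix_inv_right matrix_inv_left \<phi>_one
        flip: \<phi>_mult)
  then show "invertible (\<phi> \<alpha> A)" "matrix_inv (\<phi> \<alpha> A) = \<phi> \<alpha> (matrix_inv A)"
    by (auto simp: invertible_def intro: matrix_inv_unique)
qed

lemma x_root_add: "\<alpha> \<in> \<Phi> \<Longrightarrow> x_root \<alpha> (a + b) = x_root \<alpha> a ** x_root \<alpha> b"
  using \<phi>_mult [of \<alpha> "upper_unitri a" "upper_unitri b"] \<phi>_upper
  by (simp add: upper_m2 add.commute)

lemma x_root_inv:
  assumes "\<alpha> \<in> \<Phi>"
  shows "invertible (x_root \<alpha> t)" "matrix_inv (x_root \<alpha> t) = x_root \<alpha> (- t)"
proof -
  have "x_root \<alpha> t ** x_root \<alpha> (- t) = mat 1" "x_root \<alpha> (- t) ** x_root \<alpha> t = mat 1"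
    using assms by (simp_all flip: x_root_add)
  then show "invertible (x_root \<alpha> t)" "matrix_inv (x_root \<alpha> t) = x_root \<alpha> (- t)"
    by (auto simp: invertible_def intro: matrix_inv_unique)
qed

lemma x_root_G: "\<alpha> \<in> \<Phi> \<Longrightarrow> x_root \<alpha> t \<in> carrier G"
  using \<phi>_G [of \<alpha> "upper_unitri t"] by (simp add: \<phi>_upper) (simp add: upper_m2)

text \<open>A complex parameter \<open>t\<close> is reached at time 1 along the real line through
  it, so real one-parameter groups suffice.\<close>

lemma x_root_one_parameter_group:
  assumes "\<alpha> \<in> \<Phi>"
  shows "matrix_one_parameter_group (\<lambda>\<tau>. x_root \<alpha> (of_real \<tau> * t)) (cscale t (X \<alpha>))"
proof
  show "x_root \<alpha> (of_real (a + b) * t) = x_root \<alpha> (of_real a * t) ** x_root \<alpha> (of_real b * t)" for a b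
    using assms by (simp add: distrib_right flip: x_root_add)
  have "((\<lambda>\<tau>. x_root \<alpha> (of_real \<tau> * t) $ i $ j) has_vector_derivative t * X \<alpha> $ i $ j) (at 0)" for i j
  proof -
    have "((\<lambda>z. x_root \<alpha> (z * t) $ i $ j) has_field_derivative X \<alpha> $ i $ j * t) (at 0)"
      unfolding x_root_def
      by (rule DERIV_chain2 [where g = "\<lambda>z. z * t"]) (auto intro!: matrix_exp_entry_deriv derivative_eq_intros)
    then have "((\<lambda>z. x_root \<alpha> (z * t) $ i $ j) has_field_derivative X \<alpha> $ i $ j * t) (at (of_real 0))"
      by simp
    from has_vector_derivative_real_field [OF this] show ?thesis
      by (simp add: mult.commute)
  qed
  then show "((\<lambda>\<tau>. x_root \<alpha> (of_real \<tau> * t)) has_vector_derivative cscale t (X \<alpha>)) (at 0)"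
    by (intro has_vector_derivative_vec) simp
qed simp

lemma x_root_conj_invariant:
  assumes "\<alpha> \<in> \<Phi>" "subspace S" "\<And>Y. Y \<in> S \<Longrightarrow> commutator (cscale t (X \<alpha>)) Y \<in> S" "Y \<in> S"
  shows "x_root \<alpha> t ** Y ** x_root \<alpha> (- t) \<in> S"
  using matrix_one_parameter_group.conj_by_invariant_subspace
      [OF x_root_one_parameter_group [OF assms(1), of t] assms(2-4)]
  by simp

lemma x_root_conj_quadratic:
  assumes "\<alpha> \<in> \<Phi>" "D = commutator (cscale t (X \<alpha>))" "D (D (D Y)) = 0"
  shows "x_root \<alpha> t ** Y = (Y + D Y + (1/2) *\<^sub>R D (D Y)) ** x_root \<alpha> t"
proof -
  have "x_root \<alpha> t ** Y ** x_root \<alpha> (- t) = Y + D Y + (1/2) *\<^sub>R D (D Y)"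
    using matrix_one_parameter_group.conj_by_quadratic [OF x_root_one_parameter_group [OF assms(1), of t]] assms(2,3)
    by simp
  moreover have "x_root \<alpha> t ** Y = x_root \<alpha> t ** Y ** x_root \<alpha> (- t) ** x_root \<alpha> t"
    using x_root_inv [OF assms(1), of t] matrix_inv_left [of "x_root \<alpha> t"]
    by (simp flip: matrix_mul_assoc)
  ultimately show ?thesis
    by simp
qed

subsection \<open>The groups \<open>G\<close>, \<open>T\<close>, \<open>K\<close> and \<open>N\<close>\<close>

lemma G_subgroup: "subgroup (carrier G) GL"
proof -
  have "{x_root \<alpha> t | \<alpha> t. \<alpha> \<in> \<Phi>} \<subseteq> carrier GL"
    using x_root_inv by (auto simp: GL_def)
  then show ?thesis
    by (simp add: G_def group.generate_is_subgroup [OF group_GL])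
qed

lemmas G_closed = subgroup_GL [OF G_subgroup]

lemma G_mult: "mult G = (**)"
  by (simp add: G_def GL_def)

lemma \<sigma>_mult: "g \<in> carrier G \<Longrightarrow> g' \<in> carrier G \<Longrightarrow> \<sigma> (g ** g') = \<sigma> g ** \<sigma> g'"
  using \<sigma>_iso by (auto simp: iso_def hom_def G_mult)

lemma \<sigma>_G: "g \<in> carrier G \<Longrightarrow> \<sigma> g \<in> carrier G"
  using \<sigma>_iso by (auto simp: iso_def hom_def)

lemma \<sigma>_one: "\<sigma> (mat 1) = mat 1"
proof -
  have "\<sigma> (mat 1) ** \<sigma> (mat 1) = \<sigma> (mat 1) ** mat 1"
    by (simp add: G_closed(3) flip: \<sigma>_mult)
  then show ?thesis
    using matrix_left_cancel [OF G_closed(1) [OF \<sigma>_G [OF G_closed(3)]]] by metis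
qed

lemma \<sigma>_inv: "g \<in> carrier G \<Longrightarrow> \<sigma> (matrix_inv g) = matrix_inv (\<sigma> g)"
proof -
  assume g: "g \<in> carrier G"
  then have "\<sigma> g ** \<sigma> (matrix_inv g) = mat 1" "\<sigma> (matrix_inv g) ** \<sigma> g = mat 1"
    using G_closed(1,4) [OF g]
    by (simp_all add: matrix_inv_right matrix_inv_left \<sigma>_one flip: \<sigma>_mult)
  then show ?thesis
    by (metis matrix_inv_unique)
qed

lemma C_subgroup: "subgroup C GL"
  using G_closed by (intro subgroup_GLI) (auto simp: C_def \<sigma>_mult \<sigma>_one \<sigma>_inv)

lemma w_root_\<phi>:
  assumes "\<alpha> \<in> \<Phi>" "t \<noteq> 0"
  shows "w_root \<alpha> t = \<phi> \<alpha> (m2 0 t (- inverse t) 0)"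
proof -
  have "m2 0 t (- inverse t) 0 = upper_unitri t ** (lower_unitri (- inverse t) ** upper_unitri t)"
    using assms by (simp add: upper_m2 lower_m2)
  then have "\<phi> \<alpha> (m2 0 t (- inverse t) 0) =
      \<phi> \<alpha> (upper_unitri t) ** (\<phi> \<alpha> (lower_unitri (- inverse t)) ** \<phi> \<alpha> (upper_unitri t))"
    using assms by (simp add: \<phi>_mult det_mul upper_m2 lower_m2 del: m2_mult)
  then show ?thesis
    using assms by (simp add: w_root_def \<phi>_upper \<phi>_lower matrix_mul_assoc)
qed

lemma \<omega>_\<phi>: "\<alpha> \<in> \<Phi> \<Longrightarrow> \<omega> \<alpha> = \<phi> \<alpha> (m2 0 1 (- 1) 0)"
  by (simp add: \<omega>_def w_root_\<phi>)

lemma h_root_\<phi>: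
  assumes "\<alpha> \<in> \<Phi>" "t \<noteq> 0"
  shows "h_root \<alpha> t = \<phi> \<alpha> (m2 t 0 0 (inverse t))"
proof -
  have "h_root \<alpha> t = \<phi> \<alpha> (m2 0 t (- inverse t) 0) ** \<phi> \<alpha> (m2 0 (- 1) 1 0)"
    using assms by (simp add: h_root_def w_root_\<phi> \<omega>_\<phi> \<phi>_inv m2_inv)
  also have "\<dots> = \<phi> \<alpha> (m2 t 0 0 (inverse t))"
    using assms by (simp flip: \<phi>_mult)
  finally show ?thesis .
qed

lemma T_subgroup: "subgroup T GL" and T_G: "T \<subseteq> carrier G"
proof -
  have sub: "{h_root \<alpha> t | \<alpha> t. \<alpha> \<in> \<Phi> \<and> t \<noteq> 0} \<subseteq> carrier G"
    by (auto simp: h_root_\<phi> intro!: \<phi>_G)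
  then show "subgroup T GL"
    unfolding T_def by (intro group.generate_is_subgroup [OF group_GL])
      (auto simp: GL_simps dest: G_closed(1))
  show "T \<subseteq> carrier G"
    unfolding T_def by (rule group.generate_subgroup_incl [OF group_GL sub G_subgroup])
qed

lemma K_subgroup: "subgroup K GL"
  using subgroup_GL [OF T_subgroup] T_G
  by (intro subgroup_GLI) (auto simp: K_def \<sigma>_mult \<sigma>_one \<sigma>_inv subset_iff)

lemmas K_closed = subgroup_GL [OF K_subgroup]

lemma K_G: "k \<in> K \<Longrightarrow> k \<in> carrier G"
  using T_G by (auto simp: K_def)

text \<open>The matrix on the right is the inverse conjugate transpose of \<open>A\<close>.\<close>

lemma \<sigma>_\<phi>:
  assumes "\<alpha> \<in> \<Phi>" "det A = 1"
  shows "\<sigma> (\<phi> \<alpha> A) = \<phi> \<alpha> (m2 (cnj (A $ 2 $ 2)) (- cnj (A $ 2 $ 1)) (- cnj (A $ 1 $ 2)) (cnj (A $ 1 $ 1)))"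
  using assms(2)
proof (induction rule: SL2_induct)
  case (upper t)
  then show ?case
    using assms(1) by (simp add: \<phi>_upper \<sigma>_x flip: \<phi>_lower) (simp add: upper_m2 lower_m2)
next
  case (lower t)
  have "\<sigma> (\<phi> \<alpha> (lower_unitri t)) = \<phi> \<alpha> (upper_unitri (- cnj t))"
    using assms(1) \<sigma>_x [of "- \<alpha>" t] by (simp add: \<phi>_lower \<phi>_upper root_uminus)
  then show ?case
    by (simp add: upper_m2 lower_m2)
next
  case (mult A B)
  obtain a b c d where A: "A = m2 a b c d"
    by (rule m2_cases)
  obtain a' b' c' d' where B: "B = m2 a' b' c' d'"
    by (rule m2_cases)
  have "\<sigma> (\<phi> \<alpha> (A ** B)) = \<phi> \<alpha> (m2 (cnj d) (- cnj c) (- cnj b) (cnj a)) **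
      \<phi> \<alpha> (m2 (cnj d') (- cnj c') (- cnj b') (cnj a'))"
    using mult assms(1) by (simp add: \<phi>_mult \<sigma>_mult \<phi>_G A B del: m2_mult)
  also have "\<dots> = \<phi> \<alpha> (m2 (cnj d) (- cnj c) (- cnj b) (cnj a) **
      m2 (cnj d') (- cnj c') (- cnj b') (cnj a'))"
  proof (rule \<phi>_mult [OF assms(1), symmetric])
    have "cnj (a * d - b * c) = 1" "cnj (a' * d' - b' * c') = 1"
      using mult(1,2) by (simp_all add: A B)
    then show "det (m2 (cnj d) (- cnj c) (- cnj b) (cnj a)) = 1"
      "det (m2 (cnj d') (- cnj c') (- cnj b') (cnj a')) = 1"
      by (simp_all add: mult.commute)
  qed
  finally show ?case
    by (simp add: A B algebra_simps)
qed

lemma \<phi>_SU2_C: "\<alpha> \<in> \<Phi> \<Longrightarrow> A \<in> SU2 \<Longrightarrow> \<phi> \<alpha> A \<in> C"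
  by (erule SU2_cases) (auto simp: C_def \<sigma>_\<phi> \<phi>_G algebra_simps)

text \<open>The conjugate of a unit complex number is its inverse, so the element is
  \<open>h_root \<alpha> u\<close>; \<sigma> fixes it because the matrix is unitary.\<close>

lemma diag_in_K:
  assumes "\<alpha> \<in> \<Phi>" "norm u = 1"
  shows "\<phi> \<alpha> (m2 u 0 0 (cnj u)) \<in> K"
proof -
  have u: "u \<noteq> 0" "cnj u = inverse u"
    using assms(2) by (auto simp: inverse_eq_divide divide_conv_cnj)
  then have "h_root \<alpha> u \<in> T"
    unfolding T_def using assms by (intro generate.incl) auto
  moreover have "\<phi> \<alpha> (m2 u 0 0 (cnj u)) \<in> C"
    by (intro \<phi>_SU2_C SU2_diag assms)
  ultimately show ?thesis
    using assms u by (simp add: K_def C_def h_root_\<phi>)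
qed

lemma N_subgroup: "subgroup (carrier N) GL" and N_C: "carrier N \<subseteq> C" and K_N: "K \<subseteq> carrier N"
proof -
  have sub: "\<omega> ` \<Phi> \<union> K \<subseteq> C"
  proof -
    have "m2 0 1 (- 1) 0 \<in> SU2"
      using SU2_m2 [of 0 "- 1"] by simp
    then show ?thesis
      using K_G by (auto simp: \<omega>_\<phi> \<phi>_SU2_C) (auto simp: C_def K_def)
  qed
  then show "subgroup (carrier N) GL"
    unfolding N_def using subgroup.subset [OF C_subgroup]
    by (auto intro!: group.generate_is_subgroup [OF group_GL])
  show "carrier N \<subseteq> C"
    using group.generate_subgroup_incl [OF group_GL sub C_subgroup] by (simp add: N_def)
  show "K \<subseteq> carrier N"
    by (auto simp: N_def intro: generate.incl)
qed

lemmas N_closed = subgroup_GL [OF N_subgroup]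

lemma N_mult: "mult N = (**)"
  by (simp add: N_def GL_def)

text \<open>On the span of \<open>X \<alpha>\<close>, \<open>X (- \<alpha>)\<close> and
  \<open>h \<alpha>\<close> the operator \<open>D\<close> has cube 0. The resulting quadratic
  polynomial in \<open>D\<close> is then matched with the matrix conjugation coordinate by
  coordinate.\<close>

lemma \<iota>_upper:
  assumes "\<alpha> \<in> \<Phi>" "trace M = 0"
  shows "x_root \<alpha> t ** \<iota> \<alpha> M = \<iota> \<alpha> (upper_unitri t ** M ** upper_unitri (- t)) ** x_root \<alpha> t"
proof -
  obtain a b c d where M: "M = m2 a b c d"
    by (rule m2_cases)
  with assms have d: "d = - a"
    using minus_unique [of a d] by (simp add: m2_trace)
  define D where "D = commutator (cscale t (X \<alpha>))"
  have D: "D (cscale p (X \<alpha>) + cscale q (X (- \<alpha>)) + cscale r (h \<alpha>)) =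
      cscale (- 2 * t * r) (X \<alpha>) + cscale (t * q) (h \<alpha>)" for p q r
    using assms(1)
    by (simp add: D_def commutator_add_right commutator_cscale_left commutator_cscale_right X_h)
      (simp add: h_def algebra_simps)
  have D1: "D (\<iota> \<alpha> M) = cscale (- 2 * t * a) (X \<alpha>) + cscale 0 (X (- \<alpha>)) + cscale (t * c) (h \<alpha>)"
    by (simp add: \<iota>_def D M)
  have D2: "D (D (\<iota> \<alpha> M)) = cscale (- 2 * t * (t * c)) (X \<alpha>) + cscale 0 (X (- \<alpha>)) + cscale 0 (h \<alpha>)"
    unfolding D1 D by simp
  have D3: "D (D (D (\<iota> \<alpha> M))) = 0"
    unfolding D2 D by simp
  have "\<iota> \<alpha> M + D (\<iota> \<alpha> M) + (1/2) *\<^sub>R D (D (\<iota> \<alpha> M)) =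
      \<iota> \<alpha> (upper_unitri t ** M ** upper_unitri (- t))"
    unfolding D2 unfolding D1
    by (simp add: \<iota>_def M d upper_m2 scaleR_cscale cscale_add_left cscale_diff algebra_simps)
      (simp add: vec_eq_iff algebra_simps)
  then show ?thesis
    using x_root_conj_quadratic [OF assms(1) D_def D3] by simp
qed

text \<open>Passing from \<alpha> to its negative exchanges the two coordinates of SL_2. This
  reduces lower unitriangular matrices to upper ones.\<close>

lemma \<iota>_uminus:
  "\<iota> (- \<alpha>) (m2 a b c (- a)) = \<iota> \<alpha> (m2 (- a) c b a)"
  by (simp add: \<iota>_def h_uminus cscale_minus cscale_minus_left)

lemma \<iota>_lower:
  assumes "\<alpha> \<in> \<Phi>" "trace M = 0"
  shows "x_root (- \<alpha>) t ** \<iota> \<alpha> M = \<iota> \<alpha> (lower_unitri t ** M ** lower_unitri (- t)) ** x_root (- \<alpha>) t"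
proof -
  obtain a b c d where M: "M = m2 a b c d"
    by (rule m2_cases)
  with assms have d: "d = - a"
    using minus_unique [of a d] by (simp add: m2_trace)
  have "x_root (- \<alpha>) t ** \<iota> (- \<alpha>) (m2 (- a) c b a) =
      \<iota> (- \<alpha>) (upper_unitri t ** m2 (- a) c b a ** upper_unitri (- t)) ** x_root (- \<alpha>) t"
    by (intro \<iota>_upper root_uminus assms) (simp add: m2_trace)
  then show ?thesis
    using \<iota>_uminus [of \<alpha> "- a" c b] \<iota>_uminus [of \<alpha> "- a + t * b" "c + t * a - t * (t * b - a)" b]
    by (simp add: M d upper_m2 lower_m2 algebra_simps)
qed

text \<open>The adjoint action of SL_2 is known on generators. The induction runs over all
  \<open>M\<close> at once, since conjugation by one factor changes \<open>M\<close> but preserves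
  its trace.\<close>

lemma \<phi>_\<iota>:
  assumes "\<alpha> \<in> \<Phi>" "det A = 1" "trace M = 0"
  shows "\<phi> \<alpha> A ** \<iota> \<alpha> M = \<iota> \<alpha> (A ** M ** matrix_inv A) ** \<phi> \<alpha> A"
  using assms(2,3)
proof (induction arbitrary: M rule: SL2_induct)
  case (upper t)
  then show ?case
    using \<iota>_upper [OF assms(1)] by (simp add: \<phi>_upper assms(1)) (simp add: upper_m2 m2_inv)
next
  case (lower t)
  then show ?case
    using \<iota>_lower [OF assms(1)] by (simp add: \<phi>_lower assms(1)) (simp add: lower_m2 m2_inv)
next
  case (mult A B)
  have tr: "trace (B ** M ** matrix_inv B) = 0"
    using mult.prems mult.hyps(2) trace_mul_sym [of "B ** M" "matrix_inv B"]
    by (simp add: matrix_mul_assoc matrix_inv_left SL2_invertible)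
  have "\<phi> \<alpha> (A ** B) ** \<iota> \<alpha> M = \<phi> \<alpha> A ** (\<phi> \<alpha> B ** \<iota> \<alpha> M)"
    using mult.hyps assms(1) by (simp add: \<phi>_mult matrix_mul_assoc)
  also have "\<dots> = (\<phi> \<alpha> A ** \<iota> \<alpha> (B ** M ** matrix_inv B)) ** \<phi> \<alpha> B"
    by (simp add: mult.IH mult.prems matrix_mul_assoc)
  also have "\<dots> = \<iota> \<alpha> (A ** (B ** M ** matrix_inv B) ** matrix_inv A) ** \<phi> \<alpha> A ** \<phi> \<alpha> B"
    using mult.IH(1) [OF tr] by simp
  also have "\<dots> = \<iota> \<alpha> (A ** B ** M ** matrix_inv (A ** B)) ** \<phi> \<alpha> (A ** B)"
    using mult.hyps assms(1)
    by (simp add: \<phi>_mult matrix_inv_mult SL2_invertible matrix_mul_assoc)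
  finally show ?case .
qed

subsection \<open>Monomial elements\<close>

text \<open>
  The elements of the normaliser of the torus, characterised by their adjoint action: they permute
  the root spaces and act on the Cartan subalgebra through an isometry.
\<close>

definition acts_as :: "complex^'n^'n \<Rightarrow> ('e \<Rightarrow> 'e) \<Rightarrow> bool" where
  "acts_as g w \<longleftrightarrow> g \<in> carrier G \<and> orthogonal_transformation w \<and>
     (\<forall>x. g ** H x = H (w x) ** g) \<and>
     (\<forall>\<alpha>\<in>\<Phi>. w \<alpha> \<in> \<Phi> \<and> (\<exists>c. g ** X \<alpha> = cscale c (X (w \<alpha>)) ** g))"

lemma acts_as_mult:
  assumes "acts_as g w" "acts_as g' w'"
  shows "acts_as (g ** g') (w \<circ> w')"
  unfolding acts_as_def
proof (intro conjI allI ballI)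
  show "g ** g' \<in> carrier G" "orthogonal_transformation (w \<circ> w')"
    using assms by (auto simp: acts_as_def G_closed orthogonal_transformation_compose)
  show "g ** g' ** H x = H ((w \<circ> w') x) ** (g ** g')" for x
  proof -
    have "g ** g' ** H x = g ** (g' ** H x)"
      by (simp add: matrix_mul_assoc)
    also have "\<dots> = (g ** H (w' x)) ** g'"
      using assms by (simp add: acts_as_def matrix_mul_assoc)
    also have "\<dots> = H ((w \<circ> w') x) ** (g ** g')"
      using assms by (simp add: acts_as_def matrix_mul_assoc)
    finally show ?thesis .
  qed
  fix \<alpha> assume \<alpha>: "\<alpha> \<in> \<Phi>"
  then obtain c where c: "w' \<alpha> \<in> \<Phi>" "g' ** X \<alpha> = cscale c (X (w' \<alpha>)) ** g'"
    using assms(2) by (auto simp: acts_as_def)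
  then obtain d where d: "w (w' \<alpha>) \<in> \<Phi>" "g ** X (w' \<alpha>) = cscale d (X (w (w' \<alpha>))) ** g"
    using assms(1) by (auto simp: acts_as_def)
  show "(w \<circ> w') \<alpha> \<in> \<Phi>"
    using d by simp
  have "g ** g' ** X \<alpha> = g ** (g' ** X \<alpha>)"
    by (simp add: matrix_mul_assoc)
  also have "\<dots> = cscale c (g ** X (w' \<alpha>)) ** g'"
    by (simp add: c cscale_mult_left cscale_mult_right matrix_mul_assoc)
  also have "\<dots> = cscale (c * d) (X ((w \<circ> w') \<alpha>)) ** (g ** g')"
    by (simp add: d cscale_mult_left cscale_mult_right matrix_mul_assoc)
  finally show "\<exists>c. g ** g' ** X \<alpha> = cscale c (X ((w \<circ> w') \<alpha>)) ** (g ** g')"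
    by blast
qed

lemma acts_as_one: "acts_as (mat 1) id"
  by (auto simp: acts_as_def G_closed orthogonal_transformation_id id_def intro: exI [of _ 1])

text \<open>Split \<open>x\<close> into a part orthogonal to \<beta>, whose image under
  \<open>H\<close> commutes with both root subgroups, and a multiple of \<beta>. As
  \<open>H \<beta>\<close> is a multiple of \<open>h \<beta>\<close>, the second part is a
  computation with two by two matrices.\<close>

lemma w_root_H:
  assumes "\<beta> \<in> \<Phi>" "t \<noteq> 0"
  shows "w_root \<beta> t ** H x = H (reflection \<beta> x) ** w_root \<beta> t"
proof -
  let ?w = "w_root \<beta> t" and ?A = "m2 0 t (- inverse t) 0"
  define a where "a = x \<bullet> \<beta> / (\<beta> \<bullet> \<beta>)"
  define y where "y = x - a *\<^sub>R \<beta>"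
  have \<beta>0: "\<beta> \<bullet> \<beta> \<noteq> 0"
    using root_nonzero assms by simp
  then have "y \<bullet> \<beta> = 0"
    by (simp add: y_def a_def inner_diff_left)
  then have comm: "commutator (H y) (X \<beta>) = 0" "commutator (H y) (X (- \<beta>)) = 0"
    using assms by (simp_all add: H_X root_uminus)
  have "H y ** x_root \<beta> u = x_root \<beta> u ** H y" "H y ** x_root (- \<beta>) u = x_root (- \<beta>) u ** H y" for u
    unfolding x_root_def using comm by (auto intro!: matrix_exp_intertwine simp: commutator_def)
  then have y: "?w ** H y = H y ** ?w"
    unfolding w_root_def by (metis matrix_mul_assoc)
  have "h \<beta> = \<iota> \<beta> (m2 1 0 0 (- 1))"
    by (simp add: \<iota>_def)
  moreover have "?w ** \<iota> \<beta> (m2 1 0 0 (- 1)) = \<iota> \<beta> (?A ** m2 1 0 0 (- 1) ** matrix_inv ?A) ** ?w"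
    unfolding w_root_\<phi> [OF assms] using assms by (intro \<phi>_\<iota>) (auto simp: m2_trace)
  moreover have "\<iota> \<beta> (?A ** m2 1 0 0 (- 1) ** matrix_inv ?A) = - h \<beta>"
    using assms by (simp add: m2_inv \<iota>_def cscale_minus_left)
  ultimately have "?w ** h \<beta> = - h \<beta> ** ?w"
    by simp
  moreover have "H \<beta> = ((\<beta> \<bullet> \<beta>) / 2) *\<^sub>R h \<beta>"
    using assms \<beta>0 by (simp add: h_H linear_cmul [OF H_linear])
  ultimately have \<beta>: "?w ** H \<beta> = - H \<beta> ** ?w"
    by (simp add: scaleR_cscale cscale_mult_left cscale_mult_right mult_minus_left cscale_minus)
  have "x = y + a *\<^sub>R \<beta>" "reflection \<beta> x = y - a *\<^sub>R \<beta>"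
    by (simp_all add: y_def a_def reflection_def algebra_simps flip: scaleR_2)
  then have "H x = H y + a *\<^sub>R H \<beta>" "H (reflection \<beta> x) = H y - a *\<^sub>R H \<beta>"
    by (simp_all only: linear_add [OF H_linear] linear_diff [OF H_linear] linear_cmul [OF H_linear])
  then show ?thesis
    by (simp add: mult_add_right mult_diff_left y scaleR_cscale cscale_mult_left cscale_mult_right \<beta>
        mult_minus_left cscale_minus)
qed

lemma w_root_inv: 
  assumes "\<beta> \<in> \<Phi>" "t \<noteq> 0"
  shows "matrix_inv (w_root \<beta> t) = w_root \<beta> (- t)" "invertible (w_root \<beta> t)" "w_root \<beta> t \<in> carrier G"
  using assms by (simp_all add: w_root_\<phi> \<phi>_inv m2_inv \<phi>_G)

text \<open>The roots \<beta> and its negative are set apart because their string passes through 0,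
  where \<open>h \<beta>\<close> would have to join the span. They are handled by the two by two
  computation in \<open>acts_as_w_root\<close>.\<close>

lemma w_root_X_string:
  assumes "\<beta> \<in> \<Phi>" "\<alpha> \<in> \<Phi>" "\<alpha> \<noteq> \<beta>" "\<alpha> \<noteq> - \<beta>" "t \<noteq> 0"
  shows "\<exists>c. w_root \<beta> t ** X \<alpha> = cscale c (X (reflection \<beta> \<alpha>)) ** w_root \<beta> t"
proof -
  define \<Gamma> where "\<Gamma> = {\<gamma> \<in> \<Phi>. \<exists>k::int. \<gamma> = \<alpha> + of_int k *\<^sub>R \<beta>}"
  define S where "S = {Y. \<exists>c. Y = (\<Sum>\<gamma>\<in>\<Gamma>. cscale (c \<gamma>) (X \<gamma>))}"
  let ?w = "w_root \<beta> t"
  have fin: "finite \<Gamma>"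
    unfolding \<Gamma>_def by (rule finite_subset [OF _ finite_roots]) auto
  have \<beta>0: "\<beta> \<bullet> \<beta> \<noteq> 0" "\<beta> \<noteq> 0"
    using root_nonzero assms by auto
  have S: "subspace S"
  proof (rule subspaceI)
    show "0 \<in> S"
      by (auto simp: S_def intro!: exI [of _ "\<lambda>_. 0"])
    show "x + y \<in> S" if "x \<in> S" "y \<in> S" for x y
    proof -
      from that obtain c d where "x = (\<Sum>\<gamma>\<in>\<Gamma>. cscale (c \<gamma>) (X \<gamma>))" "y = (\<Sum>\<gamma>\<in>\<Gamma>. cscale (d \<gamma>) (X \<gamma>))"
        by (auto simp: S_def)
      then have "x + y = (\<Sum>\<gamma>\<in>\<Gamma>. cscale (c \<gamma> + d \<gamma>) (X \<gamma>))"
        by (simp add: cscale_add_left sum.distrib)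
      then show ?thesis
        by (auto simp: S_def)
    qed
    show "r *\<^sub>R x \<in> S" if "x \<in> S" for r x
    proof -
      from that obtain c where "x = (\<Sum>\<gamma>\<in>\<Gamma>. cscale (c \<gamma>) (X \<gamma>))"
        by (auto simp: S_def)
      then have "r *\<^sub>R x = (\<Sum>\<gamma>\<in>\<Gamma>. cscale (of_real r * c \<gamma>) (X \<gamma>))"
        by (simp add: scaleR_cscale cscale_sum)
      then show ?thesis
        by (auto simp: S_def)
    qed
  qed
  have X_S: "cscale a (X \<gamma>) \<in> S" if "\<gamma> \<in> \<Gamma>" for a \<gamma>
  proof -
    have "(\<Sum>\<delta>\<in>\<Gamma>. cscale (if \<delta> = \<gamma> then a else 0) (X \<delta>)) = (\<Sum>\<delta>\<in>\<Gamma>. if \<delta> = \<gamma> then cscale a (X \<gamma>) else 0)"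
      by (rule sum.cong) auto
    then have "cscale a (X \<gamma>) = (\<Sum>\<delta>\<in>\<Gamma>. cscale (if \<delta> = \<gamma> then a else 0) (X \<delta>))"
      using that fin by simp
    then show ?thesis
      unfolding S_def mem_Collect_eq by (rule exI [of _ "\<lambda>\<delta>. if \<delta> = \<gamma> then a else 0"])
  qed
  have step: "x_root \<delta> u ** Y ** x_root \<delta> (- u) \<in> S" if \<delta>: "\<delta> = \<beta> \<or> \<delta> = - \<beta>" and Y: "Y \<in> S" for \<delta> u Y
  proof (rule x_root_conj_invariant [OF _ S _ Y])
    show \<delta>\<Phi>: "\<delta> \<in> \<Phi>"
      using \<delta> assms root_uminus by auto
    fix Y assume "Y \<in> S"
    then obtain c where c: "Y = (\<Sum>\<gamma>\<in>\<Gamma>. cscale (c \<gamma>) (X \<gamma>))"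
      by (auto simp: S_def)
    have "commutator (cscale u (X \<delta>)) (cscale (c \<gamma>) (X \<gamma>)) \<in> S" if \<gamma>: "\<gamma> \<in> \<Gamma>" for \<gamma>
    proof -
      obtain k :: int where k: "\<gamma> = \<alpha> + of_int k *\<^sub>R \<beta>" "\<gamma> \<in> \<Phi>"
        using \<gamma> by (auto simp: \<Gamma>_def)
      obtain e :: int where e: "\<delta> = of_int e *\<^sub>R \<beta>"
        using \<delta> by (metis of_int_1 of_int_minus scaleR_minus1_left scaleR_one)
      have "\<delta> + \<gamma> = \<alpha> + of_int (k + e) *\<^sub>R \<beta>"
        by (simp add: k e scaleR_left_distrib algebra_simps)
      then have "\<delta> + \<gamma> \<in> \<Gamma> \<longleftrightarrow> \<delta> + \<gamma> \<in> \<Phi>"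
        unfolding \<Gamma>_def by blast
      \<comment> \<open>Otherwise \<alpha> would be a multiple of \<beta>, and a reduced root system
        leaves only the two excluded roots.\<close>
      moreover have "\<delta> + \<gamma> \<noteq> 0"
      proof
        assume "\<delta> + \<gamma> = 0"
        then have "\<alpha> = of_int (- k - e) *\<^sub>R \<beta>"
          using \<open>\<delta> + \<gamma> = \<alpha> + of_int (k + e) *\<^sub>R \<beta>\<close> 
          by (simp add: scaleR_left_diff_distrib scaleR_left_distrib) (metis add_eq_0_iff2 diff_conv_add_uminus minus_add_distrib)
        then show False
          using root_reduced [OF assms(1)] assms(2-4)
          by (metis scaleR_minus1_left scaleR_one)
      qed
      ultimately show ?thesis
        using X_X_string [OF \<delta>\<Phi> k(2)] X_S subspace_0 [OF S]
        by (cases "\<delta> + \<gamma> \<in> \<Phi>") (auto simp: commutator_cscale_left commutator_cscale_right)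
    qed
    then show "commutator (cscale u (X \<delta>)) Y \<in> S"
      unfolding c commutator_sum_right by (intro subspace_sum [OF S])
  qed
  define Y where "Y = ?w ** X \<alpha> ** matrix_inv ?w"
  have "cscale 1 (X \<alpha>) \<in> S"
    using assms by (intro X_S) (auto simp: \<Gamma>_def intro!: exI [of _ 0])
  then have "x_root \<beta> t ** (x_root (- \<beta>) (- inverse t) ** (x_root \<beta> t ** X \<alpha> ** x_root \<beta> (- t)) **
      x_root (- \<beta>) (- (- inverse t))) ** x_root \<beta> (- t) \<in> S"
    by (intro step) auto
  then have "Y \<in> S"
    using assms by (simp add: Y_def w_root_inv) (simp add: w_root_def matrix_mul_assoc)
  then obtain c where c: "Y = (\<Sum>\<gamma>\<in>\<Gamma>. cscale (c \<gamma>) (X \<gamma>))"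
    by (auto simp: S_def)
  have wX: "?w ** X \<alpha> = Y ** ?w"
    using w_root_inv(2) [OF assms(1,5)] by (simp add: Y_def matrix_group_simps)
  have refl: "reflection \<beta> \<alpha> \<in> \<Gamma>"
  proof -
    obtain k :: int where "2 * (\<alpha> \<bullet> \<beta>) / (\<beta> \<bullet> \<beta>) = of_int k"
      using root_integral [OF assms(1,2)] by (auto elim: Ints_cases)
    then have "reflection \<beta> \<alpha> = \<alpha> + of_int (- k) *\<^sub>R \<beta>"
      by (simp add: reflection_def)
    then show ?thesis
      using reflection_root assms unfolding \<Gamma>_def by blast
  qed
  have inj: "inj_on (\<lambda>\<gamma>. \<beta> \<bullet> \<gamma>) \<Gamma>"
    using \<beta>0 by (auto simp: inj_on_def \<Gamma>_def inner_add_right)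
  have "\<beta> \<bullet> reflection \<beta> \<alpha> = - (\<beta> \<bullet> \<alpha>)"
    using \<beta>0 by (simp add: reflection_def inner_diff_right inner_commute)
  \<comment> \<open>Conjugation by \<open>?w\<close> negates \<open>H \<beta>\<close>, so
    \<open>Y\<close> has the eigenvalue opposite to that of \<open>X \<alpha>\<close>. In the string
    this eigenvalue belongs to \<open>reflection \<beta> \<alpha>\<close> alone.\<close>
  have "commutator (H \<beta>) Y = (- (\<beta> \<bullet> \<alpha>)) *\<^sub>R Y"
  proof -
    have "- H \<beta> ** ?w = ?w ** H \<beta>"
      using w_root_H [OF assms(1,5), of \<beta>] by (simp add: reflection_self \<beta>0 linear_neg [OF H_linear])
    then have Hw: "H \<beta> ** ?w = - (?w ** H \<beta>)"
      by (simp add: mult_minus_left) (metis minus_minus)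
    have "commutator (H \<beta>) Y ** ?w = H \<beta> ** (?w ** X \<alpha>) - Y ** (H \<beta> ** ?w)"
      by (simp add: commutator_def mult_diff_left wX matrix_mul_assoc)
    also have "H \<beta> ** (?w ** X \<alpha>) = - (?w ** (H \<beta> ** X \<alpha>))"
      by (simp add: matrix_mul_assoc Hw mult_minus_left)
    also have "Y ** (H \<beta> ** ?w) = - (?w ** (X \<alpha> ** H \<beta>))"
      by (simp add: Hw mult_minus_right matrix_mul_assoc wX)
    finally have "commutator (H \<beta>) Y ** ?w = - (?w ** commutator (H \<beta>) (X \<alpha>))"
      by (simp add: commutator_def mult_diff_right)
    also have "\<dots> = ((- (\<beta> \<bullet> \<alpha>)) *\<^sub>R Y) ** ?w"
      by (simp add: H_X assms scaleR_cscale cscale_mult_left cscale_mult_right wX cscale_minus_left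
          mult_minus_left)
    finally show ?thesis
      using matrix_right_cancel w_root_inv(2) [OF assms(1,5)] by blast
  qed
  moreover have "commutator (H \<beta>) Y = (\<Sum>\<gamma>\<in>\<Gamma>. (\<beta> \<bullet> \<gamma>) *\<^sub>R cscale (c \<gamma>) (X \<gamma>))"
    unfolding c commutator_sum_right
    by (rule sum.cong) (auto simp: commutator_cscale_right H_X \<Gamma>_def scaleR_cscale mult.commute)
  ultimately have "(\<Sum>\<gamma>\<in>\<Gamma>. (\<beta> \<bullet> \<gamma> + \<beta> \<bullet> \<alpha>) *\<^sub>R cscale (c \<gamma>) (X \<gamma>)) = 0"
    unfolding c scaleR_left_distrib sum.distrib scaleR_sum_right by (simp add: sum_negf flip: scaleR_sum_right)
  then have "\<forall>\<gamma>\<in>\<Gamma>. (\<beta> \<bullet> \<gamma> + \<beta> \<bullet> \<alpha>) *\<^sub>R cscale (c \<gamma>) (X \<gamma>) = 0"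
    by (intro eigenvectors_sum_zero [OF fin linear_commutator [of "H \<beta>"] _ inj])
      (auto simp: commutator_cscale_right commutator_scaleR_right H_X \<Gamma>_def scaleR_cscale mult_ac)
  then have "cscale (c \<gamma>) (X \<gamma>) = 0" if "\<gamma> \<in> \<Gamma>" "\<gamma> \<noteq> reflection \<beta> \<alpha>" for \<gamma>
    using that inj refl \<open>\<beta> \<bullet> reflection \<beta> \<alpha> = - (\<beta> \<bullet> \<alpha>)\<close> unfolding inj_on_def
    by (metis add_eq_0_iff2 scaleR_eq_0_iff)
  then have "Y = cscale (c (reflection \<beta> \<alpha>)) (X (reflection \<beta> \<alpha>))"
    unfolding c using fin refl by (subst sum.remove [OF fin refl]) (auto intro!: sum.neutral)
  then show ?thesis
    using wX by auto
qed

lemma acts_as_w_root: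
  assumes "\<beta> \<in> \<Phi>" "t \<noteq> 0"
  shows "acts_as (w_root \<beta> t) (reflection \<beta>)"
  unfolding acts_as_def
proof (intro conjI allI ballI)
  let ?A = "m2 0 t (- inverse t) 0"
  fix \<alpha> assume \<alpha>: "\<alpha> \<in> \<Phi>"
  have *: "w_root \<beta> t ** \<iota> \<beta> M = \<iota> \<beta> (?A ** M ** matrix_inv ?A) ** w_root \<beta> t" if "trace M = 0" for M
    unfolding w_root_\<phi> [OF assms] using assms that by (intro \<phi>_\<iota>) auto
  consider "\<alpha> = \<beta>" | "\<alpha> = - \<beta>" | "\<alpha> \<noteq> \<beta>" "\<alpha> \<noteq> - \<beta>"
    by blast
  then show "\<exists>c. w_root \<beta> t ** X \<alpha> = cscale c (X (reflection \<beta> \<alpha>)) ** w_root \<beta> t"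
  proof cases
    case 1
    have "w_root \<beta> t ** X \<beta> = cscale (- (inverse t * inverse t)) (X (- \<beta>)) ** w_root \<beta> t"
      using * [of "m2 0 1 0 0"] assms by (simp add: m2_trace m2_inv \<iota>_def)
    with 1 show ?thesis
      using assms root_nonzero by (auto simp: reflection_self)
  next
    case 2
    have "w_root \<beta> t ** X (- \<beta>) = cscale (- (t * t)) (X \<beta>) ** w_root \<beta> t"
      using * [of "m2 0 0 1 0"] assms by (simp add: m2_trace m2_inv \<iota>_def)
    with 2 show ?thesis
      using assms root_nonzero reflection_self [of "- \<beta>"] by (auto simp: reflection_uminus)
  qed (use w_root_X_string assms \<alpha> in blast)
qed (use assms w_root_H w_root_inv reflection_root reflection_orthogonal in auto)

text \<open>\<open>h_root \<alpha> t\<close> is the product of \<open>w_root \<alpha> t\<close> and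
  \<open>w_root \<alpha> (- 1)\<close>, and the two equal reflections cancel.\<close>

lemma T_acts_as: "g \<in> T \<Longrightarrow> acts_as g id"
  unfolding T_def
proof (induction rule: generate.induct)
  case one
  then show ?case
    unfolding GL_simps by (rule acts_as_one)
next
  case (incl g)
  then obtain \<alpha> t where g: "\<alpha> \<in> \<Phi>" "t \<noteq> 0" "g = w_root \<alpha> t ** w_root \<alpha> (- 1)"
    by (auto simp: h_root_def \<omega>_def w_root_inv)
  have "reflection \<alpha> \<circ> reflection \<alpha> = id"
    by (simp add: fun_eq_iff)
  with acts_as_mult [OF acts_as_w_root acts_as_w_root, of \<alpha> t \<alpha> "- 1"] g show ?case
    by (metis neg_equal_0_iff_equal zero_neq_one)
next
  case (inv g)
  then obtain \<alpha> t where g: "\<alpha> \<in> \<Phi>" "t \<noteq> 0" "g = w_root \<alpha> t ** w_root \<alpha> (- 1)"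
    by (auto simp: h_root_def \<omega>_def w_root_inv)
  then have "inv\<^bsub>GL\<^esub> g = w_root \<alpha> 1 ** w_root \<alpha> (- t)"
    by (simp add: GL_inv invertible_mult matrix_inv_mult w_root_inv)
  moreover have "reflection \<alpha> \<circ> reflection \<alpha> = id"
    by (simp add: fun_eq_iff)
  ultimately show ?case
    using acts_as_mult [OF acts_as_w_root acts_as_w_root, of \<alpha> 1 \<alpha> "- t"] g
    by (metis neg_equal_0_iff_equal zero_neq_one)
next
  case (eng g g')
  then show ?case
    using acts_as_mult [of g id g' id] by (simp only: GL_simps comp_id)
qed

lemma K_acts_as: "k \<in> K \<Longrightarrow> acts_as k id"
  by (simp add: K_def T_acts_as)

text \<open>For real \<open>s\<close> the quotient of the two sides is a constant one-parameter
  group whose derivative at 0 is \<open>cscale (a - b) (X \<alpha>)\<close>.\<close>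

lemma x_root_injective:
  assumes "\<alpha> \<in> \<Phi>" "\<And>s. x_root \<alpha> (a * s) = x_root \<alpha> (b * s)"
  shows "a = b"
proof -
  have "x_root \<alpha> (of_real \<tau> * (a - b)) = mat 1" for \<tau>
  proof -
    have "x_root \<alpha> (of_real \<tau> * (a - b)) = x_root \<alpha> (a * of_real \<tau>) ** x_root \<alpha> (- (b * of_real \<tau>))"
      using assms(1) by (simp add: algebra_simps flip: x_root_add)
    also have "\<dots> = x_root \<alpha> (b * of_real \<tau>) ** x_root \<alpha> (- (b * of_real \<tau>))"
      by (simp only: assms(2))
    also have "\<dots> = mat 1"
      using assms(1) by (simp flip: x_root_add)
    finally show ?thesis .
  qed
  then have "((\<lambda>\<tau>::real. mat 1 :: complex^'n^'n) has_vector_derivative cscale (a - b) (X \<alpha>)) (at 0)"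
    using matrix_one_parameter_group.g_deriv [OF x_root_one_parameter_group [OF assms(1), of "a - b"]]
    by simp
  then have "cscale (a - b) (X \<alpha>) = 0"
    using vector_derivative_unique_at has_vector_derivative_const by blast
  then show ?thesis
    using X_nonzero [OF assms(1)] by (simp add: cscale_eq_0_iff)
qed

text \<open>
  The scalars by which a monomial element of \<open>C\<close> permutes the root vectors have absolute value 1,
  because it commutes with \<open>\<sigma>\<close>. Hence conjugation by it is a unitary conjugation on \<open>SL\<^sub>2\<close>.
\<close>

lemma acts_as_\<phi>:
  assumes "acts_as g w" "g \<in> C" "\<alpha> \<in> \<Phi>"
  obtains d where "norm d = 1" "\<And>A. det A = 1 \<Longrightarrow>
    g ** \<phi> \<alpha> A = \<phi> (w \<alpha>) (m2 d 0 0 (cnj d) ** A ** m2 (cnj d) 0 0 d) ** g"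
proof -
  have g: "g \<in> carrier G" "\<sigma> g = g" "invertible g"
    using assms(2) subgroup_GL(1) [OF C_subgroup] by (auto simp: C_def)
  have w: "orthogonal_transformation w" "w (- \<alpha>) = - w \<alpha>" "w \<alpha> \<in> \<Phi>"
    using assms by (auto simp: acts_as_def orthogonal_transformation_def linear_neg)
  obtain c where c: "g ** X \<alpha> = cscale c (X (w \<alpha>)) ** g"
    using assms(1,3) by (auto simp: acts_as_def)
  obtain c' where c': "g ** X (- \<alpha>) = cscale c' (X (- w \<alpha>)) ** g"
    using assms(1) root_uminus [OF assms(3)] w(2) by (fastforce simp: acts_as_def)
  have x: "g ** x_root \<alpha> t = x_root (w \<alpha>) (c * t) ** g" for t
    unfolding x_root_def using matrix_exp_intertwine [OF c, of t]
    by (simp add: matrix_exp_cscale mult.commute)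
  have x': "g ** x_root (- \<alpha>) t = x_root (- w \<alpha>) (c' * t) ** g" for t
    unfolding x_root_def using matrix_exp_intertwine [OF c', of t]
    by (simp add: matrix_exp_cscale mult.commute)
  \<comment> \<open>Transport \<open>[X \<alpha>, X (- \<alpha>)] = h \<alpha>\<close> by
    \<open>g\<close>: the left side acquires the factor \<open>c * c'\<close>, while
    \<open>h \<alpha>\<close> goes to \<open>h (w \<alpha>)\<close> exactly because \<open>w\<close>
    is an isometry.\<close>
  have "c * c' = 1"
  proof -
    have "g ** h \<alpha> = H (w ((2 / (\<alpha> \<bullet> \<alpha>)) *\<^sub>R \<alpha>)) ** g"
      using assms by (simp add: h_H acts_as_def)
    also have "w ((2 / (\<alpha> \<bullet> \<alpha>)) *\<^sub>R \<alpha>) = (2 / (w \<alpha> \<bullet> w \<alpha>)) *\<^sub>R w \<alpha>"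
      using w(1) by (simp add: orthogonal_transformation_def linear_cmul)
    finally have 1: "g ** h \<alpha> = h (w \<alpha>) ** g"
      using w by (simp add: h_H)
    have "g ** h \<alpha> = (g ** X \<alpha>) ** X (- \<alpha>) - (g ** X (- \<alpha>)) ** X \<alpha>"
      by (simp add: h_def commutator_def mult_diff_right matrix_mul_assoc)
    also have "\<dots> = cscale c (X (w \<alpha>)) ** (g ** X (- \<alpha>)) - cscale c' (X (- w \<alpha>)) ** (g ** X \<alpha>)"
      by (subst c, subst c') (simp only: matrix_mul_assoc)
    also have "\<dots> = cscale (c * c') (h (w \<alpha>)) ** g"
      by (simp add: c c' h_def commutator_def cscale_mult_left cscale_mult_right cscale_diff
          mult_diff_left matrix_mul_assoc mult.commute)
    finally have "cscale (c * c') (h (w \<alpha>)) = cscale 1 (h (w \<alpha>))"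
      using 1 matrix_right_cancel [OF g(3)] by simp
    then show ?thesis
      using h_nonzero [OF w(3)] by (rule cscale_cancel)
  qed
  \<comment> \<open>Apply \<sigma>, which fixes \<open>g\<close>, to the relation \<open>x\<close>,
    and compare with \<open>x'\<close>. The choice of \<open>t\<close> makes
    \<open>\<sigma> (x_root \<alpha> t)\<close> equal to
    \<open>x_root (- \<alpha>) s\<close>.\<close>
  moreover have "c' = cnj c"
  proof (rule x_root_injective [OF root_uminus [OF w(3)]])
    fix s
    define t where "t = - cnj s"
    have "\<sigma> (g ** x_root \<alpha> t) = \<sigma> (x_root (w \<alpha>) (c * t) ** g)"
      by (simp only: x)
    then have "g ** x_root (- \<alpha>) s = x_root (- w \<alpha>) (cnj c * s) ** g"
      using g w assms by (simp add: \<sigma>_mult x_root_G \<sigma>_x t_def)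
    then show "x_root (- w \<alpha>) (c' * s) = x_root (- w \<alpha>) (cnj c * s)"
      using matrix_right_cancel [OF g(3)] by (simp add: x')
  qed
  ultimately have cc: "c * cnj c = 1"
    by simp
  \<comment> \<open>Conjugation by the diagonal matrix of \<open>d\<close> and \<open>cnj d\<close>
    multiplies the upper right entry by \<open>d * d\<close>, so a square root of \<open>c\<close>
    is required.\<close>
  define d where "d = csqrt c"
  have dd: "d * d = c"
    by (simp add: d_def flip: power2_eq_square)
  have "norm c = 1"
    using cc by (metis complex_mod_sqrt_Re_mult_cnj one_complex.simps(1) real_sqrt_one)
  then have "norm d = 1"
    by (simp add: d_def)
  then have d1: "d * cnj d = 1"
    by (simp add: complex_norm_square [symmetric])
  have "g ** \<phi> \<alpha> A = \<phi> (w \<alpha>) (m2 d 0 0 (cnj d) ** A ** m2 (cnj d) 0 0 d) ** g" if "det A = 1" for A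
    using that
  proof (induction rule: SL2_induct)
    case (upper t)
    have "m2 d 0 0 (cnj d) ** upper_unitri t ** m2 (cnj d) 0 0 d = upper_unitri (c * t)"
      using d1 dd by (simp add: upper_m2 m2_eq_iff mult_ac)
    then show ?case
      using assms w by (simp add: \<phi>_upper x)
  next
    case (lower t)
    have "cnj d * cnj d = c'"
      using dd \<open>c' = cnj c\<close> by (metis complex_cnj_mult)
    then have "m2 d 0 0 (cnj d) ** lower_unitri t ** m2 (cnj d) 0 0 d = lower_unitri (c' * t)"
      using d1 by (simp add: lower_m2 m2_eq_iff mult_ac)
    then show ?case
      using assms w by (simp add: \<phi>_lower x')
  next
    case (mult A B)
    let ?D = "m2 d 0 0 (cnj d)" and ?E = "m2 (cnj d) 0 0 d"
    have DE: "?E ** ?D = mat 1"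
      using d1 by (simp add: m2_one mult.commute)
    have det: "det (?D ** A ** ?E) = 1" "det (?D ** B ** ?E) = 1"
      using mult.hyps d1 by (simp_all add: det_mul mult.commute)
    have "g ** \<phi> \<alpha> (A ** B) = g ** \<phi> \<alpha> A ** \<phi> \<alpha> B"
      using mult.hyps assms by (simp add: \<phi>_mult matrix_mul_assoc)
    also have "\<dots> = \<phi> (w \<alpha>) (?D ** A ** ?E) ** (g ** \<phi> \<alpha> B)"
      by (simp only: mult.IH(1) matrix_mul_assoc)
    also have "\<dots> = \<phi> (w \<alpha>) (?D ** A ** ?E) ** \<phi> (w \<alpha>) (?D ** B ** ?E) ** g"
      by (simp only: mult.IH(2) matrix_mul_assoc)
    also have "\<dots> = \<phi> (w \<alpha>) ((?D ** A ** ?E) ** (?D ** B ** ?E)) ** g"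
      using \<phi>_mult [OF w(3) det] by simp
    also have "(?D ** A ** ?E) ** (?D ** B ** ?E) = ?D ** A ** (?E ** ?D) ** B ** ?E"
      by (simp add: matrix_mul_assoc del: m2_mult)
    also have "\<dots> = ?D ** (A ** B) ** ?E"
      unfolding DE by (simp add: matrix_mul_assoc)
    finally show ?case .
  qed
  with \<open>norm d = 1\<close> show thesis
    by (rule that)
qed

lemma acts_as_\<phi>_SU2:
  assumes "acts_as g w" "g \<in> C" "\<alpha> \<in> \<Phi>" "A \<in> SU2"
  obtains B where "B \<in> SU2" "g ** \<phi> \<alpha> A = \<phi> (w \<alpha>) B ** g"
proof -
  obtain d where d: "norm d = 1" "\<And>A. det A = 1 \<Longrightarrow>
    g ** \<phi> \<alpha> A = \<phi> (w \<alpha>) (m2 d 0 0 (cnj d) ** A ** m2 (cnj d) 0 0 d) ** g"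
    using acts_as_\<phi> assms by blast
  have "m2 d 0 0 (cnj d) \<in> SU2" "m2 (cnj d) 0 0 d \<in> SU2"
    using SU2_diag [of d] SU2_diag [of "cnj d"] d(1) by simp_all
  then show thesis
    using d(2) assms(4) by (intro that) (auto simp: SU2_mult SU2_det)
qed

subsection \<open>The groups \<open>C\<^sub>s\<close>\<close>

lemma \<phi>_uminus:
  assumes "\<alpha> \<in> \<Phi>" "det A = 1"
  shows "\<phi> (- \<alpha>) A = \<phi> \<alpha> (m2 (A $ 2 $ 2) (A $ 2 $ 1) (A $ 1 $ 2) (A $ 1 $ 1))"
  using assms(2)
proof (induction rule: SL2_induct)
  case (upper t)
  then show ?case
    using assms(1) root_uminus by (simp add: \<phi>_upper flip: \<phi>_lower) (simp add: upper_m2 lower_m2)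
next
  case (lower t)
  then show ?case
    using assms(1) root_uminus by (simp add: \<phi>_lower flip: \<phi>_upper) (simp add: upper_m2 lower_m2)
next
  case (mult A B)
  obtain a b c d where A: "A = m2 a b c d"
    by (rule m2_cases)
  obtain a' b' c' d' where B: "B = m2 a' b' c' d'"
    by (rule m2_cases)
  have "\<phi> (- \<alpha>) (A ** B) = \<phi> \<alpha> (m2 d c b a) ** \<phi> \<alpha> (m2 d' c' b' a')"
    using mult assms(1) root_uminus by (simp add: \<phi>_mult A B del: m2_mult)
  also have "\<dots> = \<phi> \<alpha> (m2 d c b a ** m2 d' c' b' a')"
    using mult.hyps assms(1) by (intro \<phi>_mult [symmetric]) (auto simp: A B mult.commute)
  finally show ?case
    by (simp add: A B algebra_simps)
qed

text \<open>\<open>reflection \<beta>\<close> negates \<alpha>, so \<alpha> is a multiple of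
  \<beta>; reducedness leaves the two signs.\<close>

lemma reflection_eq_imp:
  assumes "\<alpha> \<in> \<Phi>" "\<beta> \<in> \<Phi>" "reflection \<alpha> = reflection \<beta>"
  shows "\<alpha> = \<beta> \<or> \<alpha> = - \<beta>"
proof -
  have "- \<alpha> = reflection \<beta> \<alpha>"
    using reflection_self [of \<alpha>] root_nonzero assms by simp
  then have "2 *\<^sub>R \<alpha> = (2 * (\<alpha> \<bullet> \<beta>) / (\<beta> \<bullet> \<beta>)) *\<^sub>R \<beta>"
    by (simp add: reflection_def scaleR_2 algebra_simps)
  then have "\<alpha> = ((\<alpha> \<bullet> \<beta>) / (\<beta> \<bullet> \<beta>)) *\<^sub>R \<beta>"
    by (metis (no_types) divide_inverse mult.assoc scaleR_cancel_left scaleR_scaleR zero_neq_numeral)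
  then show ?thesis
    using root_reduced assms by (metis scaleR_minus1_left scaleR_one)
qed

text \<open>Only \<alpha> and its negative have this reflection, and the exchange of coordinates
  that relates their homomorphisms preserves SU_2.\<close>

lemma C_refl_eq:
  assumes "\<alpha> \<in> \<Phi>"
  shows "C_refl (reflection \<alpha>) = {\<phi> \<alpha> A ** k | A k. A \<in> SU2 \<and> k \<in> K}"
proof -
  have unfold: "C_refl (reflection \<alpha>) =
      (\<Union>\<beta>\<in>{\<beta> \<in> \<Phi>. reflection \<beta> = reflection \<alpha>}. {\<phi> \<beta> A ** k | A k. A \<in> SU2 \<and> k \<in> K})"
    unfolding C_refl_def set_mult_def G_mult by blast
  have *: "\<phi> (- \<alpha>) A \<in> \<phi> \<alpha> ` SU2" if A: "A \<in> SU2" for A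
  proof -
    from A obtain a c where a: "A = m2 a (- cnj c) c (cnj a)" "a * cnj a + c * cnj c = 1"
      by (rule SU2_cases)
    then have "m2 (cnj a) c (- cnj c) a \<in> SU2"
      using SU2_m2 [of "cnj a" "- cnj c"] by (simp add: mult.commute)
    then show ?thesis
      using \<phi>_uminus [OF assms SU2_det [OF A]] by (auto simp: a)
  qed
  show ?thesis
  proof
    show "C_refl (reflection \<alpha>) \<subseteq> {\<phi> \<alpha> A ** k | A k. A \<in> SU2 \<and> k \<in> K}"
    proof
      fix x assume "x \<in> C_refl (reflection \<alpha>)"
      then obtain \<beta> A k where x: "\<beta> \<in> \<Phi>" "reflection \<beta> = reflection \<alpha>" "x = \<phi> \<beta> A ** k" "A \<in> SU2" "k \<in> K"
        unfolding unfold by blast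
      then have "\<beta> = \<alpha> \<or> \<beta> = - \<alpha>"
        using reflection_eq_imp assms by blast
      then obtain B where "B \<in> SU2" "\<phi> \<beta> A = \<phi> \<alpha> B"
        using * [OF x(4)] x(4) by auto
      then show "x \<in> {\<phi> \<alpha> A ** k | A k. A \<in> SU2 \<and> k \<in> K}"
        using x(3,5) by auto
    qed
    show "{\<phi> \<alpha> A ** k | A k. A \<in> SU2 \<and> k \<in> K} \<subseteq> C_refl (reflection \<alpha>)"
      unfolding unfold using assms by blast
  qed
qed

lemma C_refl_cases:
  assumes "c \<in> C_refl t"
  obtains \<alpha> A k where "\<alpha> \<in> \<Phi>" "t = reflection \<alpha>" "A \<in> SU2" "k \<in> K" "c = \<phi> \<alpha> A ** k"
  using assms unfolding C_refl_def set_mult_def G_mult by blast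

lemma K_C: "K \<subseteq> C"
  using K_N N_C by blast

lemma C_refl_C: "C_refl t \<subseteq> C"
  using K_C subgroup_GL(2) [OF C_subgroup] by (blast elim: C_refl_cases intro: \<phi>_SU2_C)

lemma C_refl_invertible: "c \<in> C_refl t \<Longrightarrow> invertible c"
  using C_refl_C subgroup_GL(1) [OF C_subgroup] by blast

lemma C_refl_K_right:
  assumes "c \<in> C_refl t" "k \<in> K"
  shows "c ** k \<in> C_refl t"
proof -
  obtain \<alpha> A k' where c: "\<alpha> \<in> \<Phi>" "t = reflection \<alpha>" "A \<in> SU2" "k' \<in> K" "c = \<phi> \<alpha> A ** k'"
    using assms(1) by (rule C_refl_cases)
  then have "c ** k = \<phi> \<alpha> A ** (k' ** k)"
    by (simp add: matrix_mul_assoc)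
  then show ?thesis
    using c assms(2) K_closed(2) [of k' k] C_refl_eq by blast
qed

lemma C_refl_SU2_left:
  assumes "c \<in> C_refl (reflection \<alpha>)" "\<alpha> \<in> \<Phi>" "B \<in> SU2"
  shows "\<phi> \<alpha> B ** c \<in> C_refl (reflection \<alpha>)"
proof -
  obtain A k where c: "A \<in> SU2" "k \<in> K" "c = \<phi> \<alpha> A ** k"
    using assms(1) C_refl_eq [OF assms(2)] by blast
  then have "\<phi> \<alpha> B ** c = \<phi> \<alpha> (B ** A) ** k"
    using assms by (simp add: \<phi>_mult SU2_det matrix_mul_assoc)
  then show ?thesis
    using SU2_mult [OF assms(3) c(1)] c(2) C_refl_eq [OF assms(2)] by blast
qed

text \<open>\<open>g\<close> carries the SU_2 factor to that of \<open>w \<alpha>\<close>, whose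
  reflection is the conjugate of \<open>t\<close> by \<open>w\<close>. A separate \<open>g'\<close>
  covers the inverse of \<open>g\<close> as well as the value 1 when \<open>g\<close> lies in
  \<open>K\<close>.\<close>

lemma C_refl_conj:
  assumes "c \<in> C_refl t" "acts_as g w" "g \<in> C" "g' \<in> C" "g ** g' \<in> K" "\<And>k. k \<in> K \<Longrightarrow> g ** k ** g' \<in> K"
    "bij w"
  shows "g ** c ** g' \<in> C_refl (w \<circ> t \<circ> inv_into UNIV w)"
proof -
  obtain \<alpha> A k where c: "\<alpha> \<in> \<Phi>" "t = reflection \<alpha>" "A \<in> SU2" "k \<in> K" "c = \<phi> \<alpha> A ** k"
    using assms(1) by (rule C_refl_cases)
  obtain B where B: "B \<in> SU2" "g ** \<phi> \<alpha> A = \<phi> (w \<alpha>) B ** g"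
    using acts_as_\<phi>_SU2 [OF assms(2,3) c(1,3)] by blast
  have w: "w \<alpha> \<in> \<Phi>" "orthogonal_transformation w"
    using assms(2) c(1) by (auto simp: acts_as_def)
  have "g ** c ** g' = (g ** \<phi> \<alpha> A) ** k ** g'"
    by (simp add: c matrix_mul_assoc)
  also have "\<dots> = \<phi> (w \<alpha>) B ** (g ** k ** g')"
    by (simp add: B matrix_mul_assoc)
  finally have "g ** c ** g' \<in> C_refl (reflection (w \<alpha>))"
    using B(1) assms(6) [OF c(4)] C_refl_eq [OF w(1)] by blast
  moreover have "reflection (w \<alpha>) = w \<circ> t \<circ> inv_into UNIV w"
  proof
    fix x
    have "x = w (inv_into UNIV w x)"
      using assms(7) by (simp add: bij_is_surj surj_f_inv_f)
    then show "reflection (w \<alpha>) x = (w \<circ> t \<circ> inv_into UNIV w) x"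
      using reflection_conj [OF w(2), of \<alpha> "inv_into UNIV w x"] c(2) by simp
  qed
  ultimately show ?thesis
    by simp
qed

text \<open>Elements of \<open>K\<close> fix every root, so \<open>K\<close> normalises the SU_2
  factor: take \<open>g = k\<close> and \<open>g' = mat 1\<close> in the conjugation lemma.\<close>

lemma C_refl_K_left:
  assumes "c \<in> C_refl t" "k \<in> K"
  shows "k ** c \<in> C_refl t"
proof -
  have "k ** c ** mat 1 \<in> C_refl (id \<circ> t \<circ> inv_into UNIV id)"
    using assms K_C K_closed
    by (intro C_refl_conj K_acts_as) (auto simp: subgroup_GL [OF C_subgroup])
  then show ?thesis
    by simp
qed

subsection \<open>Representatives of the Weyl group\<close>

abbreviation W :: "('e \<Rightarrow> 'e) set" where
  "W \<equiv> carrier (weyl_group \<Phi>)"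

lemma group_perm_group: "group (perm_group :: ('b \<Rightarrow> 'b) monoid)"
proof (rule groupI)
  fix w :: "'b \<Rightarrow> 'b" assume "w \<in> carrier perm_group"
  then show "\<exists>u\<in>carrier perm_group. u \<otimes>\<^bsub>perm_group\<^esub> w = \<one>\<^bsub>perm_group\<^esub>"
    by (intro bexI [of _ "inv_into UNIV w"])
      (auto simp: perm_group_def bij_imp_bij_inv bij_is_inj)
qed (auto simp: perm_group_def bij_comp)

lemma perm_group_inv: "bij w \<Longrightarrow> inv\<^bsub>perm_group\<^esub> w = inv_into UNIV w"
  by (rule group.inv_equality [OF group_perm_group])
    (auto simp: perm_group_def bij_imp_bij_inv bij_is_inj)

lemma weyl_subgroup: "subgroup W perm_group"
proof -
  have "reflections \<Phi> \<subseteq> carrier perm_group"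
    by (auto simp: reflections_def perm_group_def intro: orthogonal_transformation_bij reflection_orthogonal)
  then show ?thesis
    by (simp add: weyl_group_def group.generate_is_subgroup [OF group_perm_group])
qed

lemma W_bij: "w \<in> W \<Longrightarrow> bij w"
  using subgroup.mem_carrier [OF weyl_subgroup] by (simp add: perm_group_def)

lemma W_closed: "id \<in> W" "w \<in> W \<Longrightarrow> w' \<in> W \<Longrightarrow> w \<circ> w' \<in> W" "w \<in> W \<Longrightarrow> inv_into UNIV w \<in> W"
  using subgroup.one_closed [OF weyl_subgroup] subgroup.m_closed [OF weyl_subgroup, of w w']
    subgroup.m_inv_closed [OF weyl_subgroup, of w]
  by (auto simp: perm_group_def [symmetric] perm_group_inv W_bij) (auto simp: perm_group_def)

lemma reflection_W: "\<alpha> \<in> \<Phi> \<Longrightarrow> reflection \<alpha> \<in> W"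
  by (auto simp: weyl_group_def reflections_def intro: generate.incl)

lemma lcoset_iff: "x \<in> g <#\<^bsub>N\<^esub> K \<longleftrightarrow> (\<exists>k\<in>K. x = g ** k)"
  by (auto simp: l_coset_def N_mult)

lemma rep_N: "w \<in> W \<Longrightarrow> rep w \<in> carrier N"
  using rep_in_N .

lemma rep_invertible: "w \<in> W \<Longrightarrow> invertible (rep w)"
  using rep_N N_closed(1) by blast

text \<open>
  The isomorphism identifies left cosets of \<open>K\<close> with the right cosets that form \<open>N Mod K\<close>; this
  already makes \<open>K\<close> normal.
\<close>

lemma rep_coset_eq:
  assumes "w \<in> W"
  shows "rep w <#\<^bsub>N\<^esub> K = K #>\<^bsub>N\<^esub> rep w"
proof -
  have "rep w <#\<^bsub>N\<^esub> K \<in> carrier (N Mod K)"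
    using rep_iso assms by (auto simp: iso_def hom_def)
  then obtain x where x: "x \<in> carrier N" "rep w <#\<^bsub>N\<^esub> K = K #>\<^bsub>N\<^esub> x"
    by (auto simp: FactGroup_def RCOSETS_def)
  have "rep w \<in> rep w <#\<^bsub>N\<^esub> K"
    unfolding lcoset_iff using K_closed(3) by (intro bexI [of _ "mat 1"]) auto
  then obtain k where k: "k \<in> K" "rep w = k ** x"
    unfolding x by (auto simp: r_coset_def N_mult)
  have "K #>\<^bsub>N\<^esub> x = K #>\<^bsub>N\<^esub> (k ** x)"
  proof -
    have "k' ** x = (k' ** matrix_inv k) ** (k ** x)" "k' ** (k ** x) = (k' ** k) ** x" for k'
      using K_closed(1) [OF k(1)] by (simp_all add: matrix_group_simps)
    then show ?thesis
      unfolding r_coset_def N_mult using K_closed k(1) by auto blast+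
  qed
  then show ?thesis
    using x(2) k(2) by metis
qed

lemma rep_K:
  assumes "w \<in> W" "k \<in> K"
  shows "rep w ** k ** matrix_inv (rep w) \<in> K" "matrix_inv (rep w) ** k ** rep w \<in> K"
proof -
  have "rep w ** k \<in> K #>\<^bsub>N\<^esub> rep w"
    using assms by (auto simp: lcoset_iff simp flip: rep_coset_eq)
  then obtain k' where "k' \<in> K" "rep w ** k = k' ** rep w"
    by (auto simp: r_coset_def N_mult)
  moreover from this have "rep w ** k ** matrix_inv (rep w) = k'"
    using rep_invertible [OF assms(1)] by (simp add: matrix_right_inv_cancel)
  ultimately show "rep w ** k ** matrix_inv (rep w) \<in> K"
    by simp
  have "k ** rep w \<in> rep w <#\<^bsub>N\<^esub> K"
    using assms by (auto simp: rep_coset_eq r_coset_def N_mult)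
  then show "matrix_inv (rep w) ** k ** rep w \<in> K"
    using rep_invertible [OF assms(1)]
    by (auto simp: lcoset_iff matrix_group_simps)
qed

lemma rep_mult:
  assumes "u \<in> W" "w \<in> W"
  shows "\<exists>k\<in>K. rep (u \<circ> w) = rep u ** rep w ** k"
proof -
  have "rep (u \<circ> w) <#\<^bsub>N\<^esub> K = (rep u <#\<^bsub>N\<^esub> K) <#>\<^bsub>N\<^esub> (rep w <#\<^bsub>N\<^esub> K)"
    using rep_iso assms by (auto simp: iso_def hom_def FactGroup_def weyl_group_def perm_group_def)
  moreover have "rep (u \<circ> w) \<in> rep (u \<circ> w) <#\<^bsub>N\<^esub> K"
    unfolding lcoset_iff using K_closed(3) by (intro bexI [of _ "mat 1"]) auto
  ultimately obtain k k' where k: "k \<in> K" "k' \<in> K" "rep (u \<circ> w) = (rep u ** k) ** (rep w ** k')"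
    by (auto simp: set_mult_def N_mult lcoset_iff)
  moreover have "(rep u ** k) ** (rep w ** k') =
      rep u ** rep w ** ((matrix_inv (rep w) ** k ** rep w) ** k')"
    using rep_invertible [OF assms(2)] by (simp add: matrix_group_simps)
  ultimately have "rep (u \<circ> w) = rep u ** rep w ** ((matrix_inv (rep w) ** k ** rep w) ** k')"
    by simp
  then show ?thesis
    using k rep_K(2) [OF assms(2) k(1)] K_closed(2) by blast
qed

text \<open>Multiplicativity modulo \<open>K\<close>, applied to \<open>id \<circ> id\<close>, makes
  \<open>rep id\<close> the inverse of an element of \<open>K\<close>.\<close>

lemma rep_id: "rep id \<in> K"
proof -
  have id: "id \<in> W"
    by (rule W_closed)
  obtain k where k: "k \<in> K" "rep (id \<circ> id) = rep id ** rep id ** k"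
    using rep_mult [OF id id] by blast
  then have "rep id = matrix_inv k"
    using rep_invertible [OF id] K_closed(1) [OF k(1)]
    by (metis comp_id matrix_inv_unique matrix_left_cancel matrix_mul_assoc matrix_mul_rid
        matrix_inv_cancel_left(1) matrix_inv_right)
  then show ?thesis
    using k K_closed(4) by simp
qed

text \<open>Induction over products of reflections. Representatives are controlled only modulo
  \<open>K\<close>, and this suffices because \<open>K\<close> acts as the identity.\<close>

lemma rep_acts_as: "w \<in> W \<Longrightarrow> acts_as (rep w) w"
proof -
  have coset: "acts_as (rep w) u" if "rep w = g ** k" "acts_as g u" "k \<in> K" for w g k u
    using acts_as_mult [OF that(2) K_acts_as [OF that(3)]] that(1) by simp
  have refl: "acts_as (rep (reflection \<alpha>)) (reflection \<alpha>)" if \<alpha>: "\<alpha> \<in> \<Phi>" for \<alpha>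
  proof -
    have "rep (reflection \<alpha>) \<in> rep (reflection \<alpha>) <#\<^bsub>N\<^esub> K"
      unfolding lcoset_iff using K_closed(3) by (intro bexI [of _ "mat 1"]) auto
    then obtain k where "k \<in> K" "rep (reflection \<alpha>) = \<omega> \<alpha> ** k"
      unfolding rep_reflection [OF \<alpha>] lcoset_iff by blast
    then show ?thesis
      using coset acts_as_w_root [OF \<alpha>, of 1] by (simp add: \<omega>_def)
  qed
  assume "w \<in> W"
  then have "w \<in> generate perm_group (reflections \<Phi>)"
    by (simp add: weyl_group_def)
  then show ?thesis
  proof (induction rule: generate.induct)
    case one
    have "acts_as (rep id) id"
      by (rule K_acts_as [OF rep_id])
    moreover have "\<one>\<^bsub>perm_group\<^esub> = (id :: 'e \<Rightarrow> 'e)"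
      by (simp add: perm_group_def)
    ultimately show ?case
      by metis
  next
    case (incl w)
    then show ?case
      using refl by (auto simp: reflections_def)
  next
    case (inv w)
    then obtain \<alpha> where \<alpha>: "\<alpha> \<in> \<Phi>" "w = reflection \<alpha>"
      by (auto simp: reflections_def)
    then have "inv\<^bsub>perm_group\<^esub> w = w"
      using perm_group_inv W_bij reflection_W by (metis inv_equality reflection_reflection)
    then show ?case
      using refl \<alpha> by simp
  next
    case (eng u w)
    then have "u \<in> W" "w \<in> W"
      by (simp_all add: weyl_group_def)
    then obtain k where k: "k \<in> K" "rep (u \<circ> w) = rep u ** rep w ** k"
      using rep_mult by blast
    have "acts_as (rep (u \<circ> w)) (u \<circ> w)"
      using coset [OF k(2) acts_as_mult [OF eng.IH] k(1)] .
    moreover have "u \<otimes>\<^bsub>perm_group\<^esub> w = u \<circ> w"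
      by (simp add: perm_group_def)
    ultimately show ?case
      by metis
  qed
qed

lemma C_refl_rep_conj:
  assumes "w \<in> W" "c \<in> C_refl t" "x = rep w ** k" "k \<in> K"
  shows "x ** c ** matrix_inv x \<in> C_refl (w \<circ> t \<circ> inv_into UNIV w)"
proof -
  have C: "rep w \<in> C" "k \<in> C" "invertible (rep w)" "invertible k"
    using assms rep_N N_C K_C rep_invertible K_closed(1) by blast+
  have "rep w ** (k ** c ** matrix_inv k) ** matrix_inv (rep w) \<in> C_refl (w \<circ> t \<circ> inv_into UNIV w)"
  proof (rule C_refl_conj)
    show "k ** c ** matrix_inv k \<in> C_refl t"
      using assms by (intro C_refl_K_left C_refl_K_right K_closed)
    show "rep w ** matrix_inv (rep w) \<in> K"
      using C K_closed(3) by (simp add: matrix_inv_right)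
  qed (use C subgroup_GL(4) [OF C_subgroup] rep_K(1) assms rep_acts_as W_bij in auto)
  then show ?thesis
    using C by (simp add: assms(3) matrix_inv_mult matrix_mul_assoc)
qed

text \<open>The inverse of \<open>x\<close> represents the inverse of \<open>w\<close> up to an
  element of \<open>K\<close>, so the preceding lemma applies to that Weyl group element.\<close>

lemma C_refl_rep_conj_inv:
  assumes "w \<in> W" "c \<in> C_refl (w \<circ> t \<circ> inv_into UNIV w)" "x = rep w ** k" "k \<in> K"
  shows "matrix_inv x ** c ** x \<in> C_refl t"
proof -
  let ?u = "inv_into UNIV w"
  have u: "?u \<in> W" "bij ?u" "w \<circ> ?u = id" "?u \<circ> w = id"
    using assms(1) W_closed(3) W_bij [OF assms(1)]
    by (auto simp: bij_is_surj bij_is_inj bij_imp_bij_inv surj_iff [symmetric] inj_iff [symmetric])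
  have inv: "invertible (rep w)" "invertible k" "invertible (rep ?u)"
    using rep_invertible K_closed(1) assms u by blast+
  obtain k' where k': "k' \<in> K" "rep (w \<circ> ?u) = rep w ** rep ?u ** k'"
    using rep_mult assms(1) u(1) by blast
  then have "matrix_inv (rep w) = rep ?u ** (k' ** matrix_inv (rep id))"
    using inv K_closed(1) [OF k'(1)] K_closed(1) [OF rep_id] u
    by (simp add: matrix_group_simps)
  then have "matrix_inv x = matrix_inv k ** rep ?u ** (k' ** matrix_inv (rep id))"
    using inv by (simp add: assms(3) matrix_inv_mult matrix_mul_assoc)
  also have "\<dots> = rep ?u ** ((matrix_inv (rep ?u) ** matrix_inv k ** rep ?u) ** (k' ** matrix_inv (rep id)))"
    using inv by (simp add: matrix_group_simps)
  finally have x: "matrix_inv x = rep ?u ** ((matrix_inv (rep ?u) ** matrix_inv k ** rep ?u) ** (k' ** matrix_inv (rep id)))" .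
  have "matrix_inv x ** c ** matrix_inv (matrix_inv x) \<in>
      C_refl (?u \<circ> (w \<circ> t \<circ> ?u) \<circ> inv_into UNIV ?u)"
    using assms u k' rep_id by (intro C_refl_rep_conj [OF _ _ x] K_closed rep_K) auto
  moreover have "?u \<circ> (w \<circ> t \<circ> ?u) \<circ> inv_into UNIV ?u = t"
    using u assms(1) W_bij by (simp add: fun_eq_iff inv_inv_eq) 
  ultimately show ?thesis
    using inv by (simp add: assms(3) matrix_inv_matrix_inv invertible_mult)
qed

subsection \<open>Local slices\<close>

text \<open>A linear left inverse extends the coordinates from the image of
  \<open>\<iota> \<alpha>\<close> to all matrices, where linearity gives continuity.\<close>

lemma \<iota>_coordinates:
  assumes "\<alpha> \<in> \<Phi>"
  obtains p q :: "complex^'n^'n \<Rightarrow> complex"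
  where "continuous_on UNIV p" "continuous_on UNIV q"
    "\<And>M. p (\<iota> \<alpha> M) = M $ 1 $ 1" "\<And>M. q (\<iota> \<alpha> M) = M $ 2 $ 1"
proof -
  define L :: "complex \<times> complex \<times> complex \<Rightarrow> complex^'n^'n"
    where "L = (\<lambda>(a, b, c). cscale a (X \<alpha>) + cscale b (X (- \<alpha>)) + cscale c (h \<alpha>))"
  have "linear L"
    by (rule linearI) (auto simp: L_def cscale_add_left cscale_add scaleR_cscale scaleR_conv_of_real)
  moreover have "inj L"
    unfolding linear_injective_0 [OF \<open>linear L\<close>]
    using \<iota>_zero_iff [OF assms] by (auto simp: L_def zero_prod_def)
  ultimately obtain g where g: "linear g" "g \<circ> L = id"
    using linear_injective_left_inverse by blast
  have cont: "continuous_on UNIV g"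
    using g(1) by (rule linear_continuous_on [OF linear_conv_bounded_linear [THEN iffD1]])
  have "g (\<iota> \<alpha> M) = (M $ 1 $ 2, M $ 2 $ 1, M $ 1 $ 1)" for M
    using fun_cong [OF g(2), of "(M $ 1 $ 2, M $ 2 $ 1, M $ 1 $ 1)"] by (simp add: L_def \<iota>_def)
  then show thesis
    using cont by (intro that [of "\<lambda>Y. snd (snd (g Y))" "\<lambda>Y. fst (snd (g Y))"]) (auto intro!: continuous_intros)
qed

lemma continuous_on_x_root:
  "continuous_on S f \<Longrightarrow> continuous_on S (\<lambda>x. x_root \<alpha> (f x))"
  unfolding x_root_def by (rule continuous_on_compose2 [OF continuous_on_matrix_exp]) auto

lemmas continuous_on_matrix_mult = bounded_bilinear.continuous_on [OF bounded_bilinear_matrix_mult]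

lemma K_h: "\<alpha> \<in> \<Phi> \<Longrightarrow> k \<in> K \<Longrightarrow> k ** h \<alpha> = h \<alpha> ** k"
  using K_acts_as [of k] by (simp add: acts_as_def h_H)

text \<open>
  The point of \<open>SU\<^sub>2\<close> modulo its diagonal torus that an element of \<open>C\<^sub>s\<close> determines is read off from the
  conjugate of \<open>h\<close>. Where the upper left entry is nonzero, it is represented by a unique matrix for
  which this entry is positive.
\<close>

lemma C_refl_slice:
  assumes "c\<^sub>0 \<in> C_refl t"
  obtains V \<kappa> where "openin (top_of_set (C_refl t)) V" "c\<^sub>0 \<in> V" "continuous_on V \<kappa>"
    "\<And>c. c \<in> V \<Longrightarrow> \<kappa> c \<in> K"
    "\<And>c k. c \<in> V \<Longrightarrow> k \<in> K \<Longrightarrow> c ** k \<in> V \<and> \<kappa> (c ** k) = \<kappa> c ** k"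
proof -
  obtain \<alpha> A\<^sub>0 k\<^sub>0 where c0: "\<alpha> \<in> \<Phi>" "t = reflection \<alpha>" "A\<^sub>0 \<in> SU2" "k\<^sub>0 \<in> K" "c\<^sub>0 = \<phi> \<alpha> A\<^sub>0 ** k\<^sub>0"
    using assms by (rule C_refl_cases)
  obtain p q :: "complex^'n^'n \<Rightarrow> complex"
    where pq: "continuous_on UNIV p" "continuous_on UNIV q"
    "\<And>M. p (\<iota> \<alpha> M) = M $ 1 $ 1" "\<And>M. q (\<iota> \<alpha> M) = M $ 2 $ 1"
    using \<iota>_coordinates [OF c0(1)] by blast
  \<comment> \<open>Left translation by the SU_2 part of \<open>c\<^sub>0\<close> moves
    \<open>c\<^sub>0\<close> into \<open>K\<close>, so that
    \<open>p (Q c\<^sub>0) = 1\<close>.\<close>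
  define d where "d c = \<phi> \<alpha> (matrix_inv A\<^sub>0) ** c" for c :: "complex^'n^'n"
  define Q where "Q c = d c ** h \<alpha> ** matrix_inv (d c)" for c
  \<comment> \<open>If \<open>d c\<close> is \<open>\<phi> \<alpha> A ** k\<close> and
    \<open>A\<close> has first column \<open>(a, e)\<close>, then \<open>p (Q c)\<close> is
    \<open>2 |a|^2 - 1\<close> and \<open>q (Q c)\<close> is \<open>2 * cnj a * e\<close>. The bound
    -1 thus says that \<open>a\<close> is nonzero. In that case \<open>r c\<close> is
    \<open>|a|\<close>, and \<open>y c\<close> is \<open>e\<close> multiplied by the conjugate phase
    of \<open>a\<close>.\<close>
  define V where "V = C_refl t \<inter> (\<lambda>c. Re (p (Q c))) -` {-1<..}"
  define r where "r c = sqrt ((1 + Re (p (Q c))) / 2)" for c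
  define y where "y c = q (Q c) / of_real (2 * r c)" for c
  \<comment> \<open>The image of the SU_2 matrix with first column \<open>(r c, y c)\<close>,
    factored as lower times diagonal times upper. In this form it is a product of root elements,
    with parameters continuous in \<open>c\<close>.\<close>
  define P where "P c = x_root (- \<alpha>) (y c / of_real (r c)) **
      (x_root \<alpha> (of_real (r c)) ** x_root (- \<alpha>) (- inverse (of_real (r c))) ** x_root \<alpha> (of_real (r c)) **
        matrix_inv (\<omega> \<alpha>)) **
      x_root \<alpha> (- cnj (y c) / of_real (r c))" for c
  define \<kappa> where "\<kappa> c = matrix_inv (P c) ** d c" for c
  have d: "d c \<in> C_refl t" if "c \<in> C_refl t" for c
    using that C_refl_SU2_left SU2_inv c0 by (simp add: d_def)
  have Q: "Q c = \<iota> \<alpha> (m2 (a * cnj a - e * cnj e) (2 * a * cnj e) (2 * cnj a * e) (e * cnj e - a * cnj a))"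
    if "d c = \<phi> \<alpha> (m2 a (- cnj e) e (cnj a)) ** k" "a * cnj a + e * cnj e = 1" "k \<in> K" for c a e k
  proof -
    let ?A = "m2 a (- cnj e) e (cnj a)"
    have det: "det ?A = 1" "a * cnj a - (- cnj e) * e = 1"
      using that(2) by (simp_all add: mult.commute)
    have inv: "invertible k" "invertible (\<phi> \<alpha> ?A)"
      using K_closed(1) that(3) \<phi>_inv [OF c0(1) det(1)] by blast+
    have "Q c = \<phi> \<alpha> ?A ** (k ** h \<alpha>) ** matrix_inv k ** matrix_inv (\<phi> \<alpha> ?A)"
      using inv by (simp add: Q_def that(1) matrix_inv_mult matrix_mul_assoc)
    also have "\<dots> = \<phi> \<alpha> ?A ** h \<alpha> ** matrix_inv (\<phi> \<alpha> ?A)"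
      using inv by (simp add: K_h c0(1) that(3) matrix_group_simps)
    also have "h \<alpha> = \<iota> \<alpha> (m2 1 0 0 (- 1))"
      by (simp add: \<iota>_def)
    also have "\<phi> \<alpha> ?A ** \<iota> \<alpha> (m2 1 0 0 (- 1)) = \<iota> \<alpha> (?A ** m2 1 0 0 (- 1) ** matrix_inv ?A) ** \<phi> \<alpha> ?A"
      using det by (intro \<phi>_\<iota> c0) (auto simp: m2_trace)
    also have "?A ** m2 1 0 0 (- 1) ** matrix_inv ?A =
        m2 (a * cnj a - e * cnj e) (2 * a * cnj e) (2 * cnj a * e) (e * cnj e - a * cnj a)"
      unfolding m2_inv [OF det(2)] by (simp add: mult_ac)
    finally show ?thesis
      using inv by (simp add: matrix_right_inv_cancel)
  qed
  have main: "\<kappa> c \<in> K \<and> P c \<in> carrier G" if c: "c \<in> V" for c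
  proof -
    have "c \<in> C_refl t" and Vc: "Re (p (Q c)) > -1"
      using c by (auto simp: V_def)
    then obtain A k where A: "A \<in> SU2" "k \<in> K" "d c = \<phi> \<alpha> A ** k"
      using d C_refl_eq [OF c0(1)] c0(2) by blast
    then obtain a e where ae: "A = m2 a (- cnj e) e (cnj a)" "a * cnj a + e * cnj e = 1"
      by (auto elim: SU2_cases)
    note Qc = Q [OF A(3) [unfolded ae(1)] ae(2) A(2)]
    have norms: "a * cnj a = of_real ((norm a)\<^sup>2)" "e * cnj e = of_real ((norm e)\<^sup>2)"
      by (simp_all only: complex_norm_square)
    have "(of_real ((norm a)\<^sup>2 + (norm e)\<^sup>2) :: complex) = of_real 1"
      using ae(2) unfolding norms by simp
    then have ne: "(norm a)\<^sup>2 + (norm e)\<^sup>2 = 1"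
      unfolding of_real_eq_iff .
    have "p (Q c) = of_real ((norm a)\<^sup>2 - (norm e)\<^sup>2)"
      unfolding Qc pq(3) m2_nth norms by simp
    then have Rep: "Re (p (Q c)) = 2 * (norm a)\<^sup>2 - 1"
      using ne by simp
    then have a0: "a \<noteq> 0"
      using Vc by auto
    have r: "r c = norm a"
      by (simp add: r_def Rep)
    have y: "y c = cnj a * e / of_real (norm a)"
      unfolding y_def r Qc pq(4) m2_nth using a0 by simp
    let ?n = "of_real (norm a) :: complex" and ?u = "a / of_real (norm a)"
    have n0: "?n \<noteq> 0" "?n * ?n = a * cnj a"
      using a0 by (simp_all add: norms power2_eq_square)
    have yy: "y c * cnj (y c) = e * cnj e"
      using n0 a0 by (simp add: y field_simps)
    have "P c = \<phi> \<alpha> (lower_unitri (y c / ?n)) ** h_root \<alpha> ?n ** \<phi> \<alpha> (upper_unitri (- cnj (y c) / ?n))"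
      unfolding P_def r h_root_def w_root_def \<phi>_upper [OF c0(1)] \<phi>_lower [OF c0(1)] ..
    also have "\<dots> = \<phi> \<alpha> (lower_unitri (y c / ?n)) ** \<phi> \<alpha> (m2 ?n 0 0 (inverse ?n)) **
        \<phi> \<alpha> (upper_unitri (- cnj (y c) / ?n))"
      using h_root_\<phi> c0(1) n0 by simp
    also have "\<dots> = \<phi> \<alpha> (lower_unitri (y c / ?n) ** m2 ?n 0 0 (inverse ?n) ** upper_unitri (- cnj (y c) / ?n))"
      using c0(1) n0 by (simp add: \<phi>_mult det_mul lower_m2 upper_m2 del: m2_mult)
    also have "lower_unitri (y c / ?n) ** m2 ?n 0 0 (inverse ?n) ** upper_unitri (- cnj (y c) / ?n) =
        m2 ?n (- cnj (y c)) (y c) ?n"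
    proof -
      have "inverse ?n - y c * cnj (y c) / ?n = (1 - e * cnj e) / ?n"
        by (simp add: yy inverse_eq_divide diff_divide_distrib)
      also have "1 - e * cnj e = ?n * ?n"
        using ae(2) n0 by (simp add: algebra_simps)
      finally have "inverse ?n - y c * cnj (y c) / ?n = ?n"
        using n0(1) by simp
      then show ?thesis
        using n0 by (simp add: lower_m2 upper_m2 m2_eq_iff algebra_simps)
    qed
    finally have P: "P c = \<phi> \<alpha> (m2 ?n (- cnj (y c)) (y c) ?n)" .
    have B: "m2 ?n (- cnj (y c)) (y c) ?n \<in> SU2"
      using SU2_m2 [of ?n "y c"] yy n0 ae(2) by simp
    have u: "norm ?u = 1" "cnj ?u = cnj a / ?n"
      using a0 by (simp_all add: norm_divide)
    \<comment> \<open>The phase of \<open>a\<close> splits off as a diagonal factor, whose image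
      lies in \<open>K\<close>.\<close>
    have "A = m2 ?n (- cnj (y c)) (y c) ?n ** m2 ?u 0 0 (cnj ?u)"
    proof -
      have "y c * ?u = e"
        using n0 a0 by (simp add: y field_simps)
      moreover from this have "cnj (y c) * cnj ?u = cnj e"
        by (metis complex_cnj_mult)
      ultimately show ?thesis
        using n0 u(2) by (simp add: ae(1))
    qed
    then have "d c = P c ** (\<phi> \<alpha> (m2 ?u 0 0 (cnj ?u)) ** k)"
      unfolding A(3) P using \<phi>_mult [OF c0(1) SU2_det [OF B] SU2_det [OF SU2_diag [OF u(1)]]]
      by (simp add: matrix_mul_assoc del: m2_mult)
    moreover have PG: "P c \<in> carrier G"
      unfolding P by (intro \<phi>_G c0 SU2_det B)
    ultimately have "\<kappa> c = \<phi> \<alpha> (m2 ?u 0 0 (cnj ?u)) ** k"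
      using G_closed(1) [OF PG] by (simp add: \<kappa>_def matrix_inv_cancel_left)
    then show ?thesis
      using diag_in_K [OF c0(1) u(1)] A(2) PG K_closed(2) by simp
  qed
  have equi: "c ** k \<in> V \<and> \<kappa> (c ** k) = \<kappa> c ** k" if "c \<in> V" "k \<in> K" for c k
  proof -
    have c: "c \<in> C_refl t"
      using that by (simp add: V_def)
    have inv: "invertible (d c)" "invertible k"
      using C_refl_invertible [OF d [OF c]] K_closed(1) that by blast+
    have dk: "d (c ** k) = d c ** k"
      by (simp add: d_def matrix_mul_assoc)
    have "Q (c ** k) = d c ** (k ** h \<alpha>) ** matrix_inv k ** matrix_inv (d c)"
      using inv by (simp add: Q_def dk matrix_inv_mult matrix_mul_assoc)
    also have "\<dots> = Q c"
      using inv by (simp add: K_h c0(1) that(2) Q_def matrix_group_simps)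
    finally have Qk: "Q (c ** k) = Q c" .
    then have "P (c ** k) = P c"
      by (simp add: P_def y_def r_def)
    then show ?thesis
      using that c Qk C_refl_K_right by (auto simp: \<kappa>_def V_def dk matrix_mul_assoc)
  qed
  have inv_d: "invertible (d c)" if "c \<in> C_refl t" for c
    using C_refl_invertible d that by blast
  have cont_d: "continuous_on S d" for S
    unfolding d_def by (intro continuous_on_matrix_mult continuous_intros)
  have cont_Q: "continuous_on (C_refl t) Q"
    unfolding Q_def
    by (intro continuous_on_matrix_mult cont_d continuous_intros
        continuous_on_compose2 [OF continuous_on_matrix_inv cont_d]) (auto simp: inv_d)
  have cont_p: "continuous_on (C_refl t) (\<lambda>c. p (Q c))" "continuous_on (C_refl t) (\<lambda>c. q (Q c))"
    using pq(1,2) cont_Q by (auto intro: continuous_on_compose2)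
  have sub: "V \<subseteq> C_refl t"
    by (auto simp: V_def)
  have r0: "r c \<noteq> 0" if "c \<in> V" for c
    using that by (auto simp: V_def r_def)
  have cont_r: "continuous_on V r"
    unfolding r_def by (intro continuous_intros continuous_on_subset [OF cont_p(1) sub]) auto
  have cont_y: "continuous_on V y"
    unfolding y_def by (intro continuous_intros continuous_on_subset [OF cont_p(2) sub] cont_r) (auto simp: r0)
  have cont_P: "continuous_on V P"
    unfolding P_def
    by (intro continuous_on_matrix_mult continuous_on_x_root continuous_intros cont_r cont_y) (auto simp: r0)
  have "continuous_on V \<kappa>"
    unfolding \<kappa>_def using main G_closed(1)
    by (intro continuous_on_matrix_mult cont_d continuous_on_compose2 [OF continuous_on_matrix_inv cont_P]) auto
  moreover have "openin (top_of_set (C_refl t)) V"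
    unfolding V_def by (rule continuous_openin_preimage_gen) (auto intro!: continuous_intros cont_p)
  moreover have "c\<^sub>0 \<in> V"
  proof -
    have "d c\<^sub>0 = k\<^sub>0"
      using matrix_inv_cancel_left(2) [OF \<phi>_inv(1) [OF c0(1) SU2_det [OF c0(3)]], of k\<^sub>0]
      by (simp add: d_def c0(5) \<phi>_inv c0(1) SU2_det c0(3))
    then have "d c\<^sub>0 = \<phi> \<alpha> (m2 1 (- cnj 0) 0 (cnj 1)) ** k\<^sub>0"
      using \<phi>_one [OF c0(1)] by (simp add: m2_one)
    from Q [OF this _ c0(4)] have "p (Q c\<^sub>0) = 1"
      by (simp add: pq)
    then show ?thesis
      using assms by (simp add: V_def)
  qed
  ultimately show thesis
    using main equi by (intro that [of V \<kappa>]) auto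
qed

end

section \<open>Products over finite chains\<close>

text \<open>The order of the ambient type need not be well-founded, hence the measure: the number of
  elements of \<open>J\<close> below.\<close>

lemma finite_chain_induct [consumes 2, case_names less]:
  fixes J :: "'i::linorder set"
  assumes "finite J" "b \<in> J" "\<And>b. b \<in> J \<Longrightarrow> (\<And>j. j \<in> J \<Longrightarrow> j < b \<Longrightarrow> P j) \<Longrightarrow> P b"
  shows "P b"
  using assms(2)
proof (induction "card {j \<in> J. j < b}" arbitrary: b rule: less_induct)
  case less
  show ?case
  proof (rule assms(3) [OF less.prems])
    fix j assume j: "j \<in> J" "j < b"
    then have "{i \<in> J. i < j} \<subset> {i \<in> J. i < b}"
      by auto
    then show "P j"
      using assms(1) j(1) by (intro less.hyps psubset_card_mono) auto
  qed
qed

lemma sorted_list_of_set_Un: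
  fixes S T :: "'i::linorder set"
  assumes "finite S" "finite T" "\<And>x y. x \<in> S \<Longrightarrow> y \<in> T \<Longrightarrow> x < y"
  shows "sorted_list_of_set (S \<union> T) = sorted_list_of_set S @ sorted_list_of_set T"
  by (rule strict_sorted_equal)
    (use assms in \<open>auto simp: sorted_wrt_append strict_sorted_list_of_set\<close>)

definition chain_prod :: "('i::linorder \<Rightarrow> complex^'n^'n) \<Rightarrow> 'i set \<Rightarrow> complex^'n^'n" where
  "chain_prod c S = mprod (map c (sorted_list_of_set S))"

lemma seq_prod_chain_prod: "seq_prod J c r = chain_prod c (ivl J r)"
  by (simp add: seq_prod_def chain_prod_def)

lemma mprod_simps [simp]: "mprod [] = mat 1" "mprod (A # As) = A ** mprod As"
  by (simp_all add: mprod_def)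

lemma mprod_append: "mprod (As @ Bs) = mprod As ** mprod Bs"
  by (induction As) (simp_all add: matrix_mul_assoc)

lemma chain_prod_Un:
  "finite S \<Longrightarrow> finite T \<Longrightarrow> (\<And>x y. x \<in> S \<Longrightarrow> y \<in> T \<Longrightarrow> x < y) \<Longrightarrow>
    chain_prod c (S \<union> T) = chain_prod c S ** chain_prod c T"
  by (simp add: chain_prod_def sorted_list_of_set_Un mprod_append)

lemma chain_prod_singleton [simp]: "chain_prod c {a} = c a"
  by (simp add: chain_prod_def)

lemma chain_prod_cong: "finite S \<Longrightarrow> (\<And>x. x \<in> S \<Longrightarrow> c x = d x) \<Longrightarrow> chain_prod c S = chain_prod d S"
  unfolding chain_prod_def by (intro arg_cong [where f = mprod]) auto

lemma chain_prod_snoc: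
  "finite S \<Longrightarrow> (\<And>x. x \<in> S \<Longrightarrow> x < b) \<Longrightarrow> chain_prod c (insert b S) = chain_prod c S ** c b"
  using chain_prod_Un [of S "{b}" c] by simp

lemma mprod_invertible: "(\<And>A. A \<in> set As \<Longrightarrow> invertible A) \<Longrightarrow> invertible (mprod As)"
  by (induction As) (auto intro: invertible_mult)

lemma chain_prod_invertible:
  "finite S \<Longrightarrow> (\<And>x. x \<in> S \<Longrightarrow> invertible (c x)) \<Longrightarrow> invertible (chain_prod c S)"
  unfolding chain_prod_def by (intro mprod_invertible) auto

lemma continuous_map_mprod:
  "(\<And>f. f \<in> set fs \<Longrightarrow> continuous_map T euclidean f) \<Longrightarrow>
    continuous_map T euclidean (\<lambda>x. mprod (map (\<lambda>f. f x) fs))"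
  by (induction fs) (auto intro: continuous_map_matrix_mult)

lemma continuous_map_chain_prod:
  assumes "finite S" "\<And>i. i \<in> S \<Longrightarrow> continuous_map T euclidean (\<lambda>x. c x i)"
  shows "continuous_map T euclidean (\<lambda>x. chain_prod (c x) S)"
proof -
  have "continuous_map T euclidean (\<lambda>x. mprod (map (\<lambda>f. f x) (map (\<lambda>i x. c x i) (sorted_list_of_set S))))"
    using assms by (intro continuous_map_mprod) auto
  then show ?thesis
    by (simp add: chain_prod_def o_def)
qed

lemma chain_pred_cases:
  fixes J :: "'i::linorder set"
  assumes "finite J" "b \<in> J"
  obtains (first) "{j \<in> J. j < b} = {}"
    | (step) p where "p \<in> J" "p < b" "{j \<in> J. j < b} = {j \<in> J. j \<le> p}"
proof (cases "{j \<in> J. j < b} = {}")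
  case False
  let ?p = "Max {j \<in> J. j < b}"
  have p: "?p \<in> {j \<in> J. j < b}"
    using assms False by (intro Max_in) auto
  have "j \<le> ?p" if "j \<in> J" "j < b" for j
    using assms that by (intro Max_ge) auto
  then have "{j \<in> J. j < b} = {j \<in> J. j \<le> ?p}"
    using p by auto
  then show thesis
    using p by (intro step [of ?p]) auto
qed (rule first)

lemma prev_entry_first: "{j \<in> J. j < b} = {} \<Longrightarrow> prev_entry J k b = mat 1"
  unfolding prev_entry_def by (rule if_P)

lemma Max_chain_le:
  fixes J :: "'i::linorder set"
  shows "finite J \<Longrightarrow> p \<in> J \<Longrightarrow> Max {j \<in> J. j \<le> p} = p"
  by (rule Max_eqI) auto

lemma prev_entry_step:
  assumes "finite J" "p \<in> J" "{j \<in> J. j < b} = {j \<in> J. j \<le> p}"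
  shows "prev_entry J k b = k p"
  unfolding prev_entry_def assms(3) using Max_chain_le [OF assms(1,2)] assms(2) by auto

lemma prev_entry_cong:
  assumes "finite J" "\<And>j. j \<in> J \<Longrightarrow> j < i \<Longrightarrow> k j = k' j"
  shows "prev_entry J k i = prev_entry J k' i"
proof (cases "{j \<in> J. j < i} = {}")
  case False
  then have "Max {j \<in> J. j < i} \<in> {j \<in> J. j < i}"
    using assms(1) by (intro Max_in) auto
  then show ?thesis
    using assms(2) False by (simp only: prev_entry_def if_False) auto
qed (simp add: prev_entry_first)

text \<open>Telescoping: each inner \<open>k i\<close> meets its inverse in the next entry, and only
  the factors before \<open>a\<close> and at \<open>b\<close> survive.\<close>

lemma seq_prod_act:
  assumes "finite J" "a \<in> J" "b \<in> J" "a \<le> b" "\<And>i. i \<in> J \<Longrightarrow> invertible (k i)"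
  shows "seq_prod J (act J c k) (a, b) = matrix_inv (prev_entry J k a) ** seq_prod J c (a, b) ** k b"
  using assms(1,3,4)
proof (induction rule: finite_chain_induct)
  case (less b)
  show ?case
  proof (cases "a = b")
    case True
    then have "ivl J (a, b) = {b}"
      using less.hyps by (auto simp: ivl_def)
    then show ?thesis
      using True less.hyps by (simp add: seq_prod_chain_prod act_def)
  next
    case False
    with less.prems have "a < b"
      by simp
    show ?thesis
      using assms(1) \<open>b \<in> J\<close>
    proof (cases rule: chain_pred_cases)
      case first
      then show ?thesis
        using assms(2) \<open>a < b\<close> by auto
    next
      case (step p)
      then have "a \<le> p"
        using assms(2) \<open>a < b\<close> by auto
      have ivl: "ivl J (a, b) = insert b (ivl J (a, p))"
        using step less.hyps \<open>a < b\<close> unfolding ivl_def by (auto simp: le_less)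
      have fin: "finite (ivl J (a, p))" "\<And>x. x \<in> ivl J (a, p) \<Longrightarrow> x < b"
        using assms(1) step by (auto simp: ivl_def)
      have "seq_prod J (act J c k) (a, b) = seq_prod J (act J c k) (a, p) ** act J c k b"
        unfolding seq_prod_chain_prod ivl by (rule chain_prod_snoc) (use fin in auto)
      also have "\<dots> = matrix_inv (prev_entry J k a) ** seq_prod J c (a, p) ** k p **
          (matrix_inv (k p) ** c b ** k b)"
        using less.IH [OF step(1,2) \<open>a \<le> p\<close>] less.hyps
        by (simp only:) (simp add: act_def prev_entry_step [OF assms(1) step(1,3)])
      also have "\<dots> = matrix_inv (prev_entry J k a) ** (seq_prod J c (a, p) ** c b) ** k b"
        using assms(5) [OF step(1)] by (simp add: matrix_group_simps)
      also have "seq_prod J c (a, p) ** c b = seq_prod J c (a, b)"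
        unfolding seq_prod_chain_prod ivl by (rule chain_prod_snoc [symmetric]) (use fin in auto)
      finally show ?thesis .
    qed
  qed
qed

section \<open>Open maps and quotient maps\<close>

text \<open>An open box maps onto the box of its images, and surjectivity keeps all but finitely
  many of these factors full. The analogous statement for quotient maps fails in general, hence the
  insistence on open maps.\<close>

lemma open_map_product_maps:
  assumes "\<And>i. i \<in> J \<Longrightarrow> open_map (X i) (Y i) (f i)"
    "\<And>i. i \<in> J \<Longrightarrow> f i ` topspace (X i) = topspace (Y i)"
  shows "open_map (product_topology X J) (product_topology Y J) (\<lambda>x. \<lambda>i\<in>J. f i (x i))"
  unfolding open_map_def
proof (intro allI impI)
  fix U assume U: "openin (product_topology X J) U"
  show "openin (product_topology Y J) ((\<lambda>x. \<lambda>i\<in>J. f i (x i)) ` U)"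
    unfolding openin_product_topology_alt
  proof (intro ballI)
    fix y assume "y \<in> (\<lambda>x. \<lambda>i\<in>J. f i (x i)) ` U"
    then obtain x where x: "x \<in> U" "y = (\<lambda>i\<in>J. f i (x i))"
      by blast
    obtain B where B: "finite {i \<in> J. B i \<noteq> topspace (X i)}" "\<forall>i\<in>J. openin (X i) (B i)"
      "x \<in> PiE J B" "PiE J B \<subseteq> U"
      using bspec [OF U [unfolded openin_product_topology_alt] x(1)] by (elim exE conjE)
    have "finite {i \<in> J. f i ` B i \<noteq> topspace (Y i)}"
      by (rule finite_subset [OF _ B(1)]) (use assms(2) in auto)
    moreover have "\<forall>i\<in>J. openin (Y i) (f i ` B i)"
      using assms(1) B(2) by (auto simp: open_map_def)
    moreover have "y \<in> PiE J (\<lambda>i. f i ` B i)"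
      using B(3) x(2) by (auto simp: PiE_iff)
    moreover have "PiE J (\<lambda>i. f i ` B i) \<subseteq> (\<lambda>x. \<lambda>i\<in>J. f i (x i)) ` U"
    proof
      fix z assume z: "z \<in> PiE J (\<lambda>i. f i ` B i)"
      then have "\<forall>i\<in>J. \<exists>w. w \<in> B i \<and> z i = f i w"
        by (auto simp: PiE_iff)
      from bchoice [OF this] obtain w where w: "\<And>i. i \<in> J \<Longrightarrow> w i \<in> B i \<and> z i = f i (w i)"
        by auto
      have "restrict w J \<in> U"
        using w B(4) by (auto simp: PiE_iff)
      moreover have "z = (\<lambda>i\<in>J. f i (restrict w J i))"
      proof
        fix i
        show "z i = (\<lambda>i\<in>J. f i (restrict w J i)) i"
          using w PiE_arb [OF z] by (cases "i \<in> J") simp_all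
      qed
      ultimately show "z \<in> (\<lambda>x. \<lambda>i\<in>J. f i (x i)) ` U"
        by (intro image_eqI)
    qed
    ultimately show "\<exists>V. finite {i \<in> J. V i \<noteq> topspace (Y i)} \<and> (\<forall>i\<in>J. openin (Y i) (V i)) \<and>
        y \<in> PiE J V \<and> PiE J V \<subseteq> (\<lambda>x. \<lambda>i\<in>J. f i (x i)) ` U"
      by (intro exI [of _ "\<lambda>i. f i ` B i"] conjI)
  qed
qed

lemma open_map_prod_maps:
  assumes "open_map X X' f" "open_map Y Y' g"
  shows "open_map (prod_topology X Y) (prod_topology X' Y') (\<lambda>(x, y). (f x, g y))"
  unfolding open_map_def
proof (intro allI impI)
  fix U assume U: "openin (prod_topology X Y) U"
  show "openin (prod_topology X' Y') ((\<lambda>(x, y). (f x, g y)) ` U)"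
    unfolding openin_prod_topology_alt
  proof (intro allI impI)
    fix x' y' assume "(x', y') \<in> (\<lambda>(x, y). (f x, g y)) ` U"
    then obtain x y where xy: "(x, y) \<in> U" "x' = f x" "y' = g y"
      by auto
    obtain A B where AB: "openin X A" "openin Y B" "x \<in> A" "y \<in> B" "A \<times> B \<subseteq> U"
      using U [unfolded openin_prod_topology_alt, rule_format, OF xy(1)] by (elim exE conjE)
    have "f ` A \<times> g ` B \<subseteq> (\<lambda>(x, y). (f x, g y)) ` U"
      using AB(5) by (force simp: image_iff)
    then show "\<exists>A' B'. openin X' A' \<and> openin Y' B' \<and> x' \<in> A' \<and> y' \<in> B' \<and>
        A' \<times> B' \<subseteq> (\<lambda>(x, y). (f x, g y)) ` U"
      using assms AB xy unfolding open_map_def by blast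
  qed
qed

lemma quotient_map_lift:
  assumes "quotient_map X Y f" "continuous_map X Z h"
    "\<And>x y. x \<in> topspace X \<Longrightarrow> y \<in> topspace X \<Longrightarrow> f x = f y \<Longrightarrow> h x = h y"
  shows "\<exists>g. continuous_map Y Z g \<and> (\<forall>x\<in>topspace X. g (f x) = h x)"
proof (rule quotient_map_lift_exists [OF assms(1,2)])
  fix g assume "continuous_map Y Z g" "\<And>x. x \<in> topspace X \<Longrightarrow> g (f x) = h x"
  then show "\<exists>g. continuous_map Y Z g \<and> (\<forall>x\<in>topspace X. g (f x) = h x)"
    by (intro exI [of _ g] conjI ballI)
qed (rule assms(3))

section \<open>The action of \<open>K(I)\<close>\<close>

context bott_samelson_setting
begin

abbreviation K_seq :: "'i::linorder set \<Rightarrow> ('i \<Rightarrow> complex^'n^'n) set" where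
  "K_seq J \<equiv> PiE J (\<lambda>_. K)"

abbreviation C_seq :: "'i::linorder set \<Rightarrow> ('i \<Rightarrow> 'e \<Rightarrow> 'e) \<Rightarrow> ('i \<Rightarrow> complex^'n^'n) set" where
  "C_seq J s \<equiv> PiE J (\<lambda>i. C_refl (s i))"

lemma prev_entry_K:
  fixes J :: "'i::linorder set"
  assumes "finite J" "k \<in> K_seq J"
  shows "prev_entry J k i \<in> K"
proof (cases "{j \<in> J. j < i} = {}")
  case False
  then have "Max {j \<in> J. j < i} \<in> {j \<in> J. j < i}"
    using assms by (intro Max_in) auto
  then show ?thesis
    using assms False by (auto simp: prev_entry_def PiE_iff)
qed (use K_closed in \<open>simp add: prev_entry_def\<close>)

lemma K_seq_invertible:
  "finite J \<Longrightarrow> k \<in> K_seq J \<Longrightarrow> i \<in> J \<Longrightarrow> invertible (k i)"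
  "finite J \<Longrightarrow> k \<in> K_seq J \<Longrightarrow> invertible (prev_entry J k i)"
  using K_closed(1) prev_entry_K by blast+

lemma K_seq_one: "(\<lambda>i\<in>J. mat 1) \<in> K_seq J"
  using K_closed by auto

lemma K_seq_mult: "k \<in> K_seq J \<Longrightarrow> k' \<in> K_seq J \<Longrightarrow> (\<lambda>i\<in>J. k i ** k' i) \<in> K_seq J"
  using K_closed by (auto simp: PiE_iff)

lemma K_seq_inv: "k \<in> K_seq J \<Longrightarrow> (\<lambda>i\<in>J. matrix_inv (k i)) \<in> K_seq J"
  using K_closed by (auto simp: PiE_iff)

lemma act_one:
  fixes c :: "'i::linorder \<Rightarrow> complex^'n^'n"
  assumes "finite J" "c \<in> extensional J"
  shows "act J c (\<lambda>i\<in>J. mat 1) = c"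
proof
  fix i
  show "act J c (\<lambda>i\<in>J. mat 1) i = c i"
  proof (cases "i \<in> J")
    case True
    with assms(1) have "prev_entry J (\<lambda>i\<in>J. mat 1 :: complex^'n^'n) i = mat 1"
      by (cases rule: chain_pred_cases) (simp_all add: prev_entry_first prev_entry_step assms(1))
    then show ?thesis
      using True by (simp add: act_def)
  qed (use assms in \<open>simp add: act_def extensional_def\<close>)
qed

lemma act_act:
  assumes "finite J" "k \<in> K_seq J" "k' \<in> K_seq J"
  shows "act J (act J c k) k' = act J c (\<lambda>i\<in>J. k i ** k' i)"
proof
  fix i
  show "act J (act J c k) k' i = act J c (\<lambda>i\<in>J. k i ** k' i) i"
  proof (cases "i \<in> J")
    case True
    with assms(1) have "prev_entry J (\<lambda>i\<in>J. k i ** k' i) i = prev_entry J k i ** prev_entry J k' i"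
      by (cases rule: chain_pred_cases) (simp_all add: prev_entry_first prev_entry_step assms(1))
    then show ?thesis
      using True K_seq_invertible [OF assms(1)] assms(2,3)
      by (simp add: act_def matrix_group_simps)
  qed (simp add: act_def)
qed

lemma act_C_seq:
  assumes "finite J" "c \<in> C_seq J s" "k \<in> K_seq J"
  shows "act J c k \<in> C_seq J s"
  using assms prev_entry_K [OF assms(1,3)] K_closed(4)
  by (auto simp: act_def PiE_iff intro!: C_refl_K_right [OF C_refl_K_left])

lemma act_inv:
  assumes "finite J" "c \<in> extensional J" "k \<in> K_seq J"
  shows "act J (act J c k) (\<lambda>i\<in>J. matrix_inv (k i)) = c"
proof -
  have "(\<lambda>i\<in>J. k i ** (\<lambda>i\<in>J. matrix_inv (k i)) i) = (\<lambda>i\<in>J. mat 1)"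
    using K_seq_invertible(1) [OF assms(1,3)] by (auto simp: matrix_inv_right)
  then show ?thesis
    unfolding act_act [OF assms(1,3) K_seq_inv [OF assms(3)]]
    using act_one [OF assms(1,2)] by simp
qed

lemma cls_act:
  assumes "finite J" "k \<in> K_seq J" "c \<in> extensional J"
  shows "cls J (act J c k) = cls J c"
proof -
  have sub: "cls J (act J c k) \<subseteq> cls J c" if "k \<in> K_seq J" for c k
    using assms(1) that by (auto simp: cls_def act_act intro!: imageI K_seq_mult)
  have "cls J (act J (act J c k) (\<lambda>i\<in>J. matrix_inv (k i))) \<subseteq> cls J (act J c k)"
    using assms by (intro sub K_seq_inv)
  then show ?thesis
    using sub [OF assms(2)] act_inv [OF assms(1,3,2)] by auto
qed

lemma cls_eqD:
  assumes "finite J" "c' \<in> extensional J" "cls J c = cls J c'"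
  obtains k where "k \<in> K_seq J" "c' = act J c k"
proof -
  have "c' \<in> cls J c'"
    unfolding cls_def using act_one [OF assms(1,2)] K_seq_one by (metis imageI)
  then show thesis
    using assms that by (auto simp: cls_def)
qed

lemma topspace_C_seq [simp]: "topspace (C_seq_topology J s) = C_seq J s"
  by (simp add: C_seq_topology_def)

lemma continuous_map_C_seq_entry:
  assumes "i \<in> J"
  shows "continuous_map (C_seq_topology J s) euclidean (\<lambda>c. c i)"
  using continuous_map_product_projection [OF assms, of "\<lambda>i. top_of_set (C_refl (s i))"]
  by (auto simp: C_seq_topology_def continuous_map_in_subtopology)

lemma continuous_map_into_C_seq:
  assumes "\<And>x. x \<in> topspace T' \<Longrightarrow> f x \<in> C_seq J s"
    "\<And>i. i \<in> J \<Longrightarrow> continuous_map T' euclidean (\<lambda>x. f x i)"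
  shows "continuous_map T' (C_seq_topology J s) f"
  unfolding C_seq_topology_def continuous_map_componentwise
  using assms by (auto simp: continuous_map_in_subtopology PiE_iff)

lemma continuous_map_act:
  assumes "finite J" "\<And>i. i \<in> J \<Longrightarrow> continuous_map T' euclidean (\<lambda>x. f x i)"
    "\<And>i. i \<in> J \<Longrightarrow> continuous_map T' euclidean (\<lambda>x. k x i)"
    "\<And>x. x \<in> topspace T' \<Longrightarrow> k x \<in> K_seq J" "i \<in> J"
  shows "continuous_map T' euclidean (\<lambda>x. act J (f x) (k x) i)"
proof -
  have "continuous_map T' euclidean (\<lambda>x. prev_entry J (k x) i)"
    using assms(1,5)
    by (cases rule: chain_pred_cases) (auto simp: prev_entry_first prev_entry_step assms(1) intro: assms(3))
  then have "continuous_map T' euclidean (\<lambda>x. matrix_inv (prev_entry J (k x) i) ** f x i ** k x i)"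
    using assms K_seq_invertible(2) [OF assms(1)]
    by (intro continuous_map_matrix_mult continuous_map_matrix_inv) auto
  then show ?thesis
    using assms(5) by (simp add: act_def)
qed

text \<open>The saturation of an open set \<open>U\<close> is a union over \<open>k\<close> of the
  sets where \<open>act J c k\<close> lies in \<open>U\<close>, each of them open by
  continuity.\<close>

lemma open_map_cls:
  fixes J :: "'i::linorder set"
  assumes "finite J"
  shows "open_map (C_seq_topology J s) (BS J s) (cls J)"
  unfolding open_map_def
proof (intro allI impI)
  fix U assume U: "openin (C_seq_topology J s) U"
  then have UC: "U \<subseteq> C_seq J s"
    using openin_subset by fastforce
  have "{c \<in> C_seq J s. cls J c \<in> cls J ` U} =
      (\<Union>k\<in>K_seq J. {c \<in> topspace (C_seq_topology J s). act J c k \<in> U})"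
  proof (intro equalityI subsetI)
    fix c assume "c \<in> {c \<in> C_seq J s. cls J c \<in> cls J ` U}"
    then obtain u where u: "c \<in> C_seq J s" "u \<in> U" "cls J c = cls J u"
      by auto
    moreover from this UC have "u \<in> extensional J"
      by (auto simp: PiE_def)
    ultimately obtain k where "k \<in> K_seq J" "u = act J c k"
      using cls_eqD assms by metis
    then show "c \<in> (\<Union>k\<in>K_seq J. {c \<in> topspace (C_seq_topology J s). act J c k \<in> U})"
      using u by auto
  next
    fix c assume "c \<in> (\<Union>k\<in>K_seq J. {c \<in> topspace (C_seq_topology J s). act J c k \<in> U})"
    then obtain k where k: "k \<in> K_seq J" "c \<in> C_seq J s" "act J c k \<in> U"
      by auto
    then have "cls J c = cls J (act J c k)"
      using cls_act assms by (metis PiE_iff)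
    then show "c \<in> {c \<in> C_seq J s. cls J c \<in> cls J ` U}"
      using k by auto
  qed
  moreover have "openin (C_seq_topology J s) {c \<in> topspace (C_seq_topology J s). act J c k \<in> U}"
    if k: "k \<in> K_seq J" for k
  proof (rule openin_continuous_map_preimage [OF _ U])
    show "continuous_map (C_seq_topology J s) (C_seq_topology J s) (\<lambda>c. act J c k)"
      using assms k act_C_seq [OF assms _ k]
      by (intro continuous_map_into_C_seq) (simp_all add: continuous_map_act continuous_map_C_seq_entry)
  qed
  ultimately have "openin (C_seq_topology J s) {c \<in> C_seq J s. cls J c \<in> cls J ` U}"
    by auto
  then show "openin (BS J s) (cls J ` U)"
    using UC by (auto simp: BS_def openin_quotient_topology)
qed

lemma continuous_map_cls: "continuous_map (C_seq_topology J s) (BS J s) (cls J)"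
  unfolding BS_def by (intro quotient_imp_continuous_map quotient_map_quotient_topology)

lemma topspace_BS [simp]: "topspace (BS J s) = cls J ` C_seq J s"
proof -
  have "cls J ` topspace (C_seq_topology J s) = topspace (quotient_topology (C_seq_topology J s) (cls J))"
    by (rule quotient_imp_surjective_map [OF quotient_map_quotient_topology])
  then show ?thesis
    by (simp add: BS_def)
qed

text \<open>A saturated set is the full preimage of its image, and open maps restrict to full
  preimages. Hence on the image the subspace topology is the quotient topology coming from
  \<open>A\<close>.\<close>

lemma quotient_map_cls_saturated:
  fixes J :: "'i::linorder set"
  assumes "finite J" "A \<subseteq> C_seq J s" "\<And>c k. c \<in> A \<Longrightarrow> k \<in> K_seq J \<Longrightarrow> act J c k \<in> A"
  shows "open_map (subtopology (C_seq_topology J s) A) (subtopology (BS J s) (cls J ` A)) (cls J)"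
    "continuous_map (subtopology (C_seq_topology J s) A) (subtopology (BS J s) (cls J ` A)) (cls J)"
    "cls J ` topspace (subtopology (C_seq_topology J s) A) = topspace (subtopology (BS J s) (cls J ` A))"
proof -
  have "{c \<in> topspace (C_seq_topology J s). cls J c \<in> cls J ` A} = A"
  proof (intro equalityI subsetI)
    fix c assume "c \<in> {c \<in> topspace (C_seq_topology J s). cls J c \<in> cls J ` A}"
    then obtain a where a: "c \<in> C_seq J s" "a \<in> A" "cls J a = cls J c"
      by auto
    moreover from a(1) have "c \<in> extensional J"
      by (auto simp: PiE_def)
    ultimately obtain k where "k \<in> K_seq J" "c = act J a k"
      using cls_eqD assms(1) by metis
    then show "c \<in> A"
      using assms(3) a by auto
  qed (use assms(2) in auto)
  then show "open_map (subtopology (C_seq_topology J s) A) (subtopology (BS J s) (cls J ` A)) (cls J)"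
    by (rule open_map_restriction [OF open_map_cls [OF assms(1)]])
  show "continuous_map (subtopology (C_seq_topology J s) A) (subtopology (BS J s) (cls J ` A)) (cls J)"
    using continuous_map_from_subtopology [OF continuous_map_cls]
    by (auto simp: continuous_map_in_subtopology)
  show "cls J ` topspace (subtopology (C_seq_topology J s) A) = topspace (subtopology (BS J s) (cls J ` A))"
    using assms(2) by auto
qed

lemma rep_coset_K:
  assumes "w \<in> W" "x \<in> rep w <#\<^bsub>N\<^esub> K" "k \<in> K" "k' \<in> K"
  shows "k ** x ** k' \<in> rep w <#\<^bsub>N\<^esub> K"
proof -
  obtain l where l: "l \<in> K" "x = rep w ** l"
    using assms(2) by (auto simp: lcoset_iff)
  have "k ** x ** k' = rep w ** ((matrix_inv (rep w) ** k ** rep w) ** (l ** k'))"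
    using rep_invertible [OF assms(1)] by (simp add: l matrix_group_simps)
  then show ?thesis
    unfolding lcoset_iff using rep_K(2) [OF assms(1,3)] K_closed(2) l assms(4) by blast
qed

text \<open>By telescoping each interval product is multiplied by elements of \<open>K\<close> on
  both sides, and normality of \<open>K\<close> keeps it in its coset.\<close>

lemma C_nested_act:
  assumes "finite J" "nested_structure J R" "\<forall>r\<in>R. v r \<in> W" "c \<in> C_nested J s R v" "k \<in> K_seq J"
  shows "act J c k \<in> C_nested J s R v"
proof -
  have "seq_prod J (act J c k) r \<in> rep (v r) <#\<^bsub>N\<^esub> K" if r: "r \<in> R" for r
  proof -
    obtain a b where ab: "r = (a, b)" "a \<in> J" "b \<in> J" "a \<le> b"
      using assms(2) r unfolding nested_structure_def by (cases r) fastforce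
    have "seq_prod J (act J c k) r = matrix_inv (prev_entry J k a) ** seq_prod J c r ** k b"
      unfolding ab(1) using ab assms(1,5) K_seq_invertible by (intro seq_prod_act) auto
    then show ?thesis
      using assms(3-5) r ab(3) K_closed(4) prev_entry_K [OF assms(1,5)]
      by (auto simp: C_nested_def intro!: rep_coset_K)
  qed
  then show ?thesis
    using assms(4) act_C_seq [OF assms(1) _ assms(5)] by (simp add: C_nested_def)
qed

text \<open>
  A local gauge: acting by \<open>\<gamma> c\<close> normalises \<open>c\<close>, so that \<open>c \<mapsto> act J c (\<gamma> c)\<close> is a local section of
  the quotient map by the action.
\<close>

lemma local_gauge:
  fixes J :: "'i::linorder set"
  assumes "finite J" "c\<^sub>0 \<in> C_seq J s"
  shows "\<exists>V \<gamma>. openin (C_seq_topology J s) V \<and> c\<^sub>0 \<in> V \<and>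
    (\<forall>i\<in>J. continuous_map (subtopology (C_seq_topology J s) V) euclidean (\<lambda>c. \<gamma> c i)) \<and>
    (\<forall>c\<in>V. \<gamma> c \<in> K_seq J) \<and>
    (\<forall>c\<in>V. \<forall>k\<in>K_seq J. act J c k \<in> V \<and> (\<forall>i\<in>J. \<gamma> (act J c k) i = matrix_inv (k i) ** \<gamma> c i))"
  using assms
proof (induction J arbitrary: c\<^sub>0 rule: finite_linorder_max_induct)
  case empty
  then show ?case
    using openin_topspace [of "C_seq_topology {} s"]
    by (intro exI [of _ "C_seq {} s"] exI [of _ "\<lambda>c. c"]) (auto simp: act_def)
next
  case (insert m J)
  let ?J = "insert m J" and ?\<rho> = "\<lambda>c. restrict c J"
  let ?T = "C_seq_topology ?J s"
  have mJ: "m \<notin> J"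
    using insert.hyps by auto
  have \<rho>: "?\<rho> c \<in> C_seq J s" if "c \<in> C_seq ?J s" for c
    using that by (auto simp: PiE_iff)
  obtain V' \<gamma>' where V': "openin (C_seq_topology J s) V'" "?\<rho> c\<^sub>0 \<in> V'"
    "\<And>i. i \<in> J \<Longrightarrow> continuous_map (subtopology (C_seq_topology J s) V') euclidean (\<lambda>c. \<gamma>' c i)"
    "\<And>c. c \<in> V' \<Longrightarrow> \<gamma>' c \<in> K_seq J"
    "\<And>c k. c \<in> V' \<Longrightarrow> k \<in> K_seq J \<Longrightarrow> act J c k \<in> V'"
    "\<And>c k i. c \<in> V' \<Longrightarrow> k \<in> K_seq J \<Longrightarrow> i \<in> J \<Longrightarrow> \<gamma>' (act J c k) i = matrix_inv (k i) ** \<gamma>' c i"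
    using insert.IH [OF \<rho> [OF insert.prems]] by metis
  \<comment> \<open>As \<open>m\<close> is the largest index, no entry refers back to it.\<close>
  have prev: "prev_entry ?J k i = prev_entry J k i" if "i \<in> ?J" for k :: "'i \<Rightarrow> complex^'n^'n" and i
  proof -
    have "{j \<in> ?J. j < i} = {j \<in> J. j < i}"
      using insert.hyps(2) that by auto
    then show ?thesis
      by (simp only: prev_entry_def)
  qed
  have prev': "prev_entry J (restrict k J) i = prev_entry J k i" if "i \<in> ?J" for k :: "'i \<Rightarrow> complex^'n^'n" and i
    using insert.hyps(1) by (intro prev_entry_cong) auto
  \<comment> \<open>\<open>x c\<close> is the last entry after the shorter gauge has acted on its
    left. The action of \<open>k\<close> then changes it only by \<open>k m\<close> on the right,
    which is the situation of \<open>C_refl_slice\<close>.\<close>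
  define g where "g c = prev_entry J (\<gamma>' (?\<rho> c)) m" for c
  define x where "x c = matrix_inv (g c) ** c m" for c
  have g: "g c \<in> K" if "?\<rho> c \<in> V'" for c
    unfolding g_def by (rule prev_entry_K [OF insert.hyps(1) V'(4) [OF that]])
  have x: "x c \<in> C_refl (s m)" if "?\<rho> c \<in> V'" "c \<in> C_seq ?J s" for c
    using g [OF that(1)] that(2) K_closed(4) by (auto simp: x_def PiE_iff intro!: C_refl_K_left)
  obtain Vm \<kappa> where Vm: "openin (top_of_set (C_refl (s m))) Vm" "x c\<^sub>0 \<in> Vm" "continuous_on Vm \<kappa>"
    "\<And>c. c \<in> Vm \<Longrightarrow> \<kappa> c \<in> K"
    "\<And>c k. c \<in> Vm \<Longrightarrow> k \<in> K \<Longrightarrow> c ** k \<in> Vm \<and> \<kappa> (c ** k) = \<kappa> c ** k"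
    using C_refl_slice [OF x [OF V'(2) insert.prems]] by metis
  define V1 where "V1 = {c \<in> topspace ?T. ?\<rho> c \<in> V'}"
  define V where "V = {c \<in> V1. x c \<in> Vm}"
  \<comment> \<open>The inverse turns right equivariance of \<kappa> into the left factor
    \<open>matrix_inv (k m)\<close> demanded of \<gamma>.\<close>
  define \<gamma> where "\<gamma> c = (\<lambda>i\<in>?J. if i = m then matrix_inv (\<kappa> (x c)) else \<gamma>' (?\<rho> c) i)" for c
  have cont_\<rho>: "continuous_map ?T (C_seq_topology J s) ?\<rho>"
  proof (rule continuous_map_into_C_seq)
    fix i assume "i \<in> J"
    then show "continuous_map ?T euclidean (\<lambda>c. ?\<rho> c i)"
      by (simp add: continuous_map_C_seq_entry)
  qed (use \<rho> in auto)
  have V1: "openin ?T V1"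
    unfolding V1_def using cont_\<rho> V'(1) by (rule openin_continuous_map_preimage)
  have cont_\<rho>1: "continuous_map (subtopology ?T V1) (subtopology (C_seq_topology J s) V') ?\<rho>"
    using cont_\<rho> by (auto simp: continuous_map_in_subtopology continuous_map_from_subtopology V1_def)
  have cont_\<gamma>': "continuous_map (subtopology ?T V1) euclidean (\<lambda>c. \<gamma>' (?\<rho> c) i)" if "i \<in> J" for i
    using continuous_map_compose [OF cont_\<rho>1 V'(3) [OF that]] by (simp add: o_def)
  have cont_g: "continuous_map (subtopology ?T V1) euclidean g"
  proof (cases "{j \<in> J. j < m} = {}")
    case True
    then show ?thesis
      by (simp add: g_def [abs_def] prev_entry_def)
  next
    case False
    then have "Max {j \<in> J. j < m} \<in> {j \<in> J. j < m}"
      using insert.hyps(1) by (intro Max_in) auto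
    then show ?thesis
      using cont_\<gamma>' False by (simp add: g_def [abs_def] prev_entry_def)
  qed
  have "continuous_map (subtopology ?T V1) euclidean x"
    unfolding x_def [abs_def] using g K_closed(1)
    by (intro continuous_map_matrix_mult continuous_map_matrix_inv cont_g
        continuous_map_from_subtopology continuous_map_C_seq_entry) (auto simp: V1_def)
  then have cont_x: "continuous_map (subtopology ?T V1) (top_of_set (C_refl (s m))) x"
    using x by (auto simp: continuous_map_in_subtopology V1_def)
  have "openin (subtopology ?T V1) {c \<in> topspace (subtopology ?T V1). x c \<in> Vm}"
    using cont_x Vm(1) by (rule openin_continuous_map_preimage)
  moreover have "{c \<in> topspace (subtopology ?T V1). x c \<in> Vm} = V"
    by (auto simp: V_def V1_def)
  ultimately have V: "openin ?T V"
    using V1 openin_trans_full by auto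
  have \<gamma>K: "\<gamma> c \<in> K_seq ?J" if "c \<in> V" for c
    using that V'(4) [of "?\<rho> c"] Vm(4) K_closed(4) by (auto simp: V_def V1_def \<gamma>_def PiE_iff)
  have cont_\<gamma>: "continuous_map (subtopology ?T V) euclidean (\<lambda>c. \<gamma> c i)" if i: "i \<in> ?J" for i
  proof (cases "i = m")
    case True
    have "continuous_map (subtopology ?T V) (top_of_set Vm) x"
      using continuous_map_from_subtopology_mono [OF cont_x, of V]
      by (auto simp: continuous_map_in_subtopology V_def)
    then have "continuous_map (subtopology ?T V) euclidean (\<kappa> \<circ> x)"
      by (rule continuous_map_compose) (simp add: Vm(3))
    then have "continuous_map (subtopology ?T V) euclidean (\<lambda>c. matrix_inv (\<kappa> (x c)))"
      using Vm(4) K_closed(1) by (intro continuous_map_matrix_inv) (auto simp: o_def V_def)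
    then show ?thesis
      by (simp add: \<gamma>_def True)
  next
    case False
    then show ?thesis
      using i continuous_map_from_subtopology_mono [OF cont_\<gamma>', of i V]
      by (auto simp: \<gamma>_def V_def)
  qed
  have equi: "act ?J c k \<in> V \<and> (\<forall>i\<in>?J. \<gamma> (act ?J c k) i = matrix_inv (k i) ** \<gamma> c i)"
    if c: "c \<in> V" and k: "k \<in> K_seq ?J" for c k
  proof -
    have c': "?\<rho> c \<in> V'" "c \<in> C_seq ?J s" "x c \<in> Vm"
      using c by (auto simp: V_def V1_def)
    have k': "restrict k J \<in> K_seq J"
      using k by (auto simp: PiE_iff)
    have fin: "finite ?J"
      using insert.hyps by simp
    have \<rho>act: "?\<rho> (act ?J c k) = act J (?\<rho> c) (restrict k J)"
      using mJ by (auto simp: act_def prev prev' fun_eq_iff)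
    have km: "k m \<in> K" "invertible (k m)"
      using k K_closed(1) by auto
    have "g (act ?J c k) = matrix_inv (prev_entry J (restrict k J) m) ** g c"
    proof (cases "{j \<in> J. j < m} = {}")
      case False
      then have "Max {j \<in> J. j < m} \<in> {j \<in> J. j < m}"
        using insert.hyps(1) by (intro Max_in) auto
      then show ?thesis
        using False V'(6) [OF c'(1) k'] by (simp only: g_def \<rho>act prev_entry_def if_False) auto
    qed (simp add: g_def prev_entry_def)
    then have "x (act ?J c k) = matrix_inv (matrix_inv (prev_entry ?J k m) ** g c) **
        (matrix_inv (prev_entry ?J k m) ** c m ** k m)"
      by (simp add: x_def act_def prev prev')
    also have "\<dots> = x c ** k m"
      using K_seq_invertible(2) [OF fin k] K_closed(1) [OF g [OF c'(1)]]
      by (simp add: x_def matrix_group_simps)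
    finally have xk: "x (act ?J c k) = x c ** k m" .
    have "act ?J c k \<in> V"
      using act_C_seq [OF fin c'(2) k] V'(5) [OF c'(1) k'] Vm(5) [OF c'(3) km(1)]
      by (simp add: V_def V1_def \<rho>act xk)
    moreover have "\<gamma> (act ?J c k) i = matrix_inv (k i) ** \<gamma> c i" if "i \<in> ?J" for i
    proof (cases "i = m")
      case True
      then show ?thesis
        using Vm(5) [OF c'(3) km(1)] Vm(4) [OF c'(3)] km K_closed(1)
        by (simp add: \<gamma>_def xk matrix_inv_mult)
    next
      case False
      then show ?thesis
        using that V'(6) [OF c'(1) k', of i] by (simp add: \<gamma>_def \<rho>act)
    qed
    ultimately show ?thesis
      by blast
  qed
  have "c\<^sub>0 \<in> V"
    using insert.prems V'(2) Vm(2) by (auto simp: V_def V1_def)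
  show ?case
    by (intro exI [of _ V] exI [of _ \<gamma>] conjI ballI equi cont_\<gamma> \<gamma>K V \<open>c\<^sub>0 \<in> V\<close>)
      (simp_all add: equi)
qed

end

section \<open>Projection along nested intervals\<close>

context bott_samelson_setting
begin

lemma rep_coset_mult:
  assumes "u \<in> W" "w \<in> W" "x \<in> rep u <#\<^bsub>N\<^esub> K" "y \<in> rep w <#\<^bsub>N\<^esub> K"
  shows "x ** y \<in> rep (u \<circ> w) <#\<^bsub>N\<^esub> K"
proof -
  obtain k l where kl: "k \<in> K" "l \<in> K" "x = rep u ** k" "y = rep w ** l"
    using assms(3,4) by (auto simp: lcoset_iff)
  obtain m where m: "m \<in> K" "rep (u \<circ> w) = rep u ** rep w ** m"
    using rep_mult assms(1,2) by blast
  have "x ** y = rep (u \<circ> w) ** (matrix_inv m ** ((matrix_inv (rep w) ** k ** rep w) ** l))"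
    using rep_invertible [OF assms(2)] K_closed(1) [OF m(1)] by (simp add: kl m(2) matrix_group_simps)
  then show ?thesis
    unfolding lcoset_iff
    by (intro bexI [OF _ K_closed(2) [OF K_closed(4) [OF m(1)] K_closed(2) [OF rep_K(2) [OF assms(2) kl(1)] kl(2)]]])
qed

lemma rep_coset_inv:
  assumes "w \<in> W" "x \<in> rep w <#\<^bsub>N\<^esub> K"
  shows "matrix_inv x \<in> rep (inv_into UNIV w) <#\<^bsub>N\<^esub> K"
proof -
  let ?u = "inv_into UNIV w"
  have u: "?u \<in> W" "w \<circ> ?u = id"
    using assms(1) W_closed(3) W_bij [OF assms(1)] by (auto simp: bij_is_surj surj_iff [symmetric])
  obtain k where k: "k \<in> K" "x = rep w ** k"
    using assms(2) by (auto simp: lcoset_iff)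
  obtain m where m: "m \<in> K" "rep id = rep w ** rep ?u ** m"
    using rep_mult [OF assms(1) u(1)] u(2) by auto
  have inv: "invertible (rep w)" "invertible (rep ?u)" "invertible k" "invertible m" "invertible (rep id)"
    using rep_invertible K_closed(1) assms(1) u(1) k(1) m(1) rep_id by blast+
  have "rep w = rep id ** matrix_inv m ** matrix_inv (rep ?u)"
    using inv m(2) by (simp add: matrix_group_simps)
  then have "matrix_inv x = matrix_inv k ** (rep ?u ** (m ** matrix_inv (rep id)))"
    using inv by (simp add: k matrix_group_simps)
  moreover have "rep ?u ** (m ** matrix_inv (rep id)) \<in> rep ?u <#\<^bsub>N\<^esub> K"
    unfolding lcoset_iff using m(1) rep_id K_closed by blast
  ultimately show ?thesis
    using rep_coset_K [OF u(1), of _ "matrix_inv k" "mat 1"] k(1) K_closed(3,4) by simp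
qed

lemma rep_in_coset: "rep w \<in> rep w <#\<^bsub>N\<^esub> K"
  unfolding lcoset_iff using K_closed(3) by (intro bexI [of _ "mat 1"]) auto

lemma rep_coset_invertible: "w \<in> W \<Longrightarrow> x \<in> rep w <#\<^bsub>N\<^esub> K \<Longrightarrow> invertible x"
  using rep_invertible K_closed(1) by (auto simp: lcoset_iff intro: invertible_mult)

text \<open>Normality moves \<open>k\<close> past the representative. This is what places the gauge
  elements below in \<open>K\<close>.\<close>

lemma rep_coset_quotient:
  assumes "w \<in> W" "x \<in> rep w <#\<^bsub>N\<^esub> K" "y \<in> rep w <#\<^bsub>N\<^esub> K" "k \<in> K"
  shows "matrix_inv x ** k ** y \<in> K"
proof -
  obtain a b where ab: "a \<in> K" "b \<in> K" "x = rep w ** a" "y = rep w ** b"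
    using assms(2,3) by (auto simp: lcoset_iff)
  have "matrix_inv x ** k ** y = matrix_inv a ** (matrix_inv (rep w) ** k ** rep w) ** b"
    using rep_invertible [OF assms(1)] K_closed(1) [OF ab(1)] by (simp add: ab matrix_group_simps)
  then show ?thesis
    using rep_K(2) [OF assms(1,4)] K_closed(2,4) ab by metis
qed

lemma mprod_rep_coset:
  assumes "\<And>f. f \<in> set fs \<Longrightarrow> v f \<in> W" "\<And>f. f \<in> set fs \<Longrightarrow> a f \<in> rep (v f) <#\<^bsub>N\<^esub> K"
  shows "foldr (\<circ>) (map v fs) id \<in> W \<and> mprod (map a fs) \<in> rep (foldr (\<circ>) (map v fs) id) <#\<^bsub>N\<^esub> K"
  using assms
proof (induction fs)
  case Nil
  have "mat 1 = rep id ** matrix_inv (rep id)"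
    using K_closed(1) [OF rep_id] by (simp add: matrix_inv_right)
  then have "mat 1 \<in> rep id <#\<^bsub>N\<^esub> K"
    unfolding lcoset_iff using K_closed(4) [OF rep_id] by blast
  moreover have "foldr (\<circ>) (map v []) id = id" "mprod (map a []) = mat 1"
    by (simp_all add: fun_eq_iff)
  ultimately show ?case
    using W_closed(1) by metis
next
  case (Cons f fs)
  have "foldr (\<circ>) (map v fs) id \<in> W \<and> mprod (map a fs) \<in> rep (foldr (\<circ>) (map v fs) id) <#\<^bsub>N\<^esub> K"
    by (rule Cons.IH) (use Cons.prems in auto)
  then have IH: "foldr (\<circ>) (map v fs) id \<in> W" "mprod (map a fs) \<in> rep (foldr (\<circ>) (map v fs) id) <#\<^bsub>N\<^esub> K"
    by blast+
  have "v f \<in> W" "a f \<in> rep (v f) <#\<^bsub>N\<^esub> K"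
    using Cons.prems by simp_all
  moreover have "foldr (\<circ>) (map v (f # fs)) id = v f \<circ> foldr (\<circ>) (map v fs) id"
    "mprod (map a (f # fs)) = a f ** mprod (map a fs)"
    by simp_all
  ultimately show ?case
    using rep_coset_mult [OF _ IH(1) _ IH(2)] W_closed(2) [OF _ IH(1)] by metis
qed

text \<open>From left to right: once all earlier entries of \<open>k\<close> are 1, the equation at
  \<open>b\<close> reads \<open>x b ** k b = x b\<close>.\<close>

lemma act_free:
  assumes "finite J" "\<And>i. i \<in> J \<Longrightarrow> invertible (x i)" "k \<in> K_seq J" "act J x k = x" "i \<in> J"
  shows "k i = mat 1"
  using assms(1,5)
proof (induction rule: finite_chain_induct)
  case (less b)
  have "prev_entry J k b = prev_entry J (\<lambda>_. mat 1) b"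
    using assms(1) less.IH by (intro prev_entry_cong) auto
  also have "\<dots> = mat 1"
    by (simp add: prev_entry_def)
  finally have "x b ** k b = x b ** mat 1"
    using fun_cong [OF assms(4), of b] less.hyps by (simp add: act_def)
  then show ?case
    using matrix_left_cancel assms(2) less.hyps by blast
qed

end

locale nested_projection = bott_samelson_setting \<Phi> X \<sigma> \<phi> rep
  for \<Phi> :: "'e::euclidean_space set" and X :: "'e \<Rightarrow> complex^'n^'n" and \<sigma> \<phi> rep +
  fixes I :: "'i::linorder set" and s :: "'i \<Rightarrow> 'e \<Rightarrow> 'e" and R :: "('i \<times> 'i) set"
    and v :: "'i \<times> 'i \<Rightarrow> 'e \<Rightarrow> 'e" and fs :: "('i \<times> 'i) list"
  assumes finite_I: "finite I"
    and nested: "nested_structure I R"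
    and v_W: "r \<in> R \<Longrightarrow> v r \<in> W"
    and fs_R: "set fs \<subseteq> R"
    and fs_sorted: "sorted_wrt (\<lambda>f f'. snd f < fst f') fs"
begin

section \<open>Blocks, the remaining indices and boundary positions\<close>

abbreviation J :: "'i set" where "J \<equiv> index_proj I fs"
abbreviation RF :: "('i \<times> 'i) set" where "RF \<equiv> nested_proj I R fs"
abbreviation sF :: "'i \<Rightarrow> 'e \<Rightarrow> 'e" where "sF \<equiv> s_proj fs v s"
abbreviation vF :: "'i \<times> 'i \<Rightarrow> 'e \<Rightarrow> 'e" where "vF \<equiv> v_proj fs v"

lemma R_I: "r \<in> R \<Longrightarrow> fst r \<in> I \<and> snd r \<in> I \<and> fst r \<le> snd r"
  using nested unfolding nested_structure_def by auto

lemma block_I: "f \<in> set fs \<Longrightarrow> fst f \<in> I \<and> snd f \<in> I \<and> fst f \<le> snd f"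
  using fs_R R_I by blast

lemma block_ends: "f \<in> set fs \<Longrightarrow> fst f \<in> ivl I f \<and> snd f \<in> ivl I f"
  using block_I by (auto simp: ivl_def)

lemma J_I: "J \<subseteq> I" and finite_J: "finite J"
  using finite_I by (auto simp: index_proj_def)

lemma fs_nth_less: "i < j \<Longrightarrow> j < length fs \<Longrightarrow> snd (fs ! i) < fst (fs ! j)"
  using sorted_wrt_nth_less [OF fs_sorted] .

lemma block_unique_index:
  assumes "i < length fs" "j < length fs" "x \<in> ivl I (fs ! i)" "x \<in> ivl I (fs ! j)"
  shows "i = j"
proof (rule ccontr)
  assume "i \<noteq> j"
  then consider "i < j" | "j < i"
    by linarith
  then show False
    using fs_nth_less [of i j] fs_nth_less [of j i] assms by cases (auto simp: ivl_def)
qed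

lemma block_unique:
  assumes "f \<in> set fs" "f' \<in> set fs" "x \<in> ivl I f" "x \<in> ivl I f'"
  shows "f = f'"
  using assms block_unique_index by (metis in_set_conv_nth)

lemma J_not_block: "i \<in> J \<Longrightarrow> f \<in> set fs \<Longrightarrow> i \<notin> ivl I f"
  by (auto simp: index_proj_def)

lemma J_or_block: "i \<in> I \<Longrightarrow> i \<notin> J \<Longrightarrow> \<exists>f\<in>set fs. i \<in> ivl I f"
  by (auto simp: index_proj_def)

text \<open>All indices except the non-final ones of blocks. At these positions the action on
  balanced sequences is governed by \<open>K(J)\<close>; the predecessor of an index of
  \<open>J\<close> or of a left end of a block is always among them.\<close>

definition boundary :: "'i set" where
  "boundary = J \<union> snd ` set fs"

lemma boundary_I: "boundary \<subseteq> I"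
  using J_I block_I by (auto simp: boundary_def)

lemma pred_boundary:
  assumes "p \<in> I" "p < b" "{j \<in> I. j < b} = {j \<in> I. j \<le> p}" "b \<in> J \<or> b \<in> fst ` set fs"
  shows "p \<in> boundary"
proof (cases "p \<in> J")
  case False
  then obtain f where f: "f \<in> set fs" "p \<in> ivl I f"
    using J_or_block assms(1) by blast
  have b: "b \<in> I"
    using assms(4) J_I block_I by auto
  \<comment> \<open>A left end has no predecessor within its own block. So the block of
    \<open>p\<close> ends before \<open>b\<close>, and therefore at \<open>p\<close>.\<close>
  have "b \<notin> ivl I f"
  proof
    assume bf: "b \<in> ivl I f"
    then obtain f' where f': "f' \<in> set fs" "b = fst f'"
      using assms(4) J_not_block f(1) by blast
    then have "f' = f"
      using block_unique f(1) bf block_ends by blast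
    then show False
      using f f' assms(2) by (auto simp: ivl_def)
  qed
  then have "snd f < b"
    using f(2) assms(2) b by (auto simp: ivl_def)
  then have "snd f \<in> {j \<in> I. j \<le> p}"
    unfolding assms(3) [symmetric] using block_I f(1) by simp
  then have "p = snd f"
    using f(2) by (auto simp: ivl_def)
  then show ?thesis
    using f(1) by (simp add: boundary_def)
qed (simp add: boundary_def)

subsection \<open>Products over the blocks to the left of an index\<close>

definition before_prod :: "('i \<times> 'i \<Rightarrow> complex^'n^'n) \<Rightarrow> 'i \<Rightarrow> complex^'n^'n" where
  "before_prod a i = mprod (map a (before fs i))"

text \<open>Differs from \<open>before_prod\<close> by including a block that ends at
  \<open>i\<close>; its value at \<open>i\<close> is thus \<open>before_prod\<close> at the
  successor of \<open>i\<close>. Both are applied to the actual block products and to their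
  representatives.\<close>

definition through_prod :: "('i \<times> 'i \<Rightarrow> complex^'n^'n) \<Rightarrow> 'i \<Rightarrow> complex^'n^'n" where
  "through_prod a i = mprod (map a (takeWhile (\<lambda>f. snd f \<le> i) fs))"

abbreviation rep_v :: "'i \<times> 'i \<Rightarrow> complex^'n^'n" where "rep_v \<equiv> \<lambda>f. rep (v f)"

lemma rep_upto_before_prod: "rep_upto fs v i = before_prod rep_v i"
  by (simp add: rep_upto_def before_prod_def)

lemma through_prod_J:
  assumes "i \<in> J"
  shows "through_prod a i = before_prod a i"
proof -
  have "snd f \<noteq> i" if "f \<in> set fs" for f
    using J_not_block [OF assms that] block_ends [OF that] by blast
  then show ?thesis
    unfolding through_prod_def before_prod_def before_def
    by (intro arg_cong [where f = "\<lambda>xs. mprod (map a xs)"] takeWhile_cong) (auto simp: le_less)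
qed

lemma before_prod_pred:
  assumes "{j \<in> I. j < b} = {j \<in> I. j \<le> p}"
  shows "before_prod a b = through_prod a p"
proof -
  have "snd f < b \<longleftrightarrow> snd f \<le> p" if "f \<in> set fs" for f
    using assms block_I [OF that] by blast
  then show ?thesis
    unfolding through_prod_def before_prod_def before_def
    by (intro arg_cong [where f = "\<lambda>xs. mprod (map a xs)"] takeWhile_cong) auto
qed

lemma before_prod_first:
  assumes "{j \<in> I. j < b} = {}"
  shows "before_prod a b = mat 1"
proof -
  have "\<not> snd f < b" if "f \<in> set fs" for f
    using assms block_I [OF that] by blast
  then have "before fs b = []"
    unfolding before_def by (cases fs) auto
  then show ?thesis
    by (simp add: before_prod_def)
qed

lemma through_prod_block:
  assumes "f \<in> set fs"
  shows "through_prod a (snd f) = before_prod a (fst f) ** a f"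
proof -
  obtain xs ys where fs: "fs = xs @ f # ys"
    using assms by (auto simp: in_set_conv_decomp)
  have xs: "snd x < fst f" if "x \<in> set xs" for x
    using fs_sorted that by (auto simp: fs sorted_wrt_append)
  have ys: "snd f < snd y" if "y \<in> set ys" for y
  proof -
    have "snd f < fst y"
      using fs_sorted that by (auto simp: fs sorted_wrt_append)
    then show ?thesis
      using block_I [of y] that fs by auto
  qed
  have f: "fst f \<le> snd f"
    using block_I assms by blast
  have "takeWhile (\<lambda>y. snd y \<le> snd f) ys = []"
  proof (cases ys)
    case (Cons y zs)
    then show ?thesis
      using ys [of y] by simp
  qed simp
  moreover have "\<forall>x\<in>set xs. snd x \<le> snd f"
    using xs f by force
  ultimately have "takeWhile (\<lambda>y. snd y \<le> snd f) fs = xs @ [f]"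
    by (simp add: fs)
  moreover have "before fs (fst f) = xs"
    using xs f by (simp add: before_def fs)
  ultimately show ?thesis
    by (simp add: through_prod_def before_prod_def mprod_append)
qed

lemma partial_prod_coset:
  assumes "\<And>f. f \<in> set fs \<Longrightarrow> a f \<in> rep (v f) <#\<^bsub>N\<^esub> K"
  shows "v_upto fs v i \<in> W" "before_prod a i \<in> rep (v_upto fs v i) <#\<^bsub>N\<^esub> K"
    "\<exists>w\<in>W. through_prod a i \<in> rep w <#\<^bsub>N\<^esub> K \<and> through_prod rep_v i \<in> rep w <#\<^bsub>N\<^esub> K"
proof -
  have *: "foldr (\<circ>) (map v xs) id \<in> W \<and> mprod (map b xs) \<in> rep (foldr (\<circ>) (map v xs) id) <#\<^bsub>N\<^esub> K"
    if "set xs \<subseteq> set fs" "\<And>f. f \<in> set fs \<Longrightarrow> b f \<in> rep (v f) <#\<^bsub>N\<^esub> K" for xs b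
    using that fs_R v_W by (intro mprod_rep_coset) auto
  have "set (before fs i) \<subseteq> set fs" "set (takeWhile (\<lambda>f. snd f \<le> i) fs) \<subseteq> set fs"
    by (auto simp: before_def dest: set_takeWhileD)
  then show "v_upto fs v i \<in> W" "before_prod a i \<in> rep (v_upto fs v i) <#\<^bsub>N\<^esub> K"
    "\<exists>w\<in>W. through_prod a i \<in> rep w <#\<^bsub>N\<^esub> K \<and> through_prod rep_v i \<in> rep w <#\<^bsub>N\<^esub> K"
    using * [of "before fs i" a] * [of "takeWhile (\<lambda>f. snd f \<le> i) fs" a]
      * [of "takeWhile (\<lambda>f. snd f \<le> i) fs" rep_v] assms rep_in_coset
    by (auto simp: v_upto_def before_prod_def through_prod_def)
qed

lemma v_upto_W: "v_upto fs v i \<in> W"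
  and before_rep_coset: "before_prod rep_v i \<in> rep (v_upto fs v i) <#\<^bsub>N\<^esub> K"
  using partial_prod_coset(1,2) [of rep_v i, OF rep_in_coset] .

lemma partial_prod_invertible:
  assumes "\<And>f. f \<in> set fs \<Longrightarrow> invertible (a f)"
  shows "invertible (before_prod a i)" "invertible (through_prod a i)"
  unfolding before_prod_def through_prod_def before_def
  by (rule mprod_invertible, use assms in \<open>auto dest: set_takeWhileD\<close>)+

lemma rep_v_invertible: "f \<in> set fs \<Longrightarrow> invertible (rep (v f))"
  using rep_invertible v_W fs_R by blast

lemma partial_rep_invertible: "invertible (before_prod rep_v i)" "invertible (through_prod rep_v i)"
  by (rule partial_prod_invertible, erule rep_v_invertible)+

text \<open>Extends an element of \<open>K(J)\<close> over the blocks by the value at the last index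
  of \<open>J\<close> so far, and by 1 before the first one.\<close>

definition cur_entry :: "('i \<Rightarrow> complex^'n^'n) \<Rightarrow> 'i \<Rightarrow> complex^'n^'n" where
  "cur_entry k i = (if {j \<in> J. j \<le> i} = {} then mat 1 else k (Max {j \<in> J. j \<le> i}))"

lemma cur_entry_J: "i \<in> J \<Longrightarrow> cur_entry k i = k i"
  using Max_chain_le [OF finite_J] by (auto simp: cur_entry_def)

lemma cur_entry_pred:
  assumes "{j \<in> I. j < b} = {j \<in> I. j \<le> p}"
  shows "cur_entry k p = prev_entry J k b"
proof -
  have "{j \<in> J. j < b} = {j \<in> J. j \<le> p}"
    using assms J_I by blast
  then show ?thesis
    by (simp only: cur_entry_def prev_entry_def)
qed

lemma cur_entry_block:
  assumes "f \<in> set fs"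
  shows "cur_entry k (snd f) = prev_entry J k (fst f)"
proof -
  have "j \<le> snd f \<longleftrightarrow> j < fst f" if "j \<in> J" for j
    using J_not_block [OF that assms] that J_I block_I [OF assms] by (auto simp: ivl_def)
  then have "{j \<in> J. j < fst f} = {j \<in> J. j \<le> snd f}"
    by blast
  then show ?thesis
    by (simp only: cur_entry_def prev_entry_def)
qed

lemma cur_entry_K:
  assumes "k \<in> K_seq J"
  shows "cur_entry k i \<in> K"
proof (cases "{j \<in> J. j \<le> i} = {}")
  case False
  then have "Max {j \<in> J. j \<le> i} \<in> {j \<in> J. j \<le> i}"
    using finite_J by (intro Max_in) auto
  then show ?thesis
    using assms False by (simp only: cur_entry_def if_False) (auto simp: PiE_iff)
next
  case True
  then show ?thesis
    using K_closed(3) unfolding cur_entry_def if_P [OF True] by simp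
qed

lemma prev_J_first:
  assumes "{j \<in> I. j < b} = {}"
  shows "prev_entry J k b = mat 1"
  using assms J_I by (intro prev_entry_first) blast

subsection \<open>Normalising a sequence\<close>

text \<open>
  Replacing the block products of \<open>c\<close> to the left of \<open>i\<close> by their representatives balances \<open>c\<close>;
  the middle factor makes the projected sequence change by \<open>k \<in> K(J)\<close>.
\<close>

definition gauge :: "('i \<Rightarrow> complex^'n^'n) \<Rightarrow> ('i \<Rightarrow> complex^'n^'n) \<Rightarrow> 'i \<Rightarrow> complex^'n^'n" where
  "gauge c k = (\<lambda>i\<in>I. matrix_inv (through_prod (seq_prod I c) i) ** cur_entry k i ** through_prod rep_v i)"

text \<open>Agrees with \<open>seq_proj\<close> on balanced sequences. The actual block products
  extend it to all nested sequences, continuously and with no choice of a balanced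
  representative.\<close>

definition proj_seq :: "('i \<Rightarrow> complex^'n^'n) \<Rightarrow> 'i \<Rightarrow> complex^'n^'n" where
  "proj_seq c = (\<lambda>i\<in>J. before_prod (seq_prod I c) i ** c i ** matrix_inv (before_prod (seq_prod I c) i))"

abbreviation nested_seqs :: "('i \<Rightarrow> complex^'n^'n) set" where
  "nested_seqs \<equiv> C_nested I s R v"

abbreviation balanced_seqs :: "('i \<Rightarrow> complex^'n^'n) set" where
  "balanced_seqs \<equiv> balanced I s R v fs"

lemma nested_entry: "c \<in> nested_seqs \<Longrightarrow> i \<in> I \<Longrightarrow> c i \<in> C_refl (s i)"
  by (auto simp: C_nested_def)

lemma nested_invertible: "c \<in> nested_seqs \<Longrightarrow> i \<in> I \<Longrightarrow> invertible (c i)"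
  using nested_entry C_refl_invertible by blast

lemma nested_block: "c \<in> nested_seqs \<Longrightarrow> f \<in> set fs \<Longrightarrow> seq_prod I c f \<in> rep (v f) <#\<^bsub>N\<^esub> K"
  using fs_R by (auto simp: C_nested_def)

lemma nested_ext: "c \<in> nested_seqs \<Longrightarrow> c \<in> extensional I"
  by (auto simp: C_nested_def PiE_def)

lemma seq_prod_invertible:
  "(\<And>i. i \<in> I \<Longrightarrow> invertible (c i)) \<Longrightarrow> invertible (seq_prod I c r)"
  unfolding seq_prod_chain_prod using finite_I by (intro chain_prod_invertible) (auto simp: ivl_def)

lemma partial_seq_invertible:
  assumes "\<And>i. i \<in> I \<Longrightarrow> invertible (c i)"
  shows "invertible (before_prod (seq_prod I c) i)" "invertible (through_prod (seq_prod I c) i)"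
  using partial_prod_invertible seq_prod_invertible assms by blast+

text \<open>The two through products lie in the same coset of \<open>K\<close>.\<close>

lemma gauge_K:
  assumes "c \<in> nested_seqs" "k \<in> K_seq J"
  shows "gauge c k \<in> K_seq I"
proof -
  have "matrix_inv (through_prod (seq_prod I c) i) ** cur_entry k i ** through_prod rep_v i \<in> K" for i
    using partial_prod_coset(3) [of "seq_prod I c" i] nested_block [OF assms(1)] rep_coset_quotient
      cur_entry_K [OF assms(2)] by blast
  then show ?thesis
    by (auto simp: gauge_def)
qed

lemma prev_gauge:
  assumes "b \<in> I"
  shows "prev_entry I (gauge c k) b = matrix_inv (before_prod (seq_prod I c) b) ** prev_entry J k b ** before_prod rep_v b"
  using finite_I assms
proof (cases rule: chain_pred_cases)
  case first
  then show ?thesis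
    by (simp add: prev_entry_first before_prod_first prev_J_first)
next
  case (step p)
  then show ?thesis
    by (simp add: prev_entry_step [OF finite_I step(1,3)] before_prod_pred [OF step(3)] gauge_def
        flip: cur_entry_pred [OF step(3)])
qed

lemma normalise_nested:
  assumes "c \<in> nested_seqs" "k \<in> K_seq J"
  shows "act I c (gauge c k) \<in> nested_seqs"
  using C_nested_act [OF finite_I nested _ assms(1) gauge_K [OF assms]] v_W by blast

text \<open>A block product changes by the gauge entries before and at the end of the block. The
  actual product occurs inverted in the latter and cancels, leaving the representative.\<close>

lemma normalise_balanced:
  assumes "c \<in> nested_seqs" "k \<in> K_seq J"
  shows "act I c (gauge c k) \<in> balanced_seqs"
proof -
  have "seq_prod I (act I c (gauge c k)) f = rep (v f)" if f: "f \<in> set fs" for f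
  proof -
    have fI: "fst f \<in> I" "snd f \<in> I" "fst f \<le> snd f"
      using block_I [OF f] by auto
    have inv: "\<And>i. i \<in> I \<Longrightarrow> invertible (gauge c k i)"
      using gauge_K [OF assms] K_closed(1) by auto
    have inv': "invertible (before_prod (seq_prod I c) (fst f))" "invertible (before_prod rep_v (fst f))"
      "invertible (seq_prod I c f)" "invertible (prev_entry J k (fst f))"
      using assms nested_invertible partial_rep_invertible K_closed(1) prev_entry_K [OF finite_J]
      by (auto intro!: partial_seq_invertible seq_prod_invertible)
    have "seq_prod I (act I c (gauge c k)) f =
        matrix_inv (prev_entry I (gauge c k) (fst f)) ** seq_prod I c f ** gauge c k (snd f)"
      using seq_prod_act [OF finite_I fI inv, where c = c] by simp
    also have "\<dots> = rep (v f)"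
      unfolding prev_gauge [OF fI(1)] using inv' fI
      by (simp add: gauge_def through_prod_block [OF f] cur_entry_block [OF f] matrix_group_simps)
    finally show ?thesis .
  qed
  then show ?thesis
    using normalise_nested [OF assms] by (simp add: balanced_def)
qed

lemma proj_normalise:
  assumes "c \<in> nested_seqs" "k \<in> K_seq J"
  shows "seq_proj I v fs (act I c (gauge c k)) = act J (proj_seq c) k"
proof
  fix i
  show "seq_proj I v fs (act I c (gauge c k)) i = act J (proj_seq c) k i"
  proof (cases "i \<in> J")
    case True
    have inv: "invertible (before_prod (seq_prod I c) i)" "invertible (before_prod rep_v i)"
      "invertible (prev_entry J k i)"
      using assms nested_invertible partial_rep_invertible K_closed(1) prev_entry_K [OF finite_J]
      by (auto intro!: partial_seq_invertible)
    have "i \<in> I"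
      using True J_I by blast
    then have "act I c (gauge c k) i =
        matrix_inv (matrix_inv (before_prod (seq_prod I c) i) ** prev_entry J k i ** before_prod rep_v i) ** c i **
        (matrix_inv (before_prod (seq_prod I c) i) ** k i ** before_prod rep_v i)"
      using True by (simp add: act_def prev_gauge) (simp add: gauge_def through_prod_J cur_entry_J)
    then have "before_prod rep_v i ** act I c (gauge c k) i ** matrix_inv (before_prod rep_v i) =
        matrix_inv (prev_entry J k i) ** (before_prod (seq_prod I c) i ** c i ** matrix_inv (before_prod (seq_prod I c) i)) ** k i"
      using inv by (simp add: matrix_group_simps)
    moreover have "act J (proj_seq c) k i = matrix_inv (prev_entry J k i) **
        (before_prod (seq_prod I c) i ** c i ** matrix_inv (before_prod (seq_prod I c) i)) ** k i"
      using True by (simp add: act_def proj_seq_def)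
    moreover have "seq_proj I v fs (act I c (gauge c k)) i =
        before_prod rep_v i ** act I c (gauge c k) i ** matrix_inv (before_prod rep_v i)"
      using True by (simp add: seq_proj_def rep_upto_before_prod)
    ultimately show ?thesis
      by simp
  qed (simp_all add: seq_proj_def act_def)
qed

lemma partial_prod_balanced:
  assumes "c \<in> balanced_seqs"
  shows "before_prod (seq_prod I c) i = before_prod rep_v i" "through_prod (seq_prod I c) i = through_prod rep_v i"
  unfolding before_prod_def through_prod_def before_def
  by (rule arg_cong [where f = mprod], rule map_cong, rule refl,
      use assms in \<open>auto simp: balanced_def dest: set_takeWhileD\<close>)+

lemma proj_seq_balanced: "c \<in> balanced_seqs \<Longrightarrow> proj_seq c = seq_proj I v fs c"
  by (simp add: proj_seq_def seq_proj_def partial_prod_balanced rep_upto_before_prod)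

lemma balanced_nested: "c \<in> balanced_seqs \<Longrightarrow> c \<in> nested_seqs"
  by (simp add: balanced_def)

lemma gauge_balanced_one:
  assumes "c \<in> balanced_seqs"
  shows "gauge c (\<lambda>i\<in>J. mat 1) = (\<lambda>i\<in>I. mat 1)"
proof -
  have "cur_entry (\<lambda>i\<in>J. mat 1) i = mat 1" for i
  proof (cases "{j \<in> J. j \<le> i} = {}")
    case False
    then have "Max {j \<in> J. j \<le> i} \<in> {j \<in> J. j \<le> i}"
      using finite_J by (intro Max_in) auto
    then show ?thesis
      using False by (simp only: cur_entry_def if_False) auto
  next
    case True
    then show ?thesis
      unfolding cur_entry_def by (rule if_P)
  qed
  then show ?thesis
    using partial_rep_invertible(2) by (auto simp: gauge_def partial_prod_balanced [OF assms] matrix_inv_left)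
qed

subsection \<open>The projected nested structure\<close>

text \<open>As \<open>r\<close> is not inside the block \<open>f\<close>, an end of \<open>r\<close>
  in \<open>f\<close> would force \<open>f\<close> into \<open>r\<close>. That end would then be an
  end of \<open>f\<close>, against the disjointness of end points.\<close>

lemma projected_ends:
  assumes "r \<in> RF"
  shows "fst r \<in> J \<and> snd r \<in> J"
proof -
  have r: "r \<in> R" "\<And>f. f \<in> set fs \<Longrightarrow> \<not> ivl I r \<subseteq> ivl I f"
    using assms by (auto simp: nested_proj_def)
  have rI: "fst r \<in> ivl I r" "snd r \<in> ivl I r" "fst r \<in> I" "snd r \<in> I"
    using R_I [OF r(1)] by (auto simp: ivl_def)
  have "x \<notin> ivl I f" if f: "f \<in> set fs" and x: "x = fst r \<or> x = snd r" for f x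
  proof
    assume xf: "x \<in> ivl I f"
    have fR: "f \<in> R" "f \<noteq> r"
      using f fs_R r(2) [OF f] by auto
    have "ivl I r \<inter> ivl I f = {} \<or> ivl I r \<subseteq> ivl I f \<or> ivl I f \<subseteq> ivl I r"
      using nested r(1) fR(1) unfolding nested_structure_def by blast
    then have "ivl I f \<subseteq> ivl I r"
      using r(2) [OF f] x xf rI by blast
    then have "fst f \<in> ivl I r" "snd f \<in> ivl I r"
      using block_ends [OF f] by auto
    then have "x = fst f \<or> x = snd f"
      using x xf by (auto simp: ivl_def)
    moreover have "{fst r, snd r} \<inter> {fst f, snd f} = {}"
      using nested r(1) fR unfolding nested_structure_def by blast
    ultimately show False
      using x by auto
  qed
  then show ?thesis
    using rI by (auto simp: index_proj_def)
qed

lemma projected_R: "r \<in> RF \<Longrightarrow> r \<in> R"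
  by (simp add: nested_proj_def)

lemma nested_projected: "nested_structure J RF"
proof -
  have ivl: "ivl J r = ivl I r \<inter> J" for r
    using J_I by (auto simp: ivl_def)
  have "RF \<subseteq> J \<times> J"
    using projected_ends by (auto simp: mem_Times_iff)
  moreover have "\<forall>r\<in>RF. fst r \<le> snd r"
    using R_I projected_R by blast
  moreover have "\<forall>r\<in>RF. \<forall>r'\<in>RF. r \<noteq> r' \<longrightarrow> {fst r, snd r} \<inter> {fst r', snd r'} = {}"
    using nested projected_R unfolding nested_structure_def by blast
  moreover have "ivl J r \<inter> ivl J r' = {} \<or> ivl J r \<subseteq> ivl J r' \<or> ivl J r' \<subseteq> ivl J r"
    if "r \<in> RF" "r' \<in> RF" for r r'
  proof -
    have "ivl I r \<inter> ivl I r' = {} \<or> ivl I r \<subseteq> ivl I r' \<or> ivl I r' \<subseteq> ivl I r"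
      using nested projected_R that unfolding nested_structure_def by blast
    then show ?thesis
      unfolding ivl by blast
  qed
  ultimately show ?thesis
    unfolding nested_structure_def by blast
qed

lemma vF_W: "r \<in> RF \<Longrightarrow> vF r \<in> W"
  unfolding v_proj_def by (intro W_closed(2,3) v_upto_W v_W projected_R)

text \<open>Blocks are crossed in one step: for the right end of a block the hypothesis is available
  at boundary positions before its left end.\<close>

lemma boundary_induct [consumes 1, case_names index block]:
  assumes "b \<in> boundary"
    and index: "\<And>b. b \<in> J \<Longrightarrow> (\<And>p. p \<in> boundary \<Longrightarrow> p < b \<Longrightarrow> P p) \<Longrightarrow> P b"
    and block: "\<And>f. f \<in> set fs \<Longrightarrow> (\<And>p. p \<in> boundary \<Longrightarrow> p < fst f \<Longrightarrow> P p) \<Longrightarrow> P (snd f)"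
  shows "P b"
proof -
  have "finite boundary"
    using boundary_I finite_I finite_subset by blast
  then show ?thesis
    using assms(1)
  proof (induction rule: finite_chain_induct)
    case (less b)
    show ?case
    proof (cases "b \<in> J")
      case True
      then show ?thesis
        using index less.IH by blast
    next
      case False
      then obtain f where f: "f \<in> set fs" "b = snd f"
        using less.hyps by (auto simp: boundary_def)
      have "p < b" if "p < fst f" for p
        using that block_I [OF f(1)] f(2) by auto
      then show ?thesis
        using block [OF f(1)] less.IH f(2) by blast
    qed
  qed
qed

lemma ivl_snoc:
  assumes "p \<in> I" "p < b" "{j \<in> I. j < b} = {j \<in> I. j \<le> p}" "b \<in> S" "S \<subseteq> I" "a \<le> b"
  shows "ivl S (a, b) = insert b (ivl S (a, p))"
proof -
  have "x \<le> b \<longleftrightarrow> x = b \<or> x \<le> p" if "x \<in> S" for x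
  proof -
    have "x < b \<longleftrightarrow> x \<le> p"
      using assms(3,5) that by blast
    then show ?thesis
      by (auto simp: le_less)
  qed
  then show ?thesis
    using assms(4,6) by (auto simp: ivl_def)
qed

text \<open>Conjugating factors of neighbouring entries cancel up to the products of the blocks
  between them, which are just what \<open>c\<close> itself contributes there. Letting
  \<open>b\<close> be the end of a block, where no new entry appears on the left, makes the
  induction close.\<close>

lemma seq_prod_proj_seq:
  assumes "\<And>i. i \<in> I \<Longrightarrow> invertible (c i)" "b \<in> boundary" "a \<in> J" "a \<le> b"
  shows "seq_prod J (proj_seq c) (a, b) =
    before_prod (seq_prod I c) a ** seq_prod I c (a, b) ** matrix_inv (through_prod (seq_prod I c) b)"
  using assms(2,4)
proof (induction rule: boundary_induct)
  case (index b)
  let ?Q = "seq_prod I c"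
  have b: "b \<in> I" "a \<in> I"
    using index.hyps assms(3) J_I by auto
  show ?case
  proof (cases "a = b")
    case True
    have "ivl J (b, b) = {b}" "ivl I (b, b) = {b}"
      using b index.hyps by (auto simp: ivl_def)
    then have "seq_prod J (proj_seq c) (b, b) = before_prod (seq_prod I c) b ** c b ** matrix_inv (before_prod (seq_prod I c) b)"
      "seq_prod I c (b, b) = c b"
      using index.hyps by (simp_all only: seq_prod_chain_prod chain_prod_singleton)
        (simp add: proj_seq_def seq_prod_chain_prod [abs_def])
    then show ?thesis
      using True index.hyps by (simp only: through_prod_J)
  next
    case False
    then have ab: "a < b"
      using index.prems by simp
    show ?thesis
      using finite_I b(1)
    proof (cases rule: chain_pred_cases)
      case first
      then show ?thesis
        using ab b by blast
    next
      case (step p)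
      have ap: "a \<le> p"
        using ab b step(3) by blast
      have pB: "p \<in> boundary"
        using step index.hyps by (intro pred_boundary) auto
      have ivlJ: "ivl J (a, b) = insert b (ivl J (a, p))"
        by (rule ivl_snoc [OF step]) (use index.hyps J_I ab in auto)
      have ivlI: "ivl I (a, b) = insert b (ivl I (a, p))"
        by (rule ivl_snoc [OF step]) (use b ab in auto)
      have fin: "finite (ivl J (a, p))" "finite (ivl I (a, p))"
        "\<And>x. x \<in> ivl J (a, p) \<Longrightarrow> x < b" "\<And>x. x \<in> ivl I (a, p) \<Longrightarrow> x < b"
        using finite_J finite_I step(2) by (auto simp: ivl_def)
      have "seq_prod J (proj_seq c) (a, b) = seq_prod J (proj_seq c) (a, p) ** proj_seq c b"
        unfolding seq_prod_chain_prod ivlJ by (rule chain_prod_snoc) (use fin in auto)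
      also have "\<dots> = before_prod ?Q a ** ?Q (a, p) ** matrix_inv (through_prod ?Q p) **
          (before_prod ?Q b ** c b ** matrix_inv (through_prod ?Q b))"
      proof -
        have "proj_seq c b = before_prod ?Q b ** c b ** matrix_inv (through_prod ?Q b)"
          using index.hyps by (simp add: proj_seq_def through_prod_J)
        then show ?thesis
          using index.IH [OF pB step(2) ap] by simp
      qed
      also have "\<dots> = before_prod ?Q a ** (?Q (a, p) ** c b) ** matrix_inv (through_prod ?Q b)"
        using partial_seq_invertible [OF assms(1), where i = p] before_prod_pred [OF step(3)]
        by (simp add: matrix_group_simps)
      also have "?Q (a, p) ** c b = ?Q (a, b)"
        unfolding seq_prod_chain_prod ivlI by (rule chain_prod_snoc [symmetric]) (use fin in auto)
      finally show ?thesis .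
    qed
  qed
next
  case (block f)
  let ?Q = "seq_prod I c"
  have fI: "fst f \<in> I" "snd f \<in> I" "fst f \<le> snd f"
    using block_I [OF block.hyps] by auto
  have aI: "a \<in> I"
    using assms(3) J_I by blast
  have af: "a < fst f"
    using J_not_block [OF assms(3) block.hyps] block.prems aI by (auto simp: ivl_def)
  show ?case
    using finite_I fI(1)
  proof (cases rule: chain_pred_cases)
    case first
    then show ?thesis
      using af aI by blast
  next
    case (step p)
    have ap: "a \<le> p"
      using af aI step(3) by blast
    have pB: "p \<in> boundary"
      using step block.hyps by (intro pred_boundary) auto
    have "x \<le> snd f \<longleftrightarrow> x \<le> p" if "x \<in> J" for x
      using J_not_block [OF that block.hyps] that J_I step fI by (auto simp: ivl_def)
    then have ivlJ: "ivl J (a, snd f) = ivl J (a, p)"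
      by (auto simp: ivl_def)
    have ivlI: "ivl I (a, snd f) = ivl I (a, p) \<union> ivl I f"
    proof (intro equalityI subsetI)
      fix x assume x: "x \<in> ivl I (a, snd f)"
      then have "x < fst f \<Longrightarrow> x \<le> p"
        using step(3) by (auto simp: ivl_def)
      then show "x \<in> ivl I (a, p) \<union> ivl I f"
        using x by (auto simp: ivl_def)
    qed (use ap af fI step(2) in \<open>auto simp: ivl_def\<close>)
    have "?Q (a, snd f) = ?Q (a, p) ** ?Q f"
      unfolding seq_prod_chain_prod ivlI
      by (rule chain_prod_Un) (use finite_I step(2) in \<open>auto simp: ivl_def\<close>)
    moreover have "seq_prod J (proj_seq c) (a, snd f) =
        before_prod ?Q a ** ?Q (a, p) ** matrix_inv (through_prod ?Q p)"
    proof -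
      have "seq_prod J (proj_seq c) (a, snd f) = seq_prod J (proj_seq c) (a, p)"
        by (simp only: seq_prod_chain_prod ivlJ)
      then show ?thesis
        using block.IH [OF pB step(2) ap] by (rule trans)
    qed
    moreover have "through_prod ?Q (snd f) = through_prod ?Q p ** ?Q f"
      by (simp add: through_prod_block [OF block.hyps] before_prod_pred [OF step(3)])
    ultimately show ?thesis
      using partial_seq_invertible(2) [OF assms(1), where i = p] seq_prod_invertible [OF assms(1)]
      by (simp add: matrix_group_simps)
  qed
qed

lemma proj_seq_entry:
  assumes "c \<in> nested_seqs" "i \<in> J"
  shows "proj_seq c i \<in> C_refl (sF i)"
proof -
  obtain k where k: "k \<in> K" "before_prod (seq_prod I c) i = rep (v_upto fs v i) ** k"
    using partial_prod_coset(2) [OF nested_block [OF assms(1)]] by (auto simp: lcoset_iff)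
  have "c i \<in> C_refl (s i)"
    using assms J_I nested_entry by blast
  from C_refl_rep_conj [OF v_upto_W this k(2,1)] show ?thesis
    using assms(2) by (simp only: proj_seq_def s_proj_def restrict_apply' comp_assoc)
qed

lemma proj_seq_nested:
  assumes "c \<in> nested_seqs"
  shows "proj_seq c \<in> C_nested J sF RF vF"
proof -
  have "seq_prod J (proj_seq c) r \<in> rep (vF r) <#\<^bsub>N\<^esub> K" if r: "r \<in> RF" for r
  proof -
    have rJ: "fst r \<in> J" "snd r \<in> J" "fst r \<le> snd r" "r \<in> R"
      using projected_ends [OF r] R_I projected_R [OF r] by auto
    have "seq_prod J (proj_seq c) r = before_prod (seq_prod I c) (fst r) ** seq_prod I c r **
        matrix_inv (before_prod (seq_prod I c) (snd r))"
      using seq_prod_proj_seq [of c "snd r" "fst r"] rJ nested_invertible [OF assms]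
      by (simp add: boundary_def through_prod_J)
    moreover have "before_prod (seq_prod I c) i \<in> rep (v_upto fs v i) <#\<^bsub>N\<^esub> K" for i
      using partial_prod_coset(2) [OF nested_block [OF assms]] by blast
    moreover have "seq_prod I c r \<in> rep (v r) <#\<^bsub>N\<^esub> K"
      using assms rJ(4) by (auto simp: C_nested_def)
    ultimately show ?thesis
      unfolding v_proj_def
      using rep_coset_mult [OF W_closed(2) [OF v_upto_W v_W [OF rJ(4)]] W_closed(3) [OF v_upto_W]]
        rep_coset_mult [OF v_upto_W v_W [OF rJ(4)]] rep_coset_inv [OF v_upto_W] by metis
  qed
  moreover have "proj_seq c \<in> extensional J"
    by (simp add: proj_seq_def)
  ultimately show ?thesis
    using proj_seq_entry [OF assms] unfolding C_nested_def PiE_iff by blast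
qed

subsection \<open>Dependence on the representative\<close>

text \<open>The element of \<open>K(J)\<close> that moves the projected sequence when
  \<open>k\<close> carries one balanced sequence to another.\<close>

definition proj_gauge :: "('i \<Rightarrow> complex^'n^'n) \<Rightarrow> 'i \<Rightarrow> complex^'n^'n" where
  "proj_gauge k = (\<lambda>i\<in>J. before_prod rep_v i ** k i ** matrix_inv (before_prod rep_v i))"

lemma proj_gauge_K:
  assumes "k \<in> K_seq I"
  shows "proj_gauge k \<in> K_seq J"
proof -
  have "before_prod rep_v i ** k i ** matrix_inv (before_prod rep_v i) \<in> K" if "i \<in> J" for i
  proof -
    obtain l where l: "l \<in> K" "before_prod rep_v i = rep (v_upto fs v i) ** l"
      using before_rep_coset by (auto simp: lcoset_iff)
    have kl: "l ** k i ** matrix_inv l \<in> K" and inv: "invertible (rep (v_upto fs v i))" "invertible l"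
      using assms that J_I l(1) K_closed rep_invertible [OF v_upto_W] by (auto simp: PiE_iff)
    then show ?thesis
      using rep_K(1) [OF v_upto_W kl, of i] by (simp add: l(2) matrix_inv_mult matrix_mul_assoc)
  qed
  then show ?thesis
    by (auto simp: proj_gauge_def)
qed

text \<open>
  For balanced sequences, the entry of the acting element at the end of a block is conjugate to the
  entry just before the block. Hence the entries at boundary indices come from \<open>K(J)\<close>.
\<close>

lemma balanced_gauge_boundary:
  assumes c: "c \<in> balanced_seqs" and k: "k \<in> K_seq I" and ck: "act I c k \<in> balanced_seqs"
    and b: "b \<in> boundary"
  shows "k b = matrix_inv (through_prod rep_v b) ** cur_entry (proj_gauge k) b ** through_prod rep_v b"
  using b
proof (induction rule: boundary_induct)
  case (index b)
  then show ?case
    using partial_rep_invertible(1) [of b]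
    by (simp add: through_prod_J cur_entry_J proj_gauge_def matrix_group_simps)
next
  case (block f)
  have fI: "fst f \<in> I" "snd f \<in> I" "fst f \<le> snd f"
    using block_I [OF block.hyps] by auto
  have prev: "prev_entry I k (fst f) =
      matrix_inv (before_prod rep_v (fst f)) ** prev_entry J (proj_gauge k) (fst f) ** before_prod rep_v (fst f)"
    using finite_I fI(1)
  proof (cases rule: chain_pred_cases)
    case first
    then show ?thesis
      by (simp add: prev_entry_first prev_J_first before_prod_first)
  next
    case (step p)
    have "p \<in> boundary"
      using step block.hyps by (intro pred_boundary) auto
    from block.IH [OF this step(2)] show ?thesis
      by (simp add: prev_entry_step [OF finite_I step(1,3)] before_prod_pred [OF step(3)] cur_entry_pred [OF step(3)])
  qed
  have inv: "invertible (rep (v f))" "invertible (before_prod rep_v (fst f))" "invertible (prev_entry I k (fst f))"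
    using rep_v_invertible [OF block.hyps] partial_rep_invertible(1) K_seq_invertible(2) [OF finite_I k] by auto
  \<comment> \<open>Both sequences have block product \<open>rep (v f)\<close>, so the entry of
    \<open>k\<close> at the end of the block can be solved for.\<close>
  have "rep (v f) = matrix_inv (prev_entry I k (fst f)) ** rep (v f) ** k (snd f)"
    using seq_prod_act [OF finite_I fI, where k = k and c = c] K_seq_invertible(1) [OF finite_I k] c ck block.hyps
    by (simp add: balanced_def)
  then have "matrix_inv (rep (v f)) ** prev_entry I k (fst f) ** rep (v f) =
      matrix_inv (rep (v f)) ** prev_entry I k (fst f) **
      (matrix_inv (prev_entry I k (fst f)) ** rep (v f) ** k (snd f))"
    by simp
  also have "\<dots> = k (snd f)"
    using inv by (simp add: matrix_group_simps)
  finally show ?case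
    using inv by (simp add: prev through_prod_block [OF block.hyps] cur_entry_block [OF block.hyps] matrix_group_simps)
qed

lemma balanced_gauge_prev:
  assumes c: "c \<in> balanced_seqs" and k: "k \<in> K_seq I" and ck: "act I c k \<in> balanced_seqs"
    and b: "b \<in> J \<or> b \<in> fst ` set fs"
  shows "prev_entry I k b =
    matrix_inv (before_prod rep_v b) ** prev_entry J (proj_gauge k) b ** before_prod rep_v b"
proof -
  have "b \<in> I"
    using b J_I block_I by auto
  with finite_I show ?thesis
  proof (cases rule: chain_pred_cases)
    case first
    then show ?thesis
      by (simp add: prev_entry_first prev_J_first before_prod_first)
  next
    case (step p)
    have "p \<in> boundary"
      using step b by (intro pred_boundary) auto
    from balanced_gauge_boundary [OF c k ck this] show ?thesis
      by (simp add: prev_entry_step [OF finite_I step(1,3)] before_prod_pred [OF step(3)] cur_entry_pred [OF step(3)])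
  qed
qed

lemma proj_act_balanced:
  assumes c: "c \<in> balanced_seqs" and k: "k \<in> K_seq I" and ck: "act I c k \<in> balanced_seqs"
  shows "seq_proj I v fs (act I c k) = act J (seq_proj I v fs c) (proj_gauge k)"
proof
  fix i
  show "seq_proj I v fs (act I c k) i = act J (seq_proj I v fs c) (proj_gauge k) i"
  proof (cases "i \<in> J")
    case True
    have "i \<in> I"
      using True J_I by blast
    have inv: "invertible (before_prod rep_v i)" "invertible (prev_entry J (proj_gauge k) i)"
      using partial_rep_invertible(1) K_seq_invertible(2) [OF finite_J proj_gauge_K [OF k]] by auto
    have prev: "prev_entry I k i =
        matrix_inv (before_prod rep_v i) ** prev_entry J (proj_gauge k) i ** before_prod rep_v i"
      using balanced_gauge_prev [OF c k ck] True by blast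
    have ki: "k i = matrix_inv (before_prod rep_v i) ** proj_gauge k i ** before_prod rep_v i"
      using inv True by (simp add: proj_gauge_def matrix_group_simps)
    have "act I c k i = matrix_inv (prev_entry I k i) ** c i ** k i"
      using \<open>i \<in> I\<close> by (simp add: act_def)
    then have "before_prod rep_v i ** act I c k i ** matrix_inv (before_prod rep_v i) =
        matrix_inv (prev_entry J (proj_gauge k) i) **
        (before_prod rep_v i ** c i ** matrix_inv (before_prod rep_v i)) ** proj_gauge k i"
      unfolding prev ki using inv by (simp add: matrix_group_simps)
    then show ?thesis
      using True by (simp add: seq_proj_def rep_upto_before_prod act_def)
  qed (simp_all add: seq_proj_def act_def)
qed

definition balance :: "('i \<Rightarrow> complex^'n^'n) \<Rightarrow> 'i \<Rightarrow> complex^'n^'n" where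
  "balance c = act I c (gauge c (\<lambda>i\<in>J. mat 1))"

lemma balance:
  assumes "c \<in> nested_seqs"
  shows "balance c \<in> balanced_seqs" "cls I (balance c) = cls I c" "seq_proj I v fs (balance c) = proj_seq c"
proof -
  have "act J (proj_seq c) (\<lambda>i\<in>J. mat 1) = proj_seq c"
    by (rule act_one [OF finite_J]) (simp add: proj_seq_def)
  then show "balance c \<in> balanced_seqs" "cls I (balance c) = cls I c"
    "seq_proj I v fs (balance c) = proj_seq c"
    unfolding balance_def
    using normalise_balanced [OF assms K_seq_one] proj_normalise [OF assms K_seq_one]
      cls_act [OF finite_I gauge_K [OF assms K_seq_one] nested_ext [OF assms]] by simp_all
qed

lemma seq_proj_ext: "seq_proj I v fs c \<in> extensional J"
  by (simp add: seq_proj_def)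

lemma proj_cls_unique:
  assumes "c \<in> balanced_seqs" "c' \<in> balanced_seqs" "cls I c = cls I c'"
  shows "cls J (seq_proj I v fs c) = cls J (seq_proj I v fs c')"
proof -
  obtain k where k: "k \<in> K_seq I" "c' = act I c k"
    using cls_eqD [OF finite_I nested_ext [OF balanced_nested [OF assms(2)]] assms(3)] .
  then have "seq_proj I v fs c' = act J (seq_proj I v fs c) (proj_gauge k)"
    using proj_act_balanced assms by simp
  then show ?thesis
    using cls_act [OF finite_J proj_gauge_K [OF k(1)] seq_proj_ext] by simp
qed

lemma proj_seq_cls_cong:
  assumes "c \<in> nested_seqs" "c' \<in> nested_seqs" "cls I c = cls I c'"
  shows "cls J (proj_seq c) = cls J (proj_seq c')"
  using proj_cls_unique [of "balance c" "balance c'"] balance [OF assms(1)] balance [OF assms(2)] assms(3)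
  by simp

text \<open>Eliminates the definite description: any nested representative, balanced or not,
  computes the projection through \<open>proj_seq\<close>.\<close>

lemma proj_cls:
  assumes "c \<in> nested_seqs"
  shows "proj I s R v fs (cls I c) = cls J (proj_seq c)"
  unfolding proj_def
proof (rule the_equality)
  show "\<exists>c'\<in>balanced_seqs. cls I c = cls I c' \<and> cls J (proj_seq c) = cls J (seq_proj I v fs c')"
    using balance [OF assms] by metis
next
  fix b assume "\<exists>c'\<in>balanced_seqs. cls I c = cls I c' \<and> b = cls J (seq_proj I v fs c')"
  then obtain c' where c': "c' \<in> balanced_seqs" "cls I c = cls I c'" "b = cls J (seq_proj I v fs c')"
    by blast
  then show "b = cls J (proj_seq c)"
    using proj_cls_unique [of "balance c" c'] balance [OF assms] by simp
qed

subsection \<open>Blocks\<close>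

abbreviation blk :: "nat \<Rightarrow> 'i set" where "blk j \<equiv> ivl I (fs ! j)"
abbreviation Rb :: "nat \<Rightarrow> ('i \<times> 'i) set" where "Rb j \<equiv> subs I R (fs ! j)"

lemma finite_blk: "finite (blk j)" and blk_I: "blk j \<subseteq> I"
  using finite_I by (auto simp: ivl_def)

lemma ivl_ivl: "ivl I r \<subseteq> ivl I f \<Longrightarrow> ivl (ivl I f) r = ivl I r"
  by (auto simp: ivl_def)

lemma seq_prod_restrict:
  assumes "ivl I r \<subseteq> S" "S \<subseteq> I"
  shows "seq_prod S (restrict c S) r = seq_prod I c r"
proof -
  have "ivl S r = ivl I r"
    using assms by (auto simp: ivl_def)
  then show ?thesis
    unfolding seq_prod_chain_prod using assms finite_I by (auto intro!: chain_prod_cong simp: ivl_def)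
qed

lemma nested_blk: "nested_structure (blk j) (Rb j)"
proof -
  have ivl: "ivl (blk j) r = ivl I r" if "r \<in> Rb j" for r
    using that by (intro ivl_ivl) (simp add: subs_def)
  have "fst r \<in> blk j \<and> snd r \<in> blk j" if "r \<in> Rb j" for r
  proof -
    have "fst r \<in> ivl I r" "snd r \<in> ivl I r" "ivl I r \<subseteq> blk j"
      using that R_I [of r] by (auto simp: subs_def ivl_def)
    then show ?thesis
      by blast
  qed
  then have "Rb j \<subseteq> blk j \<times> blk j"
    by (auto simp: mem_Times_iff)
  moreover have "Rb j \<subseteq> R"
    by (auto simp: subs_def)
  then have "\<forall>r\<in>Rb j. fst r \<le> snd r"
    "\<forall>r\<in>Rb j. \<forall>r'\<in>Rb j. r \<noteq> r' \<longrightarrow> {fst r, snd r} \<inter> {fst r', snd r'} = {}"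
    "\<forall>r\<in>Rb j. \<forall>r'\<in>Rb j. ivl I r \<inter> ivl I r' = {} \<or> ivl I r \<subseteq> ivl I r' \<or> ivl I r' \<subseteq> ivl I r"
    using nested unfolding nested_structure_def by blast+
  ultimately show ?thesis
    unfolding nested_structure_def by (simp add: ivl)
qed

abbreviation block_seqs :: "nat \<Rightarrow> ('i \<Rightarrow> complex^'n^'n) set" where
  "block_seqs j \<equiv> C_nested (blk j) s (Rb j) v"

lemma restrict_block_seqs:
  assumes "c \<in> nested_seqs"
  shows "restrict c (blk j) \<in> block_seqs j"
proof -
  have "seq_prod (blk j) (restrict c (blk j)) r \<in> rep (v r) <#\<^bsub>N\<^esub> K" if "r \<in> Rb j" for r
  proof -
    have "r \<in> R" "ivl I r \<subseteq> blk j"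
      using that by (auto simp: subs_def)
    then show ?thesis
      using assms by (simp add: seq_prod_restrict [OF _ blk_I] C_nested_def)
  qed
  then show ?thesis
    using subsetD [OF blk_I] nested_entry [OF assms] by (auto simp: C_nested_def)
qed

text \<open>Taken as an index set of its own, a block has nothing before its left end, whereas
  \<open>I\<close> may have; at its other indices the predecessors agree. So the two actions agree
  when the entry before the block is 1.\<close>

lemma prev_entry_blk:
  assumes "j < length fs" "i \<in> blk j"
  shows "i = fst (fs ! j) \<Longrightarrow> prev_entry (blk j) k i = mat 1"
    and "i \<noteq> fst (fs ! j) \<Longrightarrow> \<exists>p\<in>blk j. prev_entry (blk j) k i = k p \<and> prev_entry I k i = k p"
proof -
  have iI: "i \<in> I" "fst (fs ! j) \<le> i" "i \<le> snd (fs ! j)"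
    using assms(2) by (auto simp: ivl_def)
  show "prev_entry (blk j) k i = mat 1" if "i = fst (fs ! j)"
  proof (rule prev_entry_first)
    show "{x \<in> blk j. x < i} = {}"
      using that by (auto simp: ivl_def)
  qed
  assume ne: "i \<noteq> fst (fs ! j)"
  have fI: "fst (fs ! j) \<in> I" "fst (fs ! j) < i"
    using block_I [of "fs ! j"] assms(1) ne iI by auto
  from finite_I iI(1) show "\<exists>p\<in>blk j. prev_entry (blk j) k i = k p \<and> prev_entry I k i = k p"
  proof (cases rule: chain_pred_cases)
    case first
    then show ?thesis
      using fI by blast
  next
    case (step p)
    have "fst (fs ! j) \<le> p"
      using step(3) fI by blast
    then have p: "p \<in> blk j"
      using step iI by (auto simp: ivl_def)
    have "{x \<in> blk j. x < i} = {x \<in> blk j. x \<le> p}"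
      using step(3) blk_I by blast
    then show ?thesis
      using prev_entry_step [OF finite_blk p] prev_entry_step [OF finite_I step(1,3)] p by blast
  qed
qed

lemma restrict_act_block:
  assumes "j < length fs" "prev_entry I k (fst (fs ! j)) = mat 1"
  shows "restrict (act I c k) (blk j) = act (blk j) (restrict c (blk j)) (restrict k (blk j))"
proof
  fix i
  show "restrict (act I c k) (blk j) i = act (blk j) (restrict c (blk j)) (restrict k (blk j)) i"
  proof (cases "i \<in> blk j")
    case True
    then have "prev_entry (blk j) (restrict k (blk j)) i = prev_entry (blk j) k i"
      using finite_blk by (intro prev_entry_cong) auto
    moreover have "prev_entry (blk j) k i = prev_entry I k i"
      using prev_entry_blk [OF assms(1) True, of k] assms(2) by (cases "i = fst (fs ! j)") auto
    ultimately show ?thesis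
      using True blk_I by (auto simp: act_def)
  qed (simp add: act_def)
qed

text \<open>Equal projected sequences make \<open>proj_gauge k\<close> trivial, by freeness. Hence
  \<open>k\<close> is 1 just before every block, and its restriction acts on the block
  alone.\<close>

lemma balanced_blocks_cong:
  assumes c: "c \<in> balanced_seqs" "c' \<in> balanced_seqs" "cls I c = cls I c'"
    and eq: "seq_proj I v fs c = seq_proj I v fs c'" and j: "j < length fs"
  shows "cls (blk j) (restrict c (blk j)) = cls (blk j) (restrict c' (blk j))"
proof -
  obtain k where k: "k \<in> K_seq I" "c' = act I c k"
    using cls_eqD [OF finite_I nested_ext [OF balanced_nested [OF c(2)]] c(3)] .
  have "act J (seq_proj I v fs c) (proj_gauge k) = seq_proj I v fs c"
    using proj_act_balanced [OF c(1) k(1)] c(2) k(2) eq by simp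
  moreover have "invertible (seq_proj I v fs c i)" if "i \<in> J" for i
  proof -
    have "invertible (c i)"
      using that J_I nested_invertible balanced_nested c(1) by blast
    then show ?thesis
      using that partial_rep_invertible(1) [of i]
      by (simp add: seq_proj_def rep_upto_before_prod invertible_mult)
  qed
  ultimately have one: "proj_gauge k i = mat 1" if "i \<in> J" for i
    using act_free [OF finite_J _ proj_gauge_K [OF k(1)]] that by blast
  have "prev_entry J (proj_gauge k) b = prev_entry J (\<lambda>_. mat 1) b" for b
    using one by (intro prev_entry_cong finite_J) auto
  then have "prev_entry J (proj_gauge k) b = mat 1" for b
    by (simp add: prev_entry_def)
  then have "prev_entry I k (fst (fs ! j)) = mat 1"
    using balanced_gauge_prev [OF c(1) k(1), of "fst (fs ! j)"] c(2) k(2) j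
      partial_rep_invertible(1) [of "fst (fs ! j)"] by (simp add: matrix_inv_left)
  then have "restrict c' (blk j) = act (blk j) (restrict c (blk j)) (restrict k (blk j))"
    unfolding k(2) by (rule restrict_act_block [OF j])
  moreover have "restrict k (blk j) \<in> K_seq (blk j)"
    using k(1) blk_I by (auto simp: PiE_iff)
  ultimately show ?thesis
    using cls_act [OF finite_blk] by simp
qed

subsection \<open>Gluing\<close>

definition block_index :: "'i \<Rightarrow> nat" where
  "block_index i = (SOME j. j < length fs \<and> i \<in> blk j)"

lemma block_index: "j < length fs \<Longrightarrow> i \<in> blk j \<Longrightarrow> block_index i = j"
  unfolding block_index_def by (rule some_equality) (use block_unique_index in auto)

lemma I_cases:
  assumes "i \<in> I"
  obtains (index) "i \<in> J" | (block) j where "j < length fs" "i \<in> blk j" "i \<notin> J"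
  using assms J_or_block J_not_block by (metis in_set_conv_nth)

text \<open>Acting at the last index only multiplies the block product on the right, which suffices
  to correct it to its representative.\<close>

definition balance_block :: "nat \<Rightarrow> ('i \<Rightarrow> complex^'n^'n) \<Rightarrow> 'i \<Rightarrow> complex^'n^'n" where
  "balance_block j d = act (blk j) d (\<lambda>i\<in>blk j. if i = snd (fs ! j)
     then matrix_inv (seq_prod (blk j) d (fs ! j)) ** rep (v (fs ! j)) else mat 1)"

definition balanced_block :: "nat \<Rightarrow> ('i \<Rightarrow> complex^'n^'n) set" where
  "balanced_block j = {d \<in> block_seqs j. seq_prod (blk j) d (fs ! j) = rep (v (fs ! j))}"

lemma block_in_Rb: "j < length fs \<Longrightarrow> fs ! j \<in> Rb j"
  using fs_R by (auto simp: subs_def)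

lemma block_prod_invertible:
  assumes "j < length fs" "d \<in> block_seqs j"
  shows "invertible (seq_prod (blk j) d (fs ! j))" "invertible (rep (v (fs ! j)))"
    "matrix_inv (seq_prod (blk j) d (fs ! j)) ** rep (v (fs ! j)) \<in> K"
proof -
  have v: "v (fs ! j) \<in> W"
    using nth_mem [OF assms(1)] fs_R v_W by blast
  have P: "seq_prod (blk j) d (fs ! j) \<in> rep (v (fs ! j)) <#\<^bsub>N\<^esub> K"
    using assms block_in_Rb by (auto simp: C_nested_def)
  show "invertible (seq_prod (blk j) d (fs ! j))" "invertible (rep (v (fs ! j)))"
    using rep_coset_invertible [OF v] P rep_in_coset by blast+
  show "matrix_inv (seq_prod (blk j) d (fs ! j)) ** rep (v (fs ! j)) \<in> K"
    using rep_coset_quotient [OF v P rep_in_coset K_closed(3)] by simp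
qed

lemma seq_prod_blk_act:
  assumes "j < length fs" "k \<in> K_seq (blk j)"
  shows "seq_prod (blk j) (act (blk j) d k) (fs ! j) = seq_prod (blk j) d (fs ! j) ** k (snd (fs ! j))"
proof -
  have f: "fst (fs ! j) \<in> blk j" "snd (fs ! j) \<in> blk j" "fst (fs ! j) \<le> snd (fs ! j)"
    using block_ends [of "fs ! j"] block_I [of "fs ! j"] assms(1) by auto
  then show ?thesis
    using seq_prod_act [OF finite_blk f K_seq_invertible(1) [OF finite_blk assms(2)], where c = d]
    by (simp add: prev_entry_blk(1) [OF assms(1) f(1) refl])
qed

lemma balance_block:
  assumes "j < length fs" "d \<in> block_seqs j"
  shows "balance_block j d \<in> balanced_block j" "cls (blk j) (balance_block j d) = cls (blk j) d"
proof -
  let ?k = "\<lambda>i\<in>blk j. if i = snd (fs ! j)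
     then matrix_inv (seq_prod (blk j) d (fs ! j)) ** rep (v (fs ! j)) else mat 1"
  have k: "?k \<in> K_seq (blk j)"
    using block_prod_invertible(3) [OF assms] K_closed(3) by auto
  have f: "snd (fs ! j) \<in> blk j"
    using block_ends [of "fs ! j"] assms(1) by auto
  have "seq_prod (blk j) (balance_block j d) (fs ! j) = rep (v (fs ! j))"
    using seq_prod_blk_act [OF assms(1) k, of d] f block_prod_invertible(1) [OF assms]
    by (simp add: balance_block_def matrix_inv_cancel_left)
  moreover have "balance_block j d \<in> block_seqs j"
    unfolding balance_block_def
    by (intro C_nested_act [OF finite_blk nested_blk _ assms(2) k]) (use v_W in \<open>auto simp: subs_def\<close>)
  ultimately show "balance_block j d \<in> balanced_block j"
    by (simp add: balanced_block_def)
  show "cls (blk j) (balance_block j d) = cls (blk j) d"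
    unfolding balance_block_def using assms(2)
    by (intro cls_act [OF finite_blk k]) (auto simp: C_nested_def PiE_def)
qed

lemma balance_block_balanced:
  assumes "j < length fs" "d \<in> balanced_block j"
  shows "balance_block j d = d"
proof -
  have d: "d \<in> block_seqs j" "seq_prod (blk j) d (fs ! j) = rep (v (fs ! j))"
    using assms(2) by (auto simp: balanced_block_def)
  have "(\<lambda>i\<in>blk j. if i = snd (fs ! j)
     then matrix_inv (seq_prod (blk j) d (fs ! j)) ** rep (v (fs ! j)) else mat 1) = (\<lambda>i\<in>blk j. mat 1)"
    unfolding d(2) using block_prod_invertible(2) [OF assms(1) d(1)] by (auto simp: matrix_inv_left)
  moreover have "d \<in> extensional (blk j)"
    using d(1) by (auto simp: C_nested_def PiE_def)
  ultimately show ?thesis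
    unfolding balance_block_def using act_one [OF finite_blk] by simp
qed

definition glue :: "('i \<Rightarrow> complex^'n^'n) \<Rightarrow> (nat \<Rightarrow> 'i \<Rightarrow> complex^'n^'n) \<Rightarrow> 'i \<Rightarrow> complex^'n^'n" where
  "glue x d = (\<lambda>i\<in>I. if i \<in> J then matrix_inv (before_prod rep_v i) ** x i ** before_prod rep_v i
     else d (block_index i) i)"

lemma glue_J: "i \<in> J \<Longrightarrow> glue x d i = matrix_inv (before_prod rep_v i) ** x i ** before_prod rep_v i"
  using J_I by (auto simp: glue_def)

lemma glue_block: "j < length fs \<Longrightarrow> i \<in> blk j \<Longrightarrow> glue x d i = d j i"
  using J_not_block [of i "fs ! j"] blk_I by (auto simp: glue_def block_index)

lemma restrict_glue:
  assumes "j < length fs" "d j \<in> extensional (blk j)"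
  shows "restrict (glue x d) (blk j) = d j"
  using assms glue_block [OF assms(1)] by (auto simp: fun_eq_iff extensional_def)

text \<open>An interval of \<open>R\<close> either lies in a block, where \<open>d\<close> takes
  care of its condition, or has both ends in \<open>J\<close>, where the condition on
  \<open>x\<close> is transported back by the before products.\<close>

lemma glue_balanced:
  assumes x: "x \<in> C_nested J sF RF vF" and d: "\<And>j. j < length fs \<Longrightarrow> d j \<in> balanced_block j"
  shows "glue x d \<in> balanced_seqs" "seq_proj I v fs (glue x d) = x"
proof -
  let ?c = "glue x d"
  have ext: "d j \<in> extensional (blk j)" if "j < length fs" for j
    using d [OF that] by (auto simp: balanced_block_def C_nested_def PiE_def)
  have entry: "?c i \<in> C_refl (s i)" if "i \<in> I" for i
    using that
  proof (cases rule: I_cases)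
    case index
    obtain k where k: "k \<in> K" "before_prod rep_v i = rep (v_upto fs v i) ** k"
      using before_rep_coset by (auto simp: lcoset_iff)
    have "x i \<in> C_refl (v_upto fs v i \<circ> s i \<circ> inv_into UNIV (v_upto fs v i))"
      using x index by (auto simp: C_nested_def s_proj_def [abs_def])
    from C_refl_rep_conj_inv [OF v_upto_W this k(2,1)] show ?thesis
      using index by (simp add: glue_J)
  next
    case (block j)
    then show ?thesis
      using d [OF block(1)] by (auto simp: glue_block balanced_block_def C_nested_def)
  qed
  have inner: "seq_prod I ?c r = seq_prod (blk j) (d j) r" if "j < length fs" "ivl I r \<subseteq> blk j" for j r
    using seq_prod_restrict [OF that(2) blk_I, of ?c] restrict_glue [of j d x] that(1) ext by simp
  have blocks: "seq_prod I ?c f = rep (v f)" if "f \<in> set fs" for f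
  proof -
    obtain j where j: "j < length fs" "f = fs ! j"
      using \<open>f \<in> set fs\<close> by (metis in_set_conv_nth)
    then show ?thesis
      using inner [OF j(1), of f] d [OF j(1)] by (simp add: balanced_block_def)
  qed
  have before: "before_prod (seq_prod I ?c) i = before_prod rep_v i" for i
    unfolding before_prod_def before_def
    by (rule arg_cong [where f = mprod]) (auto simp: blocks dest: set_takeWhileD)
  have "x \<in> extensional J"
    using x by (auto simp: C_nested_def PiE_def)
  have "before_prod rep_v i ** ?c i ** matrix_inv (before_prod rep_v i) = x i" if "i \<in> J" for i
    using partial_rep_invertible(1) [of i] that by (simp add: glue_J matrix_group_simps)
  then have px: "proj_seq ?c = x" and sx: "seq_proj I v fs ?c = x"
    using \<open>x \<in> extensional J\<close>
    by (auto simp: proj_seq_def seq_proj_def rep_upto_before_prod before fun_eq_iff extensional_def)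
  have "seq_prod I ?c r \<in> rep (v r) <#\<^bsub>N\<^esub> K" if r: "r \<in> R" for r
  proof (cases "r \<in> RF")
    case False
    then obtain j where j: "j < length fs" "ivl I r \<subseteq> blk j"
      using r by (auto simp: nested_proj_def in_set_conv_nth)
    then have "r \<in> Rb j"
      using r by (simp add: subs_def)
    then show ?thesis
      using inner [OF j] d [OF j(1)] by (auto simp: balanced_block_def C_nested_def)
  next
    case True
    have rJ: "fst r \<in> J" "snd r \<in> J" "fst r \<le> snd r"
      using projected_ends [OF True] R_I [OF r] by auto
    let ?a = "before_prod rep_v (fst r)" and ?b = "before_prod rep_v (snd r)"
      and ?u = "v_upto fs v (fst r)" and ?w = "v_upto fs v (snd r)"
    have inv: "invertible ?a" "invertible ?b"
      by (rule partial_rep_invertible(1))+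
    have "seq_prod J x r = ?a ** seq_prod I ?c r ** matrix_inv ?b"
      using seq_prod_proj_seq [of ?c "snd r" "fst r"] rJ entry C_refl_invertible
      by (simp add: boundary_def through_prod_J px before) blast
    then have eq: "seq_prod I ?c r = matrix_inv ?a ** seq_prod J x r ** ?b"
      using inv by (simp add: matrix_group_simps)
    have uw: "?u \<in> W" "?w \<in> W" "v r \<in> W" "inv_into UNIV ?u \<in> W" "vF r \<in> W"
      using v_upto_W v_W [OF r] W_closed(3) [OF v_upto_W] vF_W [OF True] by auto
    have "matrix_inv ?a \<in> rep (inv_into UNIV ?u) <#\<^bsub>N\<^esub> K" "?b \<in> rep ?w <#\<^bsub>N\<^esub> K"
      "seq_prod J x r \<in> rep (vF r) <#\<^bsub>N\<^esub> K"
      using rep_coset_inv [OF v_upto_W before_rep_coset] before_rep_coset x True by (auto simp: C_nested_def)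
    then have "seq_prod I ?c r \<in> rep (inv_into UNIV ?u \<circ> vF r \<circ> ?w) <#\<^bsub>N\<^esub> K"
      unfolding eq using uw by (intro rep_coset_mult W_closed(2))
    moreover have "inv_into UNIV ?u \<circ> vF r \<circ> ?w = v r"
      using W_bij [OF uw(1)] W_bij [OF uw(2)]
      by (simp add: v_proj_def fun_eq_iff bij_is_inj)
    ultimately show ?thesis
      by simp
  qed
  then show "?c \<in> balanced_seqs"
    using entry blocks by (auto simp: balanced_def C_nested_def glue_def)
  show "seq_proj I v fs ?c = x"
    by (rule sx)
qed

lemma glue_blocks:
  assumes "c \<in> balanced_seqs"
  shows "glue (seq_proj I v fs c) (\<lambda>j\<in>{..<length fs}. restrict c (blk j)) = c"
proof
  fix i
  show "glue (seq_proj I v fs c) (\<lambda>j\<in>{..<length fs}. restrict c (blk j)) i = c i"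
  proof (cases "i \<in> I")
    case True
    then show ?thesis
    proof (cases rule: I_cases)
      case index
      then show ?thesis
        using partial_rep_invertible(1) [of i]
        by (simp add: glue_J seq_proj_def rep_upto_before_prod matrix_group_simps)
    qed (simp add: glue_block)
  next
    case False
    then show ?thesis
      using nested_ext [OF balanced_nested [OF assms]] by (simp add: glue_def extensional_def)
  qed
qed

lemma restrict_balanced_block:
  assumes "c \<in> balanced_seqs" "j < length fs"
  shows "restrict c (blk j) \<in> balanced_block j"
  using assms restrict_block_seqs [OF balanced_nested [OF assms(1)]]
  by (simp add: seq_prod_restrict [OF subset_refl blk_I] balanced_block_def balanced_def)

text \<open>As both families are balanced, a gauge element relating them on a block is 1 at its last
  index. Extended by 1 over \<open>J\<close>, it therefore has no influence on what follows the
  block.\<close>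

lemma glue_cls_cong:
  assumes x: "x \<in> C_nested J sF RF vF"
    and d: "\<And>j. j < length fs \<Longrightarrow> d j \<in> balanced_block j" "\<And>j. j < length fs \<Longrightarrow> d' j \<in> balanced_block j"
    and cls: "\<And>j. j < length fs \<Longrightarrow> cls (blk j) (d j) = cls (blk j) (d' j)"
  shows "cls I (glue x d) = cls I (glue x d')"
proof -
  have "\<exists>k. k \<in> K_seq (blk j) \<and> d' j = act (blk j) (d j) k" if "j < length fs" for j
  proof -
    have "d' j \<in> extensional (blk j)"
      using d(2) [OF that] by (auto simp: balanced_block_def C_nested_def PiE_def)
    from cls_eqD [OF finite_blk this cls [OF that]] show ?thesis
      by blast
  qed
  then obtain \<kappa> where \<kappa>: "\<And>j. j < length fs \<Longrightarrow> \<kappa> j \<in> K_seq (blk j)"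
    "\<And>j. j < length fs \<Longrightarrow> d' j = act (blk j) (d j) (\<kappa> j)"
    by metis
  define k where "k = (\<lambda>i\<in>I. if i \<in> J then mat 1 else \<kappa> (block_index i) i)"
  have k_J: "k i = mat 1" if "i \<in> J" for i
    using that J_I by (auto simp: k_def)
  have k_blk: "k i = \<kappa> j i" if "j < length fs" "i \<in> blk j" for i j
    using that J_not_block [of i "fs ! j"] blk_I by (auto simp: k_def block_index)
  have k_end: "k (snd f) = mat 1" if f: "f \<in> set fs" for f
  proof -
    obtain j where j: "j < length fs" "f = fs ! j"
      using f by (metis in_set_conv_nth)
    have "rep (v f) = rep (v f) ** \<kappa> j (snd f)"
      using seq_prod_blk_act [OF j(1) \<kappa>(1) [OF j(1)], of "d j"] d(1) [OF j(1)] d(2) [OF j(1)] \<kappa>(2) [OF j(1)] j(2)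
      by (simp add: balanced_block_def)
    then have "\<kappa> j (snd f) = mat 1"
      using matrix_left_cancel [OF rep_v_invertible [OF f], of "mat 1" "\<kappa> j (snd f)"] by simp
    then show ?thesis
      using k_blk [OF j(1), of "snd f"] block_ends [OF f] j(2) by simp
  qed
  have k_boundary: "k p = mat 1" if "p \<in> boundary" for p
    using that k_J k_end by (auto simp: boundary_def)
  have prev: "prev_entry I k b = mat 1" if b: "b \<in> J \<or> b \<in> fst ` set fs" for b
  proof -
    have "b \<in> I"
      using b J_I block_I by auto
    with finite_I show ?thesis
    proof (cases rule: chain_pred_cases)
      case (step p)
      have "p \<in> boundary"
        using step b by (intro pred_boundary) auto
      then show ?thesis
        by (simp add: prev_entry_step [OF finite_I step(1,3)] k_boundary)
    qed (simp add: prev_entry_first)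
  qed
  have kK: "k \<in> K_seq I"
  proof (rule PiE_I)
    fix i assume "i \<in> I"
    then show "k i \<in> K"
    proof (cases rule: I_cases)
      case (block j)
      then show ?thesis
        using \<kappa>(1) [OF block(1)] k_blk by auto
    qed (simp add: k_J K_closed)
  qed (simp add: k_def)
  have "glue x d' = act I (glue x d) k"
  proof
    fix i
    show "glue x d' i = act I (glue x d) k i"
    proof (cases "i \<in> I")
      case True
      then show ?thesis
      proof (cases rule: I_cases)
        case index
        then show ?thesis
          using True prev [of i] k_J [of i] by (simp add: act_def glue_J)
      next
        case (block j)
        have "restrict (act I (glue x d) k) (blk j) =
            act (blk j) (restrict (glue x d) (blk j)) (restrict k (blk j))"
          using block(1) prev by (intro restrict_act_block) auto
        also have "restrict (glue x d) (blk j) = d j"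
          using d(1) [OF block(1)]
          by (intro restrict_glue [OF block(1)]) (auto simp: balanced_block_def C_nested_def PiE_def)
        also have "restrict k (blk j) = \<kappa> j"
          using k_blk [OF block(1)] \<kappa>(1) [OF block(1)] by (auto simp: fun_eq_iff PiE_def extensional_def)
        also have "act (blk j) (d j) (\<kappa> j) = d' j"
          using \<kappa>(2) [OF block(1)] by simp
        finally show ?thesis
          using glue_block [OF block(1,2), of x d'] block(2) by (metis restrict_apply')
      qed
    qed (simp add: glue_def act_def)
  qed
  then show ?thesis
    using cls_act [OF finite_I kK, of "glue x d"] by (simp add: glue_def)
qed

subsection \<open>Local triviality\<close>

lemma continuous_map_seq_prod:
  assumes "finite S" "\<And>i. i \<in> S \<Longrightarrow> continuous_map T' euclidean (\<lambda>x. c x i)"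
  shows "continuous_map T' euclidean (\<lambda>x. seq_prod S (c x) r)"
  unfolding seq_prod_chain_prod using assms by (intro continuous_map_chain_prod) (auto simp: ivl_def)

lemma continuous_map_before_through:
  assumes "\<And>i. i \<in> I \<Longrightarrow> continuous_map T' euclidean (\<lambda>x. c x i)"
  shows "continuous_map T' euclidean (\<lambda>x. before_prod (seq_prod I (c x)) i)"
    "continuous_map T' euclidean (\<lambda>x. through_prod (seq_prod I (c x)) i)"
proof -
  have *: "continuous_map T' euclidean (\<lambda>x. mprod (map (seq_prod I (c x)) rs))" for rs
  proof -
    have "continuous_map T' euclidean (\<lambda>x. mprod (map (\<lambda>f. f x) (map (\<lambda>r x. seq_prod I (c x) r) rs)))"
      by (rule continuous_map_mprod) (use assms finite_I in \<open>auto intro: continuous_map_seq_prod\<close>)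
    then show ?thesis
      by (simp add: o_def)
  qed
  show "continuous_map T' euclidean (\<lambda>x. before_prod (seq_prod I (c x)) i)"
    "continuous_map T' euclidean (\<lambda>x. through_prod (seq_prod I (c x)) i)"
    unfolding before_prod_def through_prod_def by (rule *)+
qed

lemma continuous_map_proj_seq:
  assumes "\<And>i. i \<in> I \<Longrightarrow> continuous_map T' euclidean (\<lambda>x. c x i)"
    "\<And>x. x \<in> topspace T' \<Longrightarrow> c x \<in> nested_seqs" "i \<in> J"
  shows "continuous_map T' euclidean (\<lambda>x. proj_seq (c x) i)"
proof -
  have "i \<in> I"
    using assms(3) J_I by blast
  then have "continuous_map T' euclidean (\<lambda>x. before_prod (seq_prod I (c x)) i ** c x i **
      matrix_inv (before_prod (seq_prod I (c x)) i))"
    using assms(1,2) nested_invertible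
    by (intro continuous_map_matrix_mult continuous_map_matrix_inv continuous_map_before_through)
      (auto intro: partial_seq_invertible)
  then show ?thesis
    using assms(3) by (simp add: proj_seq_def)
qed

lemma continuous_map_gauge:
  assumes "\<And>i. i \<in> I \<Longrightarrow> continuous_map T' euclidean (\<lambda>x. c x i)"
    "\<And>x. x \<in> topspace T' \<Longrightarrow> c x \<in> nested_seqs"
    "\<And>i. i \<in> J \<Longrightarrow> continuous_map T' euclidean (\<lambda>x. k x i)" "i \<in> I"
  shows "continuous_map T' euclidean (\<lambda>x. gauge (c x) (k x) i)"
proof -
  have "continuous_map T' euclidean (\<lambda>x. cur_entry (k x) i)"
  proof (cases "{j \<in> J. j \<le> i} = {}")
    case True
    then show ?thesis
      unfolding cur_entry_def if_P [OF True] by simp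
  next
    case False
    then have "Max {j \<in> J. j \<le> i} \<in> {j \<in> J. j \<le> i}"
      using finite_J by (intro Max_in) auto
    then show ?thesis
      unfolding cur_entry_def if_not_P [OF False] using assms(3) by blast
  qed
  then have "continuous_map T' euclidean (\<lambda>x. matrix_inv (through_prod (seq_prod I (c x)) i) **
      cur_entry (k x) i ** through_prod rep_v i)"
    using assms(1,2) nested_invertible
    by (intro continuous_map_matrix_mult continuous_map_matrix_inv continuous_map_before_through)
      (auto intro: partial_seq_invertible)
  then show ?thesis
    using assms(4) by (simp add: gauge_def)
qed

lemma continuous_map_balance_block:
  assumes "\<And>i. i \<in> blk j \<Longrightarrow> continuous_map T' euclidean (\<lambda>x. d x i)"
    "\<And>x. x \<in> topspace T' \<Longrightarrow> d x \<in> block_seqs j" "j < length fs" "i \<in> blk j"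
  shows "continuous_map T' euclidean (\<lambda>x. balance_block j (d x) i)"
  unfolding balance_block_def
proof (rule continuous_map_act [OF finite_blk])
  fix i assume i: "i \<in> blk j"
  show "continuous_map T' euclidean (\<lambda>x. (\<lambda>i\<in>blk j. if i = snd (fs ! j)
      then matrix_inv (seq_prod (blk j) (d x) (fs ! j)) ** rep (v (fs ! j)) else mat 1) i)"
  proof (cases "i = snd (fs ! j)")
    case True
    have "continuous_map T' euclidean (\<lambda>x. matrix_inv (seq_prod (blk j) (d x) (fs ! j)) ** rep (v (fs ! j)))"
      using assms(1,2) block_prod_invertible(1) [OF assms(3)]
      by (intro continuous_map_matrix_mult continuous_map_matrix_inv continuous_map_seq_prod finite_blk) auto
    then show ?thesis
      using True i by simp
  qed (use i in simp)
next
  fix x assume "x \<in> topspace T'"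
  then show "(\<lambda>i\<in>blk j. if i = snd (fs ! j)
      then matrix_inv (seq_prod (blk j) (d x) (fs ! j)) ** rep (v (fs ! j)) else mat 1) \<in> K_seq (blk j)"
    using block_prod_invertible(3) [OF assms(3) assms(2)] K_closed(3) by auto
qed (use assms in auto)

lemma glue_cong:
  assumes "\<And>j. j < length fs \<Longrightarrow> d j = d' j"
  shows "glue x d = glue x d'"
proof
  fix i
  show "glue x d i = glue x d' i"
  proof (cases "i \<in> I")
    case True
    then show ?thesis
      by (cases rule: I_cases) (use assms in \<open>simp_all add: glue_J glue_block\<close>)
  qed (simp add: glue_def)
qed

lemma BS_nested_quotient:
  fixes S :: "'i set"
  assumes "finite S" "A \<subseteq> C_seq S t" "\<And>c k. c \<in> A \<Longrightarrow> k \<in> K_seq S \<Longrightarrow> act S c k \<in> A"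
  shows "quotient_map (subtopology (C_seq_topology S t) A) (subtopology (BS S t) (cls S ` A)) (cls S)"
  using quotient_map_cls_saturated [OF assms] by (intro continuous_open_imp_quotient_map)

lemma C_nested_C_seq: "C_nested S t Q u \<subseteq> C_seq S t"
  by (auto simp: C_nested_def)

lemma nested_act: "c \<in> nested_seqs \<Longrightarrow> k \<in> K_seq I \<Longrightarrow> act I c k \<in> nested_seqs"
  using C_nested_act [OF finite_I nested] v_W by blast

lemma projected_act: "x \<in> C_nested J sF RF vF \<Longrightarrow> k \<in> K_seq J \<Longrightarrow> act J x k \<in> C_nested J sF RF vF"
  using C_nested_act [OF finite_J nested_projected] vF_W by blast

lemma block_act: "d \<in> block_seqs j \<Longrightarrow> k \<in> K_seq (blk j) \<Longrightarrow> act (blk j) d k \<in> block_seqs j"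
  using C_nested_act [OF finite_blk nested_blk] v_W by (auto simp: subs_def)

lemma continuous_map_subtopology_entry:
  "i \<in> S \<Longrightarrow> continuous_map (subtopology (C_seq_topology S t) A) euclidean (\<lambda>c. c i)"
  by (intro continuous_map_from_subtopology continuous_map_C_seq_entry)

lemma continuous_map_into_nested:
  assumes "\<And>x. x \<in> topspace T' \<Longrightarrow> f x \<in> A" "A \<subseteq> C_seq S t"
    "\<And>i. i \<in> S \<Longrightarrow> continuous_map T' euclidean (\<lambda>x. f x i)"
  shows "continuous_map T' (subtopology (C_seq_topology S t) A) f"
  using assms continuous_map_into_C_seq [of T' f S t] by (auto simp: continuous_map_in_subtopology)

section \<open>Total space, base and fibre\<close>

abbreviation total :: "('i \<Rightarrow> complex^'n^'n) set topology" where
  "total \<equiv> BS_nested I s R v"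

abbreviation base :: "('i \<Rightarrow> complex^'n^'n) set topology" where
  "base \<equiv> BS_nested J sF RF vF"

abbreviation fibre :: "(nat \<Rightarrow> ('i \<Rightarrow> complex^'n^'n) set) topology" where
  "fibre \<equiv> product_topology (\<lambda>j. BS_nested (blk j) s (Rb j) v) {..<length fs}"

abbreviation projection :: "('i \<Rightarrow> complex^'n^'n) set \<Rightarrow> ('i \<Rightarrow> complex^'n^'n) set" where
  "projection \<equiv> proj I s R v fs"

abbreviation projected_seqs :: "('i \<Rightarrow> complex^'n^'n) set" where
  "projected_seqs \<equiv> C_nested J sF RF vF"

lemma topspace_BS_nested: "topspace (BS_nested S t Q u) = cls S ` C_nested S t Q u"
  by (simp add: BS_nested_def Int_absorb1 [OF image_mono [OF C_nested_C_seq]])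

lemma topspace_C_nested: "topspace (subtopology (C_seq_topology S t) (C_nested S t Q u)) = C_nested S t Q u"
  by (simp add: Int_absorb1 [OF C_nested_C_seq])

text \<open>On sequences the projection is the continuous map \<open>proj_seq\<close>, and
  continuity descends along the quotient map \<open>cls I\<close>.\<close>

lemma continuous_map_projection: "continuous_map total base projection"
proof -
  let ?T = "subtopology (C_seq_topology I s) nested_seqs"
  let ?TB = "subtopology (C_seq_topology J sF) projected_seqs"
  have q: "quotient_map ?T total (cls I)" "quotient_map ?TB base (cls J)"
    unfolding BS_nested_def
    using BS_nested_quotient [OF finite_I C_nested_C_seq nested_act]
      BS_nested_quotient [OF finite_J C_nested_C_seq projected_act] by blast+
  have "continuous_map ?T ?TB proj_seq"
    by (intro continuous_map_into_nested continuous_map_proj_seq continuous_map_subtopology_entry C_nested_C_seq)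
      (simp_all only: topspace_C_nested proj_seq_nested)
  then have "continuous_map ?T base (cls J \<circ> proj_seq)"
    using quotient_imp_continuous_map [OF q(2)] by (rule continuous_map_compose)
  then have "continuous_map ?T base (projection \<circ> cls I)"
    by (rule continuous_map_eq) (simp add: proj_cls)
  then show ?thesis
    using continuous_compose_quotient_map_eq [OF q(1)] by blast
qed

lemma local_triviality:
  assumes "b\<^sub>0 \<in> topspace base"
  shows "\<exists>U \<theta>. openin base U \<and> b\<^sub>0 \<in> U \<and>
    homeomorphic_map (subtopology total {e \<in> topspace total. projection e \<in> U})
      (prod_topology (subtopology base U) fibre) \<theta> \<and>
    (\<forall>e\<in>topspace total. projection e \<in> U \<longrightarrow> fst (\<theta> e) = projection e)"
proof -
  let ?n = "length fs"
  obtain x\<^sub>0 where x0: "x\<^sub>0 \<in> projected_seqs" "b\<^sub>0 = cls J x\<^sub>0"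
    using assms unfolding topspace_BS_nested by auto
  then have "x\<^sub>0 \<in> C_seq J sF"
    using C_nested_C_seq by blast
  from local_gauge [OF finite_J this] obtain V \<gamma> where
    V: "openin (C_seq_topology J sF) V" "x\<^sub>0 \<in> V"
    and cont_\<gamma>: "\<And>i. i \<in> J \<Longrightarrow> continuous_map (subtopology (C_seq_topology J sF) V) euclidean (\<lambda>x. \<gamma> x i)"
    and \<gamma>_K: "\<And>x. x \<in> V \<Longrightarrow> \<gamma> x \<in> K_seq J"
    and V_act: "\<And>x k. x \<in> V \<Longrightarrow> k \<in> K_seq J \<Longrightarrow> act J x k \<in> V"
    and \<gamma>_act: "\<And>x k i. x \<in> V \<Longrightarrow> k \<in> K_seq J \<Longrightarrow> i \<in> J \<Longrightarrow> \<gamma> (act J x k) i = matrix_inv (k i) ** \<gamma> x i"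
    by metis
  \<comment> \<open>\<open>VB\<close> and \<open>VE\<close> are saturated, so their images carry the
    quotient topologies.\<close>
  define VB where "VB = V \<inter> projected_seqs"
  define VE where "VE = {c \<in> nested_seqs. proj_seq c \<in> V}"
  define U where "U = cls J ` VB"
  have VB_sub: "VB \<subseteq> C_seq J sF" "VB \<subseteq> projected_seqs"
    using C_nested_C_seq [of J sF RF vF] unfolding VB_def by blast+
  have VE_sub: "VE \<subseteq> C_seq I s" "VE \<subseteq> nested_seqs"
    using C_nested_C_seq [of I s R v] unfolding VE_def by blast+
  have ext_VB: "x \<in> extensional J" if "x \<in> projected_seqs" for x
    using that by (auto simp: C_nested_def PiE_def)
  have VB_act: "act J x k \<in> VB" if "x \<in> VB" "k \<in> K_seq J" for x k
    using that V_act projected_act by (auto simp: VB_def)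
  have VB_cls: "y \<in> VB" if y: "y \<in> projected_seqs" "cls J y \<in> U" for y
  proof -
    obtain x where x: "x \<in> VB" "cls J x = cls J y"
      using y by (auto simp: U_def)
    obtain k where "k \<in> K_seq J" "y = act J x k"
      using cls_eqD [OF finite_J ext_VB [OF y(1)] x(2)] .
    then show ?thesis
      using VB_act x by blast
  qed
  have VE_proj: "c \<in> VE \<longleftrightarrow> projection (cls I c) \<in> U" if "c \<in> nested_seqs" for c
    using that VB_cls [OF proj_seq_nested [OF that]] proj_seq_nested [OF that]
    by (auto simp: VE_def proj_cls U_def VB_def)
  have VE_act: "act I c k \<in> VE" if "c \<in> VE" "k \<in> K_seq I" for c k
  proof -
    have c: "c \<in> nested_seqs" "act I c k \<in> nested_seqs"
      using that VE_sub nested_act by auto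
    then have "projection (cls I (act I c k)) \<in> U"
      using VE_proj [OF c(1)] that cls_act [OF finite_I that(2) nested_ext [OF c(1)]] by simp
    then show ?thesis
      using VE_proj [OF c(2)] by simp
  qed
  have preimage: "{e \<in> topspace total. projection e \<in> U} = cls I ` VE"
    unfolding topspace_BS_nested using VE_proj VE_sub by blast
  \<comment> \<open>If \<open>k\<close> moves \<open>x\<close>, then \<gamma> changes by the inverse
    of \<open>k\<close>, which undoes the move. So \<open>N\<close> is constant on classes.\<close>
  define N where "N x = act J x (\<gamma> x)" for x
  have N_VB: "N x \<in> VB" if "x \<in> VB" for x
    using that VB_act \<gamma>_K by (auto simp: N_def VB_def)
  have N_cls: "cls J (N x) = cls J x" if "x \<in> VB" for x
    using that cls_act [OF finite_J \<gamma>_K] ext_VB by (auto simp: N_def VB_def)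
  have N_cong: "N x = N y" if xy: "x \<in> VB" "y \<in> VB" "cls J x = cls J y" for x y
  proof -
    have xV: "x \<in> V" and yB: "y \<in> projected_seqs"
      using xy by (auto simp: VB_def)
    obtain k where k: "k \<in> K_seq J" "y = act J x k"
      using cls_eqD [OF finite_J ext_VB [OF yB] xy(3)] .
    have "(\<lambda>i\<in>J. k i ** \<gamma> y i) = \<gamma> x"
    proof
      fix i
      show "(\<lambda>i\<in>J. k i ** \<gamma> y i) i = \<gamma> x i"
        using \<gamma>_act [OF xV k(1)] K_seq_invertible(1) [OF finite_J k(1)] PiE_arb [OF \<gamma>_K [OF xV]]
        by (cases "i \<in> J") (simp_all add: k(2) matrix_inv_cancel_left)
    qed
    moreover have "\<gamma> y \<in> K_seq J"
      using \<gamma>_K xy(2) by (auto simp: VB_def)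
    then have "N y = act J x (\<lambda>i\<in>J. k i ** \<gamma> y i)"
      unfolding N_def by (subst (1) k(2)) (rule act_act [OF finite_J k(1)])
    ultimately show ?thesis
      by (simp add: N_def)
  qed
  have \<gamma>_N: "\<gamma> (N x) = (\<lambda>i\<in>J. mat 1)" if "x \<in> VB" for x
  proof
    fix i
    have xV: "x \<in> V" "N x \<in> V"
      using that N_VB by (auto simp: VB_def)
    show "\<gamma> (N x) i = (\<lambda>i\<in>J. mat 1) i"
      using \<gamma>_act [OF xV(1) \<gamma>_K [OF xV(1)]] K_seq_invertible(1) [OF finite_J \<gamma>_K [OF xV(1)]]
        PiE_arb [OF \<gamma>_K [OF xV(2)]]
      by (cases "i \<in> J") (simp_all add: N_def matrix_inv_left)
  qed
  \<comment> \<open>A balanced representative of the class of \<open>c\<close>, with projected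
    sequence in normal form.\<close>
  define star where "star c = act I c (gauge c (\<gamma> (proj_seq c)))" for c
  have VE: "c \<in> nested_seqs" "proj_seq c \<in> VB" "\<gamma> (proj_seq c) \<in> K_seq J" if "c \<in> VE" for c
    using that \<gamma>_K proj_seq_nested by (auto simp: VE_def VB_def)
  have star: "star c \<in> balanced_seqs" "cls I (star c) = cls I c" "seq_proj I v fs (star c) = N (proj_seq c)"
    if "c \<in> VE" for c
    unfolding star_def N_def
    using normalise_balanced [OF VE(1,3) [OF that]] proj_normalise [OF VE(1,3) [OF that]]
      cls_act [OF finite_I gauge_K [OF VE(1,3) [OF that]] nested_ext [OF VE(1) [OF that]]] by auto
  \<comment> \<open>The first component stays \<open>proj_seq c\<close>, whose class is the
    projection of that of \<open>c\<close>. Conversely \<open>ghat\<close> normalises and balances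
    its arguments itself, and so is defined on arbitrary representatives of a point of the base and
    of the fibre.\<close>
  define fhat where "fhat c = (proj_seq c, \<lambda>j\<in>{..<?n}. restrict (star c) (blk j))" for c
  define ghat where "ghat z = glue (N (fst z)) (\<lambda>j. balance_block j (snd z j))" for z
  define qD where "qD z = (cls J (fst z), \<lambda>j\<in>{..<?n}. cls (blk j) (snd z j))"
    for z :: "('i \<Rightarrow> complex^'n^'n) \<times> (nat \<Rightarrow> 'i \<Rightarrow> complex^'n^'n)"
  let ?E = "subtopology (C_seq_topology I s) VE"
  let ?E' = "subtopology (BS I s) (cls I ` VE)"
  let ?B = "subtopology (C_seq_topology J sF) VB"
  let ?B' = "subtopology (BS J sF) (cls J ` VB)"
  let ?Y = "\<lambda>j. subtopology (C_seq_topology (blk j) s) (block_seqs j)"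
  let ?D = "prod_topology ?B (product_topology ?Y {..<?n})"
  let ?P = "prod_topology ?B' fibre"
  have topE: "topspace ?E = VE"
    using VE_sub by auto
  have topY: "topspace (?Y j) = block_seqs j" for j
    by (rule topspace_C_nested)
  have topB: "topspace ?B = VB"
    using VB_sub(1) by (simp add: Int_absorb1)
  have topD: "z \<in> topspace ?D \<longleftrightarrow> fst z \<in> VB \<and> snd z \<in> PiE {..<?n} block_seqs" for z
    unfolding topspace_prod_topology topspace_product_topology topY topB mem_Times_iff o_def by simp
  have qE: "quotient_map ?E ?E' (cls I)"
    by (rule BS_nested_quotient [OF finite_I VE_sub(1) VE_act])
  have qD: "quotient_map ?D ?P qD"
  proof -
    note B = quotient_map_cls_saturated [OF finite_J VB_sub(1) VB_act]
    note Y = quotient_map_cls_saturated [OF finite_blk C_nested_C_seq block_act, folded BS_nested_def]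
    let ?qY = "\<lambda>d. \<lambda>j\<in>{..<?n}. cls (blk j) (d j)"
    \<comment> \<open>Openness in each factor is what makes \<open>qD\<close> a quotient
      map.\<close>
    have open_Y: "open_map (product_topology ?Y {..<?n}) fibre ?qY"
      by (rule open_map_product_maps) (use Y(1,3) in auto)
    have cont_Y: "continuous_map (product_topology ?Y {..<?n}) fibre ?qY"
      unfolding continuous_map_componentwise
    proof (intro conjI ballI)
      fix j assume j: "j \<in> {..<?n}"
      have "continuous_map (product_topology ?Y {..<?n}) (BS_nested (blk j) s (Rb j) v) (cls (blk j) \<circ> (\<lambda>d. d j))"
        by (rule continuous_map_compose [OF continuous_map_product_projection [OF j] Y(2)])
      then show "continuous_map (product_topology ?Y {..<?n}) (BS_nested (blk j) s (Rb j) v) (\<lambda>d. ?qY d j)"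
        using j by (simp add: o_def)
    qed auto
    have surj_Y: "?qY ` topspace (product_topology ?Y {..<?n}) = topspace fibre"
    proof (intro equalityI subsetI)
      fix y assume y: "y \<in> topspace fibre"
      have "\<exists>d. d \<in> topspace (?Y j) \<and> y j = cls (blk j) d" if "j \<in> {..<?n}" for j
      proof -
        have "y j \<in> topspace (BS_nested (blk j) s (Rb j) v)"
          using PiE_mem [OF y [unfolded topspace_product_topology o_def] that] .
        then show ?thesis
          unfolding topspace_BS_nested topY by blast
      qed
      then have "\<forall>j\<in>{..<?n}. \<exists>d. d \<in> topspace (?Y j) \<and> y j = cls (blk j) d"
        by blast
      from bchoice [OF this] obtain d where d: "\<forall>j\<in>{..<?n}. d j \<in> topspace (?Y j) \<and> y j = cls (blk j) (d j)"
        by blast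
      have "y = ?qY (restrict d {..<?n})"
      proof
        fix j
        show "y j = ?qY (restrict d {..<?n}) j"
          using d PiE_arb [OF y [unfolded topspace_product_topology o_def], of j]
          by (cases "j \<in> {..<?n}") simp_all
      qed
      moreover have "restrict d {..<?n} \<in> topspace (product_topology ?Y {..<?n})"
        using d by (auto simp: PiE_iff)
      ultimately show "y \<in> ?qY ` topspace (product_topology ?Y {..<?n})"
        by (rule image_eqI)
    qed (use continuous_map_funspace [OF cont_Y] in auto)
    have qD_eq: "qD = (\<lambda>(x, d). (cls J x, ?qY d))"
      by (auto simp: qD_def)
    show ?thesis
    proof (rule continuous_open_imp_quotient_map)
      show "open_map ?D ?P qD"
        unfolding qD_eq by (rule open_map_prod_maps [OF B(1) open_Y])
      have "continuous_map ?D ?P (\<lambda>z. (cls J (fst z), ?qY (snd z)))"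
        using continuous_map_compose [OF continuous_map_fst B(2), of "product_topology ?Y {..<?n}"]
          continuous_map_compose [OF continuous_map_snd cont_Y, of ?B]
        by (intro continuous_map_pairedI) (simp_all add: o_def)
      then show "continuous_map ?D ?P qD"
        by (simp add: qD_def [abs_def])
      have "qD ` topspace ?D = (cls J ` topspace ?B) \<times> (?qY ` topspace (product_topology ?Y {..<?n}))"
        unfolding qD_eq topspace_prod_topology by (auto simp: image_iff)
      also have "\<dots> = topspace ?P"
        by (simp only: surj_Y B(3) topspace_prod_topology)
      finally show "qD ` topspace ?D = topspace ?P" .
    qed
  qed
  have fhat_D: "fhat c \<in> topspace ?D" if "c \<in> VE" for c
    unfolding topD fhat_def
    using VE(2) [OF that] restrict_block_seqs [OF balanced_nested [OF star(1) [OF that]]] by auto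
  have balance_d: "balance_block j (snd z j) \<in> balanced_block j"
    "cls (blk j) (balance_block j (snd z j)) = cls (blk j) (snd z j)"
    if "z \<in> topspace ?D" "j < ?n" for z j
    using balance_block [OF that(2)] that topD by (auto simp: PiE_iff)
  have ghat: "ghat z \<in> balanced_seqs" "seq_proj I v fs (ghat z) = N (fst z)" "ghat z \<in> VE"
    if z: "z \<in> topspace ?D" for z
  proof -
    have N: "N (fst z) \<in> VB"
      using z topD N_VB by blast
    then have "N (fst z) \<in> projected_seqs"
      using VB_sub by blast
    from glue_balanced [OF this, of "\<lambda>j. balance_block j (snd z j)"] balance_d(1) [OF z]
    show *: "ghat z \<in> balanced_seqs" "seq_proj I v fs (ghat z) = N (fst z)"
      by (auto simp: ghat_def)
    then show "ghat z \<in> VE"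
      using N proj_seq_balanced [OF *(1)] balanced_nested [OF *(1)] by (simp add: VE_def VB_def)
  qed
  have fhat_cong: "qD (fhat c) = qD (fhat c')" if c: "c \<in> VE" "c' \<in> VE" "cls I c = cls I c'" for c c'
  proof -
    have eq: "cls J (proj_seq c) = cls J (proj_seq c')"
      using proj_seq_cls_cong VE(1) c by blast
    have "seq_proj I v fs (star c) = seq_proj I v fs (star c')"
      using star(3) c N_cong [OF VE(2) VE(2) eq] by simp
    then have "cls (blk j) (restrict (star c) (blk j)) = cls (blk j) (restrict (star c') (blk j))"
      if "j < ?n" for j
      using balanced_blocks_cong [OF star(1) [OF c(1)] star(1) [OF c(2)] _ _ that] star(2) c by simp
    then have "(\<lambda>j\<in>{..<?n}. cls (blk j) (snd (fhat c) j)) = (\<lambda>j\<in>{..<?n}. cls (blk j) (snd (fhat c') j))"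
      by (intro restrict_ext) (simp add: fhat_def)
    then show ?thesis
      unfolding qD_def by (simp add: fhat_def eq)
  qed
  have ghat_cong: "cls I (ghat z) = cls I (ghat z')"
    if z: "z \<in> topspace ?D" "z' \<in> topspace ?D" "qD z = qD z'" for z z'
  proof -
    have "cls J (fst z) = cls J (fst z')"
      using z(3) by (simp add: qD_def)
    then have N: "N (fst z) = N (fst z')"
      using N_cong topD z by blast
    have "cls (blk j) (snd z j) = cls (blk j) (snd z' j)" if "j < ?n" for j
    proof -
      have "snd (qD z) j = snd (qD z') j"
        using z(3) by simp
      then show ?thesis
        using that by (simp add: qD_def)
    qed
    moreover have "N (fst z') \<in> projected_seqs"
      using N_VB VB_sub(2) topD z(2) by blast
    ultimately show ?thesis
      unfolding ghat_def N using balance_d z(1,2) by (intro glue_cls_cong) auto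
  qed
  have ghat_fhat: "cls I (ghat (fhat c)) = cls I c" if c: "c \<in> VE" for c
  proof -
    have "ghat (fhat c) = glue (seq_proj I v fs (star c)) (\<lambda>j\<in>{..<?n}. restrict (star c) (blk j))"
      unfolding ghat_def star(3) [OF c]
      using balance_block_balanced restrict_balanced_block [OF star(1) [OF c]]
      by (simp add: fhat_def) (rule glue_cong, simp)
    also have "\<dots> = star c"
      by (rule glue_blocks [OF star(1) [OF c]])
    finally show ?thesis
      using star(2) [OF c] by simp
  qed
  have fhat_ghat: "qD (fhat (ghat z)) = qD z" if z: "z \<in> topspace ?D" for z
  proof -
    have fz: "fst z \<in> VB"
      using z topD by blast
    have p: "proj_seq (ghat z) = N (fst z)"
      using proj_seq_balanced [OF ghat(1) [OF z]] ghat(2) [OF z] by simp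
    \<comment> \<open>A glued sequence is balanced and projects to a normal form, on which \<gamma>
      is 1. Its normalising gauge is therefore trivial, and the restrictions to the blocks recover
      the glued data.\<close>
    have "star (ghat z) = act I (ghat z) (\<lambda>i\<in>I. mat 1)"
      unfolding star_def p \<gamma>_N [OF fz] gauge_balanced_one [OF ghat(1) [OF z]] ..
    also have "\<dots> = ghat z"
      by (rule act_one [OF finite_I nested_ext [OF balanced_nested [OF ghat(1) [OF z]]]])
    finally have star_g: "star (ghat z) = ghat z" .
    have "restrict (ghat z) (blk j) = balance_block j (snd z j)" if "j < ?n" for j
      unfolding ghat_def
      by (rule restrict_glue [OF that]) (simp add: balance_block_def act_def)
    then have "(\<lambda>j\<in>{..<?n}. cls (blk j) (snd (fhat (ghat z)) j)) = (\<lambda>j\<in>{..<?n}. cls (blk j) (snd z j))"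
      using balance_d(2) [OF z] by (intro restrict_ext) (simp add: fhat_def star_g)
    moreover have "cls J (fst (fhat (ghat z))) = cls J (fst z)"
      using N_cls [OF fz] by (simp add: fhat_def p)
    ultimately show ?thesis
      unfolding qD_def by simp
  qed
  have cont_E: "continuous_map ?E euclidean (\<lambda>c. c i)" if "i \<in> I" for i
    using that by (rule continuous_map_subtopology_entry)
  have cont_proj: "continuous_map ?E ?B proj_seq"
    using VE topE VB_sub(1) cont_E by (intro continuous_map_into_nested continuous_map_proj_seq) auto
  have cont_\<gamma>B: "continuous_map ?B euclidean (\<lambda>x. \<gamma> x i)" if "i \<in> J" for i
    by (rule continuous_map_from_subtopology_mono [OF cont_\<gamma> [OF that]]) (simp add: VB_def)
  have cont_star: "continuous_map ?E euclidean (\<lambda>c. star c i)" if "i \<in> I" for i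
    unfolding star_def
  proof (rule continuous_map_act [OF finite_I cont_E _ _ that])
    fix i assume "i \<in> I"
    then show "continuous_map ?E euclidean (\<lambda>c. gauge c (\<gamma> (proj_seq c)) i)"
      using VE topE cont_E continuous_map_compose [OF cont_proj cont_\<gamma>B]
      by (intro continuous_map_gauge) (auto simp: o_def)
  qed (use VE gauge_K topE in auto)
  have "continuous_map ?E ?D fhat"
    unfolding fhat_def [abs_def]
  proof (rule continuous_map_pairedI [OF cont_proj])
    show "continuous_map ?E (product_topology ?Y {..<?n}) (\<lambda>c. \<lambda>j\<in>{..<?n}. restrict (star c) (blk j))"
      unfolding continuous_map_componentwise
    proof (intro conjI ballI)
      fix j assume j: "j \<in> {..<?n}"
      have "continuous_map ?E (?Y j) (\<lambda>c. restrict (star c) (blk j))"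
      proof (rule continuous_map_into_nested)
        fix i assume "i \<in> blk j"
        then show "continuous_map ?E euclidean (\<lambda>c. restrict (star c) (blk j) i)"
          using cont_star blk_I by auto
      next
        fix c assume "c \<in> topspace ?E"
        then show "restrict (star c) (blk j) \<in> block_seqs j"
          unfolding topE by (intro restrict_block_seqs balanced_nested star(1))
      qed (rule C_nested_C_seq)
      then show "continuous_map ?E (?Y j) (\<lambda>c. (\<lambda>j\<in>{..<?n}. restrict (star c) (blk j)) j)"
        using j by simp
    qed auto
  qed
  then have cont_fhat: "continuous_map ?E ?P (qD \<circ> fhat)"
    using quotient_imp_continuous_map [OF qD] by (rule continuous_map_compose)
  have cont_fst: "continuous_map ?D euclidean (\<lambda>z. fst z i)" if "i \<in> J" for i
    using continuous_map_compose [OF continuous_map_fst continuous_map_subtopology_entry [OF that, of sF VB],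
        of "product_topology ?Y {..<?n}"] by (simp add: o_def)
  have cont_snd: "continuous_map ?D euclidean (\<lambda>z. snd z j i)" if "j < ?n" "i \<in> blk j" for i j
  proof -
    have "continuous_map ?D (?Y j) ((\<lambda>d. d j) \<circ> snd)"
      using that by (intro continuous_map_compose [OF continuous_map_snd] continuous_map_product_projection) simp
    from continuous_map_compose [OF this continuous_map_subtopology_entry [OF that(2)]] show ?thesis
      by (simp add: o_def)
  qed
  have cont_N: "continuous_map ?D euclidean (\<lambda>z. N (fst z) i)" if "i \<in> J" for i
    unfolding N_def
  proof (rule continuous_map_act [OF finite_J cont_fst _ _ that])
    fix i assume "i \<in> J"
    show "continuous_map ?D euclidean (\<lambda>z. \<gamma> (fst z) i)"
      using continuous_map_compose [OF continuous_map_fst cont_\<gamma>B [OF \<open>i \<in> J\<close>],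
          of "product_topology ?Y {..<?n}"] by (simp add: o_def)
  qed (use \<gamma>_K topD VB_def in auto)
  have "continuous_map ?D ?E ghat"
  proof (rule continuous_map_into_nested)
    fix i assume "i \<in> I"
    then show "continuous_map ?D euclidean (\<lambda>z. ghat z i)"
    proof (cases rule: I_cases)
      case index
      then show ?thesis
        unfolding ghat_def using cont_N by (auto simp: glue_J intro!: continuous_map_matrix_mult)
    next
      case (block j)
      then show ?thesis
        unfolding ghat_def using cont_snd topD
        by (auto simp: glue_block PiE_iff intro!: continuous_map_balance_block)
    qed
  qed (use ghat(3) VE_sub in auto)
  then have cont_ghat: "continuous_map ?D ?E' (cls I \<circ> ghat)"
    using quotient_imp_continuous_map [OF qE] by (rule continuous_map_compose)
  have \<theta>_cong: "(qD \<circ> fhat) c = (qD \<circ> fhat) c'" if "c \<in> topspace ?E" "c' \<in> topspace ?E" "cls I c = cls I c'" for c c'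
    using fhat_cong that topE by simp
  have "\<exists>\<theta>. continuous_map ?E' ?P \<theta> \<and> (\<forall>c\<in>topspace ?E. \<theta> (cls I c) = (qD \<circ> fhat) c)"
    by (rule quotient_map_lift [OF qE cont_fhat]) (rule \<theta>_cong)
  then obtain \<theta> where cont_\<theta>: "continuous_map ?E' ?P \<theta>"
    and \<theta>0: "\<forall>c\<in>topspace ?E. \<theta> (cls I c) = (qD \<circ> fhat) c"
    by (elim exE conjE)
  have \<theta>: "\<theta> (cls I c) = qD (fhat c)" if "c \<in> VE" for c
    using bspec [OF \<theta>0 [unfolded topE o_def] that] .
  have \<psi>_cong: "(cls I \<circ> ghat) z = (cls I \<circ> ghat) z'" if "z \<in> topspace ?D" "z' \<in> topspace ?D" "qD z = qD z'" for z z'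
    unfolding o_def by (rule ghat_cong [OF that])
  have "\<exists>\<psi>. continuous_map ?P ?E' \<psi> \<and> (\<forall>z\<in>topspace ?D. \<psi> (qD z) = (cls I \<circ> ghat) z)"
    by (rule quotient_map_lift [OF qD cont_ghat]) (rule \<psi>_cong)
  then obtain \<psi> where cont_\<psi>: "continuous_map ?P ?E' \<psi>"
    and \<psi>0: "\<forall>z\<in>topspace ?D. \<psi> (qD z) = (cls I \<circ> ghat) z"
    by (elim exE conjE)
  have \<psi>: "\<psi> (qD z) = cls I (ghat z)" if "z \<in> topspace ?D" for z
    using bspec [OF \<psi>0 that] by (simp only: o_def)
  have "homeomorphic_maps ?E' ?P \<theta> \<psi>"
    unfolding homeomorphic_maps_def
  proof (intro conjI cont_\<theta> cont_\<psi> ballI)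
    fix e assume "e \<in> topspace ?E'"
    then obtain c where c: "c \<in> VE" "e = cls I c"
      unfolding topspace_subtopology by blast
    show "\<psi> (\<theta> e) = e"
      unfolding c(2) \<theta> [OF c(1)] \<psi> [OF fhat_D [OF c(1)]] by (rule ghat_fhat [OF c(1)])
  next
    fix y assume "y \<in> topspace ?P"
    then obtain z where z: "z \<in> topspace ?D" "y = qD z"
      unfolding quotient_imp_surjective_map [OF qD, symmetric] by blast
    show "\<theta> (\<psi> y) = y"
      unfolding z(2) \<psi> [OF z(1)] \<theta> [OF ghat(3) [OF z(1)]] by (rule fhat_ghat [OF z(1)])
  qed
  then have hom: "homeomorphic_map ?E' ?P \<theta>"
    using homeomorphic_map_maps by blast
  \<comment> \<open>The classes of \<open>VE\<close> lie in the total space, so taking the subspace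
    in two stages or in one gives the same topology.\<close>
  have eq_E: "?E' = subtopology total {e \<in> topspace total. projection e \<in> U}"
    unfolding preimage unfolding BS_nested_def subtopology_subtopology
    using VE_sub(2) by (intro arg_cong [where f = "subtopology _"]) auto
  have eq_B: "?B' = subtopology base U"
    unfolding U_def BS_nested_def subtopology_subtopology
    using VB_sub(2) by (intro arg_cong [where f = "subtopology _"]) auto
  have open_U: "openin base U"
  proof -
    have "openin (subtopology (C_seq_topology J sF) projected_seqs) VB"
      unfolding VB_def using V(1) by (metis inf_commute openin_subtopology_Int2)
    then show ?thesis
      using quotient_map_cls_saturated(1) [OF finite_J C_nested_C_seq projected_act]
      by (simp add: open_map_def U_def BS_nested_def)
  qed
  have in_U: "b\<^sub>0 \<in> U"
    using x0 V(2) by (auto simp: U_def VB_def)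
  have fst_\<theta>: "fst (\<theta> e) = projection e" if e: "e \<in> topspace total" "projection e \<in> U" for e
  proof -
    obtain c where "c \<in> VE" "e = cls I c"
      using e preimage by blast
    then show ?thesis
      using \<theta> VE(1) by (simp add: qD_def fhat_def proj_cls)
  qed
  show ?thesis
    using hom [unfolded eq_E eq_B] open_U in_U fst_\<theta> by (intro exI [of _ U] exI [of _ \<theta>] conjI ballI impI)
qed

lemma fibre_bundle_projection: "fibre_bundle total base fibre projection"
  unfolding fibre_bundle_def using continuous_map_projection local_triviality by blast

end

theorem theorem7:
  fixes \<Phi> :: "'e::euclidean_space set"
    and X :: "'e \<Rightarrow> complex^'n^'n"
    and \<sigma> :: "complex^'n^'n \<Rightarrow> complex^'n^'n"
    and \<phi> :: "'e \<Rightarrow> complex^2^2 \<Rightarrow> complex^'n^'n"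
    and rep :: "('e \<Rightarrow> 'e) \<Rightarrow> complex^'n^'n"
    and I :: "'i::linorder set"
    and s :: "'i \<Rightarrow> 'e \<Rightarrow> 'e"
    and R F :: "('i \<times> 'i) set"
    and v :: "'i \<times> 'i \<Rightarrow> 'e \<Rightarrow> 'e"
    and fs :: "('i \<times> 'i) list"
  assumes "bott_samelson_setting \<Phi> X \<sigma> \<phi> rep"
    and "finite I"
    and "\<forall>i\<in>I. s i \<in> reflections \<Phi>"
    and "nested_structure I R"
    and "\<forall>r\<in>R. v r \<in> carrier (weyl_group \<Phi>)"
    and "F \<subseteq> R"
    and "F \<noteq> {}"
    and "\<forall>f\<in>F. \<forall>f'\<in>F. f \<noteq> f' \<longrightarrow> ivl I f \<inter> ivl I f' = {}"
    and "F = set fs"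
    and "sorted_wrt (\<lambda>f f'. snd f < fst f') fs"
  shows "fibre_bundle
    (bott_samelson_setting.BS_nested \<Phi> X \<sigma> \<phi> rep I s R v)
    (bott_samelson_setting.BS_nested \<Phi> X \<sigma> \<phi> rep
       (index_proj I fs) (s_proj fs v s) (nested_proj I R fs) (v_proj fs v))
    (product_topology
       (\<lambda>j. bott_samelson_setting.BS_nested \<Phi> X \<sigma> \<phi> rep
          (ivl I (fs ! j)) s (subs I R (fs ! j)) v)
       {..<length fs})
    (bott_samelson_setting.proj \<Phi> X \<sigma> \<phi> rep I s R v fs)"
proof -
  interpret bott_samelson_setting \<Phi> X \<sigma> \<phi> rep
    by (rule assms(1))
  interpret nested_projection \<Phi> X \<sigma> \<phi> rep I s R v fs
    by unfold_locales (use assms in auto)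
  show ?thesis
    by (rule fibre_bundle_projection)
qed

end
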